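(* Let $A$ be a finite-dimensional algebra over an algebraically closed field $\Bbbk$, given by a quiver $Q$ with vertex set $\mathbf{N}=\{1,\dots,n\}$ and relations $R$. Let $\tilde A$ be the algebra obtained from $A$ by attaching to each vertex $k$ a new vertex $\tilde k$ and an arrow $k\to\tilde k$, let $N$ be the nilpotency degree of $\mathrm{Rad}\,\tilde A$, let $\mathfrak{C}=\mathfrak{C}(\tilde A)$ (with respect to the radical filtration of $\tilde A$), and let $\mathfrak{D}=\mathfrak{D}(\tilde A)$ be the trivial extension of $\mathfrak{C}$ by its restricted dual $\mathfrak{C}^*$ (all defined in the context). Then $\mathfrak{D}$ is quasi-hereditary with respect to the second order as well, i.e. with respect to the order on $\overline{\mathbf{N}}\times\mathbb{Z}$ opposite to the first order.
   Context: $\tilde A$: the quiver of $A$ with, for each $k\in\mathbf{N}$, an additional vertex $\tilde k$ and an additional arrow $\alpha_k:k\to\tilde k$, with the same relations $R$ and no new ones. Paths are composed from right to left, so $\alpha_k\in e_{\tilde k}\tilde Ae_k$; thus $e_k\tilde A=e_kA$ and $e_{\tilde k}\tilde A=\Bbbk e_{\tilde k}\oplus\alpha_kA$ with $\alpha_kA\cong e_kA$. Put $\tilde{\mathbf{N}}=\{\tilde 1,\dots,\tilde n\}$ and $\overline{\mathbf{N}}=\mathbf{N}\cup\tilde{\mathbf{N}}$. Let $I_j=\mathrm{Rad}^j\tilde A$, so $I_{N-1}\neq0=I_N$. $\mathfrak{C}=\mathfrak{C}(\tilde A)=\bigoplus_{r,c\in\mathbb{Z}}\mathfrak{C}_{r,c}$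 is the algebra of $\mathbb{Z}\times\mathbb{Z}$-matrices with finitely many nonzero entries, where the entry in row $r$, column $c$ lies in $\mathfrak{C}_{r,c}=I_{r-c}$ if $r>c$, $\tilde A/I_{N-(c-r)}$ if $0\le c-r<N$, and $0$ if $c-r\ge N$, with multiplication induced from $\tilde A$. Let $e_{k,i}$ be the idempotent $e_k$ in matrix position $(i,i)$, $k\in\overline{\mathbf{N}}$, $i\in\mathbb{Z}$. $\mathfrak{C}^*=\bigoplus_{i,j\in\mathbb{Z};\,x,y\in\overline{\mathbf{N}}}\mathrm{Hom}_\Bbbk(e_{y,j}\mathfrak{C}e_{x,i},\Bbbk)$ with its natural $\mathfrak{C}$-bimodule structure, and $\mathfrak{D}=\mathfrak{C}\oplus\mathfrak{C}^*$ is the trivial extension, with product $(a,f)(b,g)=(ab,ag+fb)$. Modules $M$ are assumed to satisfy $M=\bigoplus e_{k,i}M$. First order on $\overline{\mathbf{N}}\times\mathbb{Z}$: $(k,i)>(l,j)$ iff $i>j$, or $i=j$, $k\in\mathbf{N}$ and $l\in\tilde{\mathbf{N}}$. The second order is its opposite: $(k,i)>(l,j)$ iff $i<j$, or $i=j$, $k\in\tilde{\mathbf{N}}$ and $l\in\mathbf{N}$. For a given order, the standard module $\Delta(\lambda)$ is the quotient of the indecomposable projective $P(\lambda)$ generated by $e_\lambda$ by the sum of images of all homomorphisms $P(\mu)\to P(\lambda)$ with $\mu>\lambda$. Quasi-hereditary: for every $\lambda$, $\mathrm{End}(\Delta(\lambda))=\Bbbk$ and $P(\lambda)$ has a finite filtration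 with top subquotient $\Delta(\lambda)$ and all other subquotients of the form $\Delta(\mu)$, $\mu>\lambda$. *)

theory Defs
  imports
    "HOL-Computational_Algebra.Polynomial"
    "HOL-Algebra.Module"
    "HOL-Algebra.QuotRing"
    "HOL-Algebra.Ideal_Product"
    "Graph_Theory.Arc_Walk"
begin

section \<open>Bound quiver algebras\<close>

text \<open>
  Algebras over a field \<open>'k\<close> are records of type \<open>('k, 'a) module\<close>; only the fields that make
  sense are specified (\<open>one\<close> is \<open>undefined\<close> for non-unital algebras).
  A finite quiver is a \<open>fin_digraph\<close>.  A path is a pair \<open>(u, p)\<close> of its starting vertex and the
  list of its arrows in the order in which they are travelled, so that the composition from
  right to left of \<open>(v, q)\<close> and \<open>(u, p)\<close> is \<open>(u, p @ q)\<close>, provided that \<open>p\<close> ends at \<open>v\<close>.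
\<close>

definition quiver_paths :: "('v, 'a) pre_digraph \<Rightarrow> ('v \<times> 'a list) set" where
  "quiver_paths Q = {(u, p). \<exists>v. pre_digraph.awalk Q u p v}"

definition path_elem :: "'v \<times> 'a list \<Rightarrow> 'v \<times> 'a list \<Rightarrow> 'k::field" where
  "path_elem x = (\<lambda>y. if y = x then 1 else 0)"

definition path_algebra :: "('v, 'a) pre_digraph \<Rightarrow> ('k::field, 'v \<times> 'a list \<Rightarrow> 'k) module" where
  "path_algebra Q = \<lparr>
     carrier = {f. finite {x. f x \<noteq> 0} \<and> {x. f x \<noteq> 0} \<subseteq> quiver_paths Q},
     mult = (\<lambda>f g (u, p). \<Sum>i\<le>length p.
               f (pre_digraph.awlast Q u (take i p), drop i p) * g (u, take i p)),
     one = (\<lambda>(u, p). if u \<in> verts Q \<and> p = [] then 1 else 0),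
     zero = (\<lambda>_. 0),
     add = (\<lambda>f g x. f x + g x),
     smult = (\<lambda>c f x. c * f x)\<rparr>"

definition arrow_ideal_power :: "('v, 'a) pre_digraph \<Rightarrow> nat \<Rightarrow> ('v \<times> 'a list \<Rightarrow> 'k::field) set" where
  "arrow_ideal_power Q m =
     {f \<in> carrier (path_algebra Q). \<forall>u p. f (u, p) \<noteq> 0 \<longrightarrow> m \<le> length p}"

text \<open>
  For a finite quiver, the quotient by an admissible ideal is finite-dimensional, being spanned
  by the finitely many paths of length less than \<open>m\<close>.
\<close>

definition admissible_ideal :: "('v, 'a) pre_digraph \<Rightarrow> ('v \<times> 'a list \<Rightarrow> 'k::field) set \<Rightarrow> bool" where
  "admissible_ideal Q I \<longleftrightarrow>
     ideal I (path_algebra Q) \<and> I \<subseteq> arrow_ideal_power Q 2 \<and> (\<exists>m\<ge>2. arrow_ideal_power Q m \<subseteq> I)"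

definition quot_algebra :: "('k, 'a) module \<Rightarrow> 'a set \<Rightarrow> ('k, 'a set) module" where
  "quot_algebra A I = \<lparr>
     carrier = carrier (A Quot I), mult = mult (A Quot I), one = one (A Quot I),
     zero = zero (A Quot I), add = add (A Quot I),
     smult = (\<lambda>c X. \<Union>x\<in>X. I +>\<^bsub>A\<^esub> (c \<odot>\<^bsub>A\<^esub> x))\<rparr>"

definition bound_quiver_algebra ::
    "('v, 'a) pre_digraph \<Rightarrow> ('v \<times> 'a list \<Rightarrow> 'k::field) set \<Rightarrow> ('k, ('v \<times> 'a list \<Rightarrow> 'k) set) module" where
  "bound_quiver_algebra Q R = quot_algebra (path_algebra Q) (Idl\<^bsub>path_algebra Q\<^esub> R)"

definition vertex_idem ::
    "('v, 'a) pre_digraph \<Rightarrow> ('v \<times> 'a list \<Rightarrow> 'k::field) set \<Rightarrow> 'v \<Rightarrow> ('v \<times> 'a list \<Rightarrow> 'k) set" where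
  "vertex_idem Q R v = (Idl\<^bsub>path_algebra Q\<^esub> R) +>\<^bsub>path_algebra Q\<^esub> path_elem (v, [])"


section \<open>Attaching an arrow to every vertex\<close>

datatype 'v tvert = Old 'v | Tilde 'v

datatype ('v, 'a) tarr = OldArr 'a | Alpha 'v

definition tilde_quiver :: "('v, 'a) pre_digraph \<Rightarrow> ('v tvert, ('v, 'a) tarr) pre_digraph" where
  "tilde_quiver Q = \<lparr>
     verts = Old ` verts Q \<union> Tilde ` verts Q,
     arcs = OldArr ` arcs Q \<union> Alpha ` verts Q,
     tail = (\<lambda>a. case a of OldArr b \<Rightarrow> Old (tail Q b) | Alpha k \<Rightarrow> Old k),
     head = (\<lambda>a. case a of OldArr b \<Rightarrow> Old (head Q b) | Alpha k \<Rightarrow> Tilde k)\<rparr>"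

definition old_path :: "'v \<times> 'a list \<Rightarrow> 'v tvert \<times> ('v, 'a) tarr list" where
  "old_path = (\<lambda>(u, p). (Old u, map OldArr p))"

definition old_elem :: "('v \<times> 'a list \<Rightarrow> 'k::field) \<Rightarrow> ('v tvert \<times> ('v, 'a) tarr list \<Rightarrow> 'k)" where
  "old_elem f = (\<lambda>x. if x \<in> range old_path then f (inv_into UNIV old_path x) else 0)"

definition tilde_algebra ::
    "('v, 'a) pre_digraph \<Rightarrow> ('v \<times> 'a list \<Rightarrow> 'k::field) set
       \<Rightarrow> ('k, ('v tvert \<times> ('v, 'a) tarr list \<Rightarrow> 'k) set) module" where
  "tilde_algebra Q R = bound_quiver_algebra (tilde_quiver Q) (old_elem ` R)"

definition tilde_idem ::
    "('v, 'a) pre_digraph \<Rightarrow> ('v \<times> 'a list \<Rightarrow> 'k::field) set \<Rightarrow> 'v tvert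
       \<Rightarrow> ('v tvert \<times> ('v, 'a) tarr list \<Rightarrow> 'k) set" where
  "tilde_idem Q R = vertex_idem (tilde_quiver Q) (old_elem ` R)"


section \<open>The radical filtration\<close>

definition left_ideal :: "'a set \<Rightarrow> ('a, 'm) ring_scheme \<Rightarrow> bool" where
  "left_ideal I R \<longleftrightarrow> additive_subgroup I R \<and> (\<forall>r\<in>carrier R. \<forall>x\<in>I. r \<otimes>\<^bsub>R\<^esub> x \<in> I)"

definition maximal_left_ideal :: "'a set \<Rightarrow> ('a, 'm) ring_scheme \<Rightarrow> bool" where
  "maximal_left_ideal I R \<longleftrightarrow> left_ideal I R \<and> I \<noteq> carrier R \<and>
     (\<forall>J. left_ideal J R \<and> I \<subseteq> J \<longrightarrow> J = I \<or> J = carrier R)"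

definition jacobson_radical :: "('a, 'm) ring_scheme \<Rightarrow> 'a set" where
  "jacobson_radical R = carrier R \<inter> \<Inter>{I. maximal_left_ideal I R}"

primrec radical_power :: "('a, 'm) ring_scheme \<Rightarrow> nat \<Rightarrow> 'a set" where
  "radical_power R 0 = carrier R"
| "radical_power R (Suc j) = radical_power R j \<cdot>\<^bsub>R\<^esub> jacobson_radical R"

definition nilpotency_degree :: "('a, 'm) ring_scheme \<Rightarrow> nat" where
  "nilpotency_degree R = (LEAST m. radical_power R m = {\<zero>\<^bsub>R\<^esub>})"


section \<open>The algebra of integer-indexed matrices\<close>

text \<open>
  The space of entries in row \<open>r\<close> and column \<open>c\<close> is the quotient \<open>entry_top / entry_bot\<close>.
  For \<open>r > c\<close> this is \<open>I\<^bsub>r-c\<^esub> / {0}\<close>, i.e. the elements of \<open>I\<^bsub>r-c\<^esub>\<close> appear as singletons;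
  for \<open>c - r \<ge> N\<close> it is \<open>A / A\<close>.
\<close>

definition entry_top :: "('k, 'a) module \<Rightarrow> int \<Rightarrow> int \<Rightarrow> 'a set" where
  "entry_top A r c = (if r > c then radical_power A (nat (r - c)) else carrier A)"

definition entry_bot :: "('k, 'a) module \<Rightarrow> int \<Rightarrow> int \<Rightarrow> 'a set" where
  "entry_bot A r c =
     (let N = int (nilpotency_degree A) in
      if r > c then {\<zero>\<^bsub>A\<^esub>}
      else if c - r < N then radical_power A (nat (N - (c - r)))
      else carrier A)"

text \<open>Only the vector space structure of the following record is meaningful.\<close>

definition entry_space :: "('k, 'a) module \<Rightarrow> int \<Rightarrow> int \<Rightarrow> ('k, 'a set) module" where
  "entry_space A r c = quot_algebra (A\<lparr>carrier := entry_top A r c\<rparr>) (entry_bot A r c)"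

definition entry_mult :: "('k, 'a) module \<Rightarrow> int \<Rightarrow> int \<Rightarrow> 'a set \<Rightarrow> 'a set \<Rightarrow> 'a set" where
  "entry_mult A r c X Y = (\<Union>x\<in>X. \<Union>y\<in>Y. entry_bot A r c +>\<^bsub>A\<^esub> (x \<otimes>\<^bsub>A\<^esub> y))"

definition matrix_algebra :: "('k, 'a) module \<Rightarrow> ('k, int \<Rightarrow> int \<Rightarrow> 'a set) module" where
  "matrix_algebra A = \<lparr>
     carrier = {M. (\<forall>r c. M r c \<in> carrier (entry_space A r c)) \<and>
                   finite {(r, c). M r c \<noteq> \<zero>\<^bsub>entry_space A r c\<^esub>}},
     mult = (\<lambda>M M' r c. finsum (entry_space A r c) (\<lambda>s. entry_mult A r c (M r s) (M' s c))
               {s. M r s \<noteq> \<zero>\<^bsub>entry_space A r s\<^esub> \<and> M' s c \<noteq> \<zero>\<^bsub>entry_space A s c\<^esub>}),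
     one = undefined,
     zero = (\<lambda>r c. \<zero>\<^bsub>entry_space A r c\<^esub>),
     add = (\<lambda>M M' r c. M r c \<oplus>\<^bsub>entry_space A r c\<^esub> M' r c),
     smult = (\<lambda>t M r c. t \<odot>\<^bsub>entry_space A r c\<^esub> M r c)\<rparr>"

definition matrix_idem :: "('k, 'a) module \<Rightarrow> ('v \<Rightarrow> 'a) \<Rightarrow> 'v \<times> int \<Rightarrow> int \<Rightarrow> int \<Rightarrow> 'a set" where
  "matrix_idem A e = (\<lambda>(k, i) r c.
     if r = i \<and> c = i then entry_bot A i i +>\<^bsub>A\<^esub> e k else \<zero>\<^bsub>entry_space A r c\<^esub>)"


section \<open>Restricted dual and trivial extension\<close>

text \<open>
  Let \<open>C\<close> be the direct sum of the spaces \<open>e\<^sub>\<mu> C e\<^sub>\<nu>\<close>.  An element of the direct sum of the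
  spaces \<open>Hom(e\<^sub>\<mu> C e\<^sub>\<nu>, 'k)\<close> is identified with the linear form on \<open>C\<close> with these components,
  i.e. with a linear form that vanishes on all but finitely many of the \<open>e\<^sub>\<mu> C e\<^sub>\<nu>\<close>.
  Linear forms are set to 0 outside the carrier.
\<close>

definition restricted_dual ::
    "('k::field, 'c) module \<Rightarrow> 'l set \<Rightarrow> ('l \<Rightarrow> 'c) \<Rightarrow> ('c \<Rightarrow> 'k) set" where
  "restricted_dual C \<Lambda> e =
     {f. (\<forall>a. a \<notin> carrier C \<longrightarrow> f a = 0) \<and>
         (\<forall>a\<in>carrier C. \<forall>b\<in>carrier C. f (a \<oplus>\<^bsub>C\<^esub> b) = f a + f b) \<and>
         (\<forall>t. \<forall>a\<in>carrier C. f (t \<odot>\<^bsub>C\<^esub> a) = t * f a) \<and>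
         finite {(\<mu>, \<nu>). \<mu> \<in> \<Lambda> \<and> \<nu> \<in> \<Lambda> \<and>
                   (\<exists>a\<in>carrier C. f (e \<mu> \<otimes>\<^bsub>C\<^esub> a \<otimes>\<^bsub>C\<^esub> e \<nu>) \<noteq> 0)}}"

definition dual_lact :: "('k::field, 'c) module \<Rightarrow> 'c \<Rightarrow> ('c \<Rightarrow> 'k) \<Rightarrow> 'c \<Rightarrow> 'k" where
  "dual_lact C a f = (\<lambda>b. if b \<in> carrier C then f (b \<otimes>\<^bsub>C\<^esub> a) else 0)"

definition dual_ract :: "('k::field, 'c) module \<Rightarrow> ('c \<Rightarrow> 'k) \<Rightarrow> 'c \<Rightarrow> 'c \<Rightarrow> 'k" where
  "dual_ract C f a = (\<lambda>b. if b \<in> carrier C then f (a \<otimes>\<^bsub>C\<^esub> b) else 0)"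

definition trivial_extension ::
    "('k::field, 'c) module \<Rightarrow> 'l set \<Rightarrow> ('l \<Rightarrow> 'c) \<Rightarrow> ('k, 'c \<times> ('c \<Rightarrow> 'k)) module" where
  "trivial_extension C \<Lambda> e = \<lparr>
     carrier = carrier C \<times> restricted_dual C \<Lambda> e,
     mult = (\<lambda>(a, f) (b, g). (a \<otimes>\<^bsub>C\<^esub> b, \<lambda>x. dual_lact C a g x + dual_ract C f b x)),
     one = undefined,
     zero = (\<zero>\<^bsub>C\<^esub>, \<lambda>_. 0),
     add = (\<lambda>(a, f) (b, g). (a \<oplus>\<^bsub>C\<^esub> b, \<lambda>x. f x + g x)),
     smult = (\<lambda>t (a, f). (t \<odot>\<^bsub>C\<^esub> a, \<lambda>x. t * f x))\<rparr>"


section \<open>Quasi-hereditary algebras with local units\<close>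

text \<open>
  Left modules over a \<open>'k\<close>-algebra \<open>D\<close>: \<open>smult\<close> is the action of \<open>D\<close>, \<open>scale\<close> that of \<open>'k\<close>.
  The fields \<open>mult\<close> and \<open>one\<close> are unused.
\<close>

record ('k, 'd, 'm) alg_module = "('d, 'm) module" +
  scale :: "'k \<Rightarrow> 'm \<Rightarrow> 'm"

definition alg_submodule ::
    "('k, 'd) module \<Rightarrow> ('k, 'd, 'm) alg_module \<Rightarrow> 'm set \<Rightarrow> bool" where
  "alg_submodule D M S \<longleftrightarrow> submodule S D M \<and> (\<forall>t. \<forall>x\<in>S. scale M t x \<in> S)"

definition quot_module ::
    "('k, 'd, 'm) alg_module \<Rightarrow> 'm set \<Rightarrow> ('k, 'd, 'm set) alg_module" where
  "quot_module M S = \<lparr>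
     carrier = a_rcosets\<^bsub>M\<^esub> S, mult = undefined, one = undefined, zero = S, add = set_add M,
     smult = (\<lambda>d X. \<Union>x\<in>X. S +>\<^bsub>M\<^esub> (d \<odot>\<^bsub>M\<^esub> x)),
     scale = (\<lambda>t X. \<Union>x\<in>X. S +>\<^bsub>M\<^esub> scale M t x)\<rparr>"

definition module_hom ::
    "('k, 'd) module \<Rightarrow> ('k, 'd, 'm) alg_module \<Rightarrow> ('k, 'd, 'n) alg_module \<Rightarrow> ('m \<Rightarrow> 'n) set" where
  "module_hom D M M' =
     {f \<in> carrier M \<rightarrow>\<^sub>E carrier M'.
        (\<forall>x\<in>carrier M. \<forall>y\<in>carrier M. f (x \<oplus>\<^bsub>M\<^esub> y) = f x \<oplus>\<^bsub>M'\<^esub> f y) \<and>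
        (\<forall>d\<in>carrier D. \<forall>x\<in>carrier M. f (d \<odot>\<^bsub>M\<^esub> x) = d \<odot>\<^bsub>M'\<^esub> f x) \<and>
        (\<forall>t. \<forall>x\<in>carrier M. f (scale M t x) = scale M' t (f x))}"

definition module_isomorphic ::
    "('k, 'd) module \<Rightarrow> ('k, 'd, 'm) alg_module \<Rightarrow> ('k, 'd, 'n) alg_module \<Rightarrow> bool" where
  "module_isomorphic D M M' \<longleftrightarrow> (\<exists>f\<in>module_hom D M M'. bij_betw f (carrier M) (carrier M'))"

definition proj_module :: "('k, 'd) module \<Rightarrow> 'd \<Rightarrow> ('k, 'd, 'd) alg_module" where
  "proj_module D \<epsilon> = \<lparr>
     carrier = (\<lambda>d. d \<otimes>\<^bsub>D\<^esub> \<epsilon>) ` carrier D, mult = undefined, one = undefined,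
     zero = \<zero>\<^bsub>D\<^esub>, add = add D, smult = mult D, scale = smult D\<rparr>"

text \<open>\<open>gt \<mu> \<nu>\<close> stands for \<open>\<mu> > \<nu>\<close>.\<close>

definition trace_above ::
    "('k, 'd) module \<Rightarrow> 'l set \<Rightarrow> ('l \<Rightarrow> 'd) \<Rightarrow> ('l \<Rightarrow> 'l \<Rightarrow> bool) \<Rightarrow> 'l \<Rightarrow> 'd set" where
  "trace_above D \<Lambda> e gt \<nu> =
     \<Inter>{S. alg_submodule D (proj_module D (e \<nu>)) S \<and>
          (\<forall>\<mu>\<in>\<Lambda>. gt \<mu> \<nu> \<longrightarrow>
             (\<forall>h\<in>module_hom D (proj_module D (e \<mu>)) (proj_module D (e \<nu>)).
                h ` carrier (proj_module D (e \<mu>)) \<subseteq> S))}"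

definition standard_module ::
    "('k, 'd) module \<Rightarrow> 'l set \<Rightarrow> ('l \<Rightarrow> 'd) \<Rightarrow> ('l \<Rightarrow> 'l \<Rightarrow> bool) \<Rightarrow> 'l \<Rightarrow> ('k, 'd, 'd set) alg_module" where
  "standard_module D \<Lambda> e gt \<nu> =
     quot_module (proj_module D (e \<nu>)) (trace_above D \<Lambda> e gt \<nu>)"

text \<open>
  \<open>End(\<Delta>(\<nu>)) = 'k\<close> means that the structure map from \<open>'k\<close> to \<open>End(\<Delta>(\<nu>))\<close> is bijective.
\<close>

definition quasi_hereditary ::
    "('k, 'd) module \<Rightarrow> 'l set \<Rightarrow> ('l \<Rightarrow> 'd) \<Rightarrow> ('l \<Rightarrow> 'l \<Rightarrow> bool) \<Rightarrow> bool" where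
  "quasi_hereditary D \<Lambda> e gt \<longleftrightarrow> (\<forall>\<nu>\<in>\<Lambda>.
     (let P = proj_module D (e \<nu>); \<Delta> = standard_module D \<Lambda> e gt in
      bij_betw (\<lambda>t. \<lambda>x\<in>carrier (\<Delta> \<nu>). scale (\<Delta> \<nu>) t x) UNIV (module_hom D (\<Delta> \<nu>) (\<Delta> \<nu>)) \<and>
      (\<exists>(m::nat) F \<mu>.
         F 0 = carrier P \<and> F (Suc m) = {\<zero>\<^bsub>P\<^esub>} \<and>
         (\<forall>j\<le>Suc m. alg_submodule D P (F j)) \<and>
         (\<forall>j\<le>m. F (Suc j) \<subseteq> F j \<and>
            module_isomorphic D (quot_module (P\<lparr>carrier := F j\<rparr>) (F (Suc j))) (\<Delta> (\<mu> j))) \<and>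
         \<mu> 0 = \<nu> \<and> (\<forall>j\<in>{1..m}. \<mu> j \<in> \<Lambda> \<and> gt (\<mu> j) \<nu>))))"


section \<open>The algebra \<open>\<DD>\<close> and the two orders\<close>

definition index_set :: "('v, 'a) pre_digraph \<Rightarrow> ('v tvert \<times> int) set" where
  "index_set Q = verts (tilde_quiver Q) \<times> UNIV"

definition C_algebra ::
    "('v, 'a) pre_digraph \<Rightarrow> ('v \<times> 'a list \<Rightarrow> 'k::field) set
       \<Rightarrow> ('k, int \<Rightarrow> int \<Rightarrow> ('v tvert \<times> ('v, 'a) tarr list \<Rightarrow> 'k) set set) module" where
  "C_algebra Q R = matrix_algebra (tilde_algebra Q R)"

definition C_idem ::
    "('v, 'a) pre_digraph \<Rightarrow> ('v \<times> 'a list \<Rightarrow> 'k::field) set \<Rightarrow> 'v tvert \<times> int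
       \<Rightarrow> int \<Rightarrow> int \<Rightarrow> ('v tvert \<times> ('v, 'a) tarr list \<Rightarrow> 'k) set set" where
  "C_idem Q R = matrix_idem (tilde_algebra Q R) (tilde_idem Q R)"

definition D_algebra where
  "D_algebra Q R = trivial_extension (C_algebra Q R) (index_set Q) (C_idem Q R)"

definition D_idem where
  "D_idem Q R \<nu> = (C_idem Q R \<nu>, \<lambda>_. 0)"

definition first_gt :: "'v tvert \<times> int \<Rightarrow> 'v tvert \<times> int \<Rightarrow> bool" where
  "first_gt = (\<lambda>(k, i) (l, j). i > j \<or> (i = j \<and> k \<in> range Old \<and> l \<in> range Tilde))"

definition second_gt :: "'v tvert \<times> int \<Rightarrow> 'v tvert \<times> int \<Rightarrow> bool" where
  "second_gt x y \<longleftrightarrow> first_gt y x"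

end

theory Submission
  imports Defs
begin

text \<open>
  Write \<open>N\<close> for the nilpotency degree of the radical of \<open>B\<close>, the algebra with the attached arrows,
  and let \<open>J z\<close> be the \<open>z\<close>-th radical power, which is \<open>B\<close> itself for \<open>z \<le> 0\<close>.  Then all entries of the
  matrix algebra \<open>C\<close> have the same shape: the entries in row \<open>r\<close> and column \<open>c\<close> form
  \<open>J (r - c) / J (N + r - c)\<close>.  For \<open>\<nu> = (x, i)\<close> let \<open>u \<nu> j\<close> be the class of \<open>e\<^sub>x\<close> in position \<open>(i - j, i)\<close>,
  so that \<open>u \<nu> 0\<close> is the idempotent at \<open>\<nu>\<close> and \<open>u \<nu> N = 0\<close>.  Right multiplication by \<open>u (x, i) j\<close> maps
  the projective module of the trivial extension \<open>D\<close> at \<open>(x, i - j)\<close> to the one at \<open>(x, i)\<close>, and in the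
  second order \<open>(x, i - j) > (x, i)\<close> for \<open>j > 0\<close>.

  The point is that with respect to the second order every element of \<open>e\<^sub>\<mu> D e\<^sub>\<nu>\<close> with \<open>\<mu> > \<nu>\<close> is a
  multiple of \<open>u \<nu> 1\<close>.  Hence the standard module at \<open>\<nu>\<close> is the quotient of \<open>D e\<^sub>\<nu>\<close> by \<open>D (u \<nu> 1)\<close>, and
  \<open>D e\<^sub>\<nu>\<close> is filtered by the left ideals \<open>D (u \<nu> j)\<close> for \<open>j = 0, \<dots>, N\<close>, each layer of which is
  the standard module at \<open>(x, i - j)\<close>: whatever is killed by right multiplication by \<open>u (x, i) j\<close> with
  \<open>j < N\<close> is a multiple of \<open>u (x, i - j) 1\<close>.  This argument is carried out for abstract elements \<open>u\<close>
  in the locale \<open>shift_quasi_hereditary\<close>.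

  For the summand \<open>C\<close> of \<open>D\<close> these claims are comparisons of exponents of \<open>J\<close>.  For the restricted dual
  they are dualized: a linear form is of the form \<open>h (u \<nu> j \<cdot> _)\<close> if it vanishes on the kernel of
  the left multiplication by \<open>u \<nu> j\<close> (\<open>dual_factor\<close>), and the kernels are again described by
  exponents of \<open>J\<close> (\<open>MA_symmetric_shift_algebra\<close>).

  The attached arrows are needed for the endomorphisms of the standard module at \<open>(x, i)\<close>.  To these
  the restricted dual contributes the dual of \<open>e\<^sub>x (J (N - 1)) e\<^sub>x\<close>, and this space is zero.  For an
  old vertex \<open>k\<close>, left multiplication by \<open>\<alpha>\<^sub>k\<close> is injective on \<open>e\<^sub>k B\<close> and sends \<open>e\<^sub>k (J (N - 1))\<close> to
  \<open>J N = 0\<close>.  For a new vertex it holds because only the trivial path starts there and \<open>N \<ge> 2\<close>.  The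
  injectivity comes from the linear map on the path algebra that removes a final \<open>\<alpha>\<^sub>k\<close> from each
  path (\<open>strip_TI\<close>).  For such computations in \<open>B\<close> one has to know that its Jacobson radical is the
  image of the ideal generated by the arrows (\<open>jacobson_radical_eq\<close>).
\<close>

section \<open>Vector spaces, subspaces and cosets\<close>

locale kspace = abelian_group M
  for M :: "('k::field, 'a, 'm) module_scheme" (structure) +
  assumes scl_closed [simp, intro]: "x \<in> carrier M \<Longrightarrow> t \<odot>\<^bsub>M\<^esub> x \<in> carrier M"
    and scl_add: "x \<in> carrier M \<Longrightarrow> y \<in> carrier M \<Longrightarrow> t \<odot>\<^bsub>M\<^esub> (x \<oplus>\<^bsub>M\<^esub> y) = t \<odot>\<^bsub>M\<^esub> x \<oplus>\<^bsub>M\<^esub> t \<odot>\<^bsub>M\<^esub> y"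
    and add_scl: "x \<in> carrier M \<Longrightarrow> (s + t) \<odot>\<^bsub>M\<^esub> x = s \<odot>\<^bsub>M\<^esub> x \<oplus>\<^bsub>M\<^esub> t \<odot>\<^bsub>M\<^esub> x"
    and scl_scl: "x \<in> carrier M \<Longrightarrow> s \<odot>\<^bsub>M\<^esub> (t \<odot>\<^bsub>M\<^esub> x) = (s * t) \<odot>\<^bsub>M\<^esub> x"
    and one_scl [simp]: "x \<in> carrier M \<Longrightarrow> 1 \<odot>\<^bsub>M\<^esub> x = x"
begin

lemma zero_scl [simp]: "x \<in> carrier M \<Longrightarrow> 0 \<odot>\<^bsub>M\<^esub> x = \<zero>"
  using add_scl[of x 0 0] add.r_cancel_one[of "0 \<odot>\<^bsub>M\<^esub> x" "0 \<odot>\<^bsub>M\<^esub> x"] by simp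

lemma scl_zero [simp]: "t \<odot>\<^bsub>M\<^esub> \<zero> = \<zero>"
  using scl_add[of \<zero> \<zero> t] add.r_cancel_one[of "t \<odot>\<^bsub>M\<^esub> \<zero>" "t \<odot>\<^bsub>M\<^esub> \<zero>"] by simp

lemma scl_minus_one: "x \<in> carrier M \<Longrightarrow> (- 1) \<odot>\<^bsub>M\<^esub> x = \<ominus> x"
  using add_scl[of x "-1" 1] by (metis add.inv_equality left_minus one_scl scl_closed zero_scl)

lemma scl_a_inv: "x \<in> carrier M \<Longrightarrow> t \<odot>\<^bsub>M\<^esub> (\<ominus> x) = \<ominus> (t \<odot>\<^bsub>M\<^esub> x)"
  using scl_minus_one[of x] scl_minus_one[of "t \<odot>\<^bsub>M\<^esub> x"] scl_scl[of x t "-1"] scl_scl[of x "-1" t] by simp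

lemma scl_minus:
  "x \<in> carrier M \<Longrightarrow> y \<in> carrier M \<Longrightarrow> t \<odot>\<^bsub>M\<^esub> (x \<ominus> y) = t \<odot>\<^bsub>M\<^esub> x \<ominus> t \<odot>\<^bsub>M\<^esub> y"
  by (simp add: minus_eq scl_add scl_a_inv)

end

definition ksubspace :: "'a set \<Rightarrow> ('k::field, 'a, 'm) module_scheme \<Rightarrow> bool" where
  "ksubspace S M \<longleftrightarrow> additive_subgroup S M \<and> (\<forall>t. \<forall>x\<in>S. t \<odot>\<^bsub>M\<^esub> x \<in> S)"

lemma (in kspace) ksubspaceI:
  assumes "S \<subseteq> carrier M" "\<zero> \<in> S" "\<And>x y. x \<in> S \<Longrightarrow> y \<in> S \<Longrightarrow> x \<oplus> y \<in> S"
    "\<And>t x. x \<in> S \<Longrightarrow> t \<odot>\<^bsub>M\<^esub> x \<in> S"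
  shows "ksubspace S M"
proof -
  have "\<ominus> x \<in> S" if "x \<in> S" for x
    using assms(4)[OF that, of "-1"] scl_minus_one[of x] assms(1) that by auto
  then have "subgroup S (add_monoid M)"
    using assms by (intro group.subgroupI[OF a_group]) (auto simp: a_inv_def)
  then show ?thesis using assms(4) by (simp add: ksubspace_def additive_subgroup_def)
qed

lemma ksubspace_facts:
  assumes "ksubspace S M"
  shows "S \<subseteq> carrier M" "\<zero>\<^bsub>M\<^esub> \<in> S" "\<And>x y. x \<in> S \<Longrightarrow> y \<in> S \<Longrightarrow> x \<oplus>\<^bsub>M\<^esub> y \<in> S"
    "\<And>t x. x \<in> S \<Longrightarrow> t \<odot>\<^bsub>M\<^esub> x \<in> S" "additive_subgroup S M"
proof -
  interpret additive_subgroup S M using assms by (simp add: ksubspace_def)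
  show "S \<subseteq> carrier M" "\<zero>\<^bsub>M\<^esub> \<in> S" "additive_subgroup S M"
    by (rule a_subset zero_closed is_additive_subgroup)+
  show "x \<oplus>\<^bsub>M\<^esub> y \<in> S" if "x \<in> S" "y \<in> S" for x y using that by (rule a_closed)
  show "t \<odot>\<^bsub>M\<^esub> x \<in> S" if "x \<in> S" for t x using that assms by (simp add: ksubspace_def)
qed

context abelian_group
begin

lemma add_eq_swap:
  assumes "a \<in> carrier G" "b \<in> carrier G" "c \<in> carrier G" "d \<in> carrier G" "a \<oplus> b = c \<oplus> d"
  shows "c \<ominus> a = b \<ominus> d"
proof -
  have "c \<ominus> a = ((c \<oplus> d) \<ominus> d) \<ominus> a" using assms(1-4) by (simp add: minus_eq a_assoc r_neg)
  also have "\<dots> = ((a \<oplus> b) \<ominus> d) \<ominus> a" by (simp only: assms(5))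
  also have "\<dots> = a \<oplus> (\<ominus> a \<oplus> (b \<ominus> d))" using assms(1-4) by (simp add: minus_eq a_ac)
  also have "\<dots> = b \<ominus> d" using assms(1-4) by (simp add: r_neg2)
  finally show ?thesis .
qed

lemma coset_mem_iff:
  assumes "additive_subgroup H G" "x \<in> carrier G" "y \<in> carrier G"
  shows "y \<in> H +> x \<longleftrightarrow> y \<ominus> x \<in> H"
proof -
  interpret abelian_subgroup H G using assms(1) abelian_group_axioms by (rule abelian_subgroupI3)
  show ?thesis using a_rcos_module assms by (simp add: minus_eq)
qed

lemma coset_subset:
  assumes "additive_subgroup H G" "x \<in> carrier G"
  shows "H +> x \<subseteq> carrier G"
  using assms additive_subgroup.a_subset a_r_coset_subset_G by blast

lemma coset_self:
  assumes "additive_subgroup H G" "x \<in> carrier G"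
  shows "x \<in> H +> x"
  using assms by (simp add: coset_mem_iff additive_subgroup.zero_closed minus_eq r_neg)

lemma coset_eq_iff:
  assumes "additive_subgroup H G" "x \<in> carrier G" "y \<in> carrier G"
  shows "H +> x = H +> y \<longleftrightarrow> x \<ominus> y \<in> H"
proof -
  have "subgroup H (add_monoid G)" using assms(1) by (simp add: additive_subgroup.a_subgroup)
  then show ?thesis
    using a_repr_independence[of x H y] coset_mem_iff[OF assms(1,3,2)] coset_self[OF assms(1,2)] assms
    by auto
qed

lemma coset_zero: "additive_subgroup H G \<Longrightarrow> H +> \<zero> = H"
  by (simp add: additive_subgroup.a_subset)

lemma coset_add:
  assumes "additive_subgroup H G" "x \<in> carrier G" "y \<in> carrier G"
  shows "(H +> x) <+> (H +> y) = H +> (x \<oplus> y)"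
proof -
  interpret abelian_subgroup H G using assms(1) abelian_group_axioms by (rule abelian_subgroupI3)
  show ?thesis using a_rcos_sum assms by simp
qed

text \<open>Operations on quotients are defined as unions over all representatives; whenever an operation
  is well defined, its union collapses to the term of any one representative.\<close>

lemma coset_UN:
  assumes "additive_subgroup H G" "x \<in> carrier G"
    and "\<And>z. z \<in> carrier G \<Longrightarrow> z \<ominus> x \<in> H \<Longrightarrow> g z = g x"
  shows "(\<Union>z\<in>H +> x. g z) = g x"
proof -
  have eq: "g z = g x" if "z \<in> H +> x" for z
  proof -
    have "z \<in> carrier G" using that coset_subset[OF assms(1,2)] by (rule rev_subsetD)
    moreover from this have "z \<ominus> x \<in> H" using that coset_mem_iff[OF assms(1,2)] by simp
    ultimately show ?thesis by (rule assms(3))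
  qed
  show ?thesis
    using coset_self[OF assms(1,2)] by (intro SUP_eq_const[OF _ eq]) blast+
qed

end

lemma a_r_coset_cong: "add M = add M' \<Longrightarrow> H +>\<^bsub>M\<^esub> x = H +>\<^bsub>M'\<^esub> x"
  by (simp add: a_r_coset_def r_coset_def)

lemma set_add_cong: "add M = add M' \<Longrightarrow> set_add M = set_add M'"
  by (simp add: set_add_def set_mult_def fun_eq_iff)

lemma a_rcosets_alt: "a_rcosets\<^bsub>M\<^esub> H = (\<lambda>x. H +>\<^bsub>M\<^esub> x) ` carrier M"
  by (auto simp: A_RCOSETS_def RCOSETS_def a_r_coset_def)

lemma (in abelian_group) abelian_group_on:
  assumes "additive_subgroup X G" "carrier P = X" "add P = add G" "zero P = \<zero>"
  shows "abelian_group P"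
proof (rule abelian_groupI)
  interpret X: additive_subgroup X G by fact
  show "\<exists>y\<in>carrier P. y \<oplus>\<^bsub>P\<^esub> x = \<zero>\<^bsub>P\<^esub>" if "x \<in> carrier P" for x
    using that assms by (intro bexI[of _ "\<ominus> x"]) (auto simp: l_neg)
qed (use assms in \<open>auto simp: additive_subgroup.a_closed additive_subgroup.zero_closed a_ac
   additive_subgroup.a_Hcarr\<close>)

lemma (in abelian_group) a_inv_on:
  assumes "additive_subgroup X G" "carrier P = X" "add P = add G" "zero P = \<zero>" "x \<in> X"
  shows "\<ominus>\<^bsub>P\<^esub> x = \<ominus> x"
proof -
  interpret P: abelian_group P using assms abelian_group_on by blast
  interpret X: additive_subgroup X G by fact
  have "\<ominus> x \<oplus> x = \<zero>" "\<ominus> x \<in> X" using assms(5) by (auto simp: l_neg)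
  then show ?thesis using P.minus_equality[of "\<ominus> x" x] assms by simp
qed

text \<open>A quotient \<open>T / K\<close> of two subspaces of one space.  Both the bound quiver algebras and the
  spaces of matrix entries have this form.\<close>

context
  fixes M :: "('k::field, 'a) module" (structure) and T K
  assumes M: "kspace M" and T: "ksubspace T M" and K: "ksubspace K M"
begin

interpretation kspace M by (rule M)

abbreviation (input) "TmodK \<equiv> quot_algebra (M\<lparr>carrier := T\<rparr>) K"

lemma quot_carrier: "carrier TmodK = (\<lambda>x. K +> x) ` T"
  unfolding quot_algebra_def FactRing_def a_rcosets_alt
  by (simp add: a_r_coset_cong[of "M\<lparr>carrier := T\<rparr>" M])

lemma quot_zero: "\<zero>\<^bsub>TmodK\<^esub> = K +> \<zero>"
  using coset_zero[of K] ksubspace_facts[OF K] by (simp add: quot_algebra_def FactRing_def)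

lemma quot_add: "x \<in> carrier M \<Longrightarrow> y \<in> carrier M \<Longrightarrow> (K +> x) \<oplus>\<^bsub>TmodK\<^esub> (K +> y) = K +> (x \<oplus> y)"
  using coset_add[of K x y] ksubspace_facts[OF K]
  by (simp add: quot_algebra_def FactRing_def set_add_cong[of "M\<lparr>carrier := T\<rparr>" M])

lemma quot_smult: "x \<in> carrier M \<Longrightarrow> t \<odot>\<^bsub>TmodK\<^esub> (K +> x) = K +> (t \<odot>\<^bsub>M\<^esub> x)"
proof -
  assume x: "x \<in> carrier M"
  have "(\<Union>z\<in>K +> x. K +> t \<odot>\<^bsub>M\<^esub> z) = K +> t \<odot>\<^bsub>M\<^esub> x"
    using ksubspace_facts[OF K] x
    by (intro coset_UN) (auto simp: coset_eq_iff scl_minus[symmetric])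
  then show ?thesis
    by (simp add: quot_algebra_def a_r_coset_cong[of "M\<lparr>carrier := T\<rparr>" M])
qed

lemma quot_kspace: "kspace TmodK"
proof -
  note Tf = ksubspace_facts[OF T]
  have TM: "x \<in> carrier M" if "x \<in> T" for x using Tf that by blast
  have "abelian_group TmodK"
  proof (rule abelian_groupI)
    fix X Y Z assume "X \<in> carrier TmodK" "Y \<in> carrier TmodK" "Z \<in> carrier TmodK"
    then obtain x y z where xyz: "X = K +> x" "Y = K +> y" "Z = K +> z" "x \<in> T" "y \<in> T" "z \<in> T"
      unfolding quot_carrier by auto
    show "X \<oplus>\<^bsub>TmodK\<^esub> Y \<in> carrier TmodK" using xyz Tf TM by (auto simp: quot_carrier quot_add)
    show "X \<oplus>\<^bsub>TmodK\<^esub> Y \<oplus>\<^bsub>TmodK\<^esub> Z = X \<oplus>\<^bsub>TmodK\<^esub> (Y \<oplus>\<^bsub>TmodK\<^esub> Z)" using xyz Tf TM by (simp add: quot_add a_assoc)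
    show "X \<oplus>\<^bsub>TmodK\<^esub> Y = Y \<oplus>\<^bsub>TmodK\<^esub> X" using xyz Tf TM by (simp add: quot_add a_comm)
    show "\<zero>\<^bsub>TmodK\<^esub> \<oplus>\<^bsub>TmodK\<^esub> X = X" using xyz Tf TM by (simp add: quot_add quot_zero)
    have "(K +> (- 1) \<odot>\<^bsub>M\<^esub> x) \<oplus>\<^bsub>TmodK\<^esub> X = \<zero>\<^bsub>TmodK\<^esub>"
      using xyz Tf TM by (simp add: quot_add quot_zero scl_minus_one l_neg)
    moreover have "(K +> (- 1) \<odot>\<^bsub>M\<^esub> x) \<in> carrier TmodK" using xyz Tf by (simp add: quot_carrier)
    ultimately show "\<exists>y\<in>carrier TmodK. y \<oplus>\<^bsub>TmodK\<^esub> X = \<zero>\<^bsub>TmodK\<^esub>" by blast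
  next
    show "\<zero>\<^bsub>TmodK\<^esub> \<in> carrier TmodK" using Tf by (auto simp: quot_carrier quot_zero)
  qed
  then interpret Q: abelian_group TmodK .
  show ?thesis
    using Tf by unfold_locales
     (auto simp: quot_carrier quot_add quot_smult scl_add add_scl scl_scl TM)
qed

end


section \<open>Linear forms\<close>

definition linear_form :: "('k::field, 'a, 'm) module_scheme \<Rightarrow> ('a \<Rightarrow> 'k) \<Rightarrow> bool" where
  "linear_form M f \<longleftrightarrow> (\<forall>a\<in>carrier M. \<forall>b\<in>carrier M. f (a \<oplus>\<^bsub>M\<^esub> b) = f a + f b) \<and>
     (\<forall>t. \<forall>a\<in>carrier M. f (t \<odot>\<^bsub>M\<^esub> a) = t * f a)"

lemma linear_formD:
  assumes "linear_form M f"
  shows "a \<in> carrier M \<Longrightarrow> b \<in> carrier M \<Longrightarrow> f (a \<oplus>\<^bsub>M\<^esub> b) = f a + f b"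
    "a \<in> carrier M \<Longrightarrow> f (t \<odot>\<^bsub>M\<^esub> a) = t * f a"
  using assms by (auto simp: linear_form_def)

context kspace
begin

lemma linear_form_zero: "linear_form M f \<Longrightarrow> f \<zero> = 0"
  using linear_formD(2)[of M f \<zero> 0] by simp

lemma linear_form_minus:
  "linear_form M f \<Longrightarrow> x \<in> carrier M \<Longrightarrow> y \<in> carrier M \<Longrightarrow> f (x \<ominus> y) = f x - f y"
  using linear_formD(1)[of M f x "\<ominus> y"] linear_formD(2)[of M f y "-1"] scl_minus_one[of y]
  by (simp add: minus_eq)

lemma linear_form_finsum:
  assumes "linear_form M f" "finite F" "g \<in> F \<rightarrow> carrier M"
  shows "f (finsum M g F) = (\<Sum>x\<in>F. f (g x))"
  using assms(2,3)
  by (induction F rule: finite_induct)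
    (auto simp: finsum_insert linear_form_zero linear_formD(1) assms(1) Pi_def)

text \<open>By Zorn's lemma there is a maximal subspace that meets \<open>W\<close> trivially.  If it missed some \<open>x\<close>
  in its sum with \<open>W\<close>, then the line through \<open>x\<close> could be added to it.\<close>

lemma ksubspace_complement:
  assumes W: "ksubspace W M"
  obtains S where "ksubspace S M" "S \<inter> W = {\<zero>}"
    "\<And>x. x \<in> carrier M \<Longrightarrow> \<exists>s\<in>S. \<exists>w\<in>W. x = s \<oplus> w"
proof -
  note Wf = ksubspace_facts[OF W]
  define \<A> where "\<A> = {S. ksubspace S M \<and> S \<inter> W = {\<zero>}}"
  have "\<exists>S\<in>\<A>. \<forall>X\<in>\<A>. S \<subseteq> X \<longrightarrow> X = S"
  proof (rule subset_Zorn)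
    fix \<C> assume chain: "subset.chain \<A> \<C>"
    show "\<exists>U\<in>\<A>. \<forall>X\<in>\<C>. X \<subseteq> U"
    proof (cases "\<C> = {}")
      case True
      have "ksubspace {\<zero>} M" by (rule ksubspaceI) auto
      then have "{\<zero>} \<in> \<A>" using Wf by (auto simp: \<A>_def)
      with True show ?thesis by blast
    next
      case False
      have sub: "ksubspace X M" "X \<inter> W = {\<zero>}" if "X \<in> \<C>" for X
        using chain that by (auto simp: subset.chain_def \<A>_def)
      have "ksubspace (\<Union>\<C>) M"
      proof (rule ksubspaceI)
        fix x y assume "x \<in> \<Union>\<C>" "y \<in> \<Union>\<C>"
        then obtain X Y where XY: "X \<in> \<C>" "Y \<in> \<C>" "x \<in> X" "y \<in> Y" by blast
        then have "X \<subseteq> Y \<or> Y \<subseteq> X" using chain by (auto simp: subset.chain_def)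
        then show "x \<oplus> y \<in> \<Union>\<C>"
          using XY ksubspace_facts(3)[OF sub(1)[of X]] ksubspace_facts(3)[OF sub(1)[of Y]] by blast
      next
        show "\<Union>\<C> \<subseteq> carrier M" using ksubspace_facts(1)[OF sub(1)] by (rule Union_least)
        show "\<zero> \<in> \<Union>\<C>" using False ksubspace_facts(2)[OF sub(1)] by auto
        show "t \<odot>\<^bsub>M\<^esub> x \<in> \<Union>\<C>" if "x \<in> \<Union>\<C>" for t x
          using that ksubspace_facts(4)[OF sub(1)] by auto
      qed
      moreover have "\<Union>\<C> \<inter> W = {\<zero>}" using False sub by blast
      ultimately show ?thesis by (auto simp: \<A>_def)
    qed
  qed
  then obtain S where S: "ksubspace S M" "S \<inter> W = {\<zero>}"
    and max: "\<And>X. ksubspace X M \<Longrightarrow> X \<inter> W = {\<zero>} \<Longrightarrow> S \<subseteq> X \<Longrightarrow> X = S"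
    by (auto simp: \<A>_def)
  note Sf = ksubspace_facts[OF S(1)]
  have SM: "s \<in> carrier M" if "s \<in> S" for s using that Sf by blast
  have WM: "w \<in> carrier M" if "w \<in> W" for w using that Wf by blast
  have "\<exists>s\<in>S. \<exists>w\<in>W. x = s \<oplus> w" if x: "x \<in> carrier M" for x
  proof (rule ccontr)
    assume no: "\<not> ?thesis"
    define X where "X = {s \<oplus> t \<odot>\<^bsub>M\<^esub> x |s t. s \<in> S}"
    have "ksubspace X M"
    proof (rule ksubspaceI)
      show "X \<subseteq> carrier M" using x SM by (auto simp: X_def)
      have "\<zero> = \<zero> \<oplus> 0 \<odot>\<^bsub>M\<^esub> x" using x by simp
      then show "\<zero> \<in> X" using Sf(2) unfolding X_def by blast
      fix y z assume "y \<in> X" "z \<in> X"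
      then obtain s t s' t' where *: "y = s \<oplus> t \<odot>\<^bsub>M\<^esub> x" "z = s' \<oplus> t' \<odot>\<^bsub>M\<^esub> x" "s \<in> S" "s' \<in> S"
        by (auto simp: X_def)
      then have "y \<oplus> z = (s \<oplus> s') \<oplus> (t + t') \<odot>\<^bsub>M\<^esub> x"
        using x SM by (simp add: add_scl a_ac)
      then show "y \<oplus> z \<in> X" using Sf(3) * unfolding X_def by blast
    next
      fix r y assume "y \<in> X"
      then obtain s t where *: "y = s \<oplus> t \<odot>\<^bsub>M\<^esub> x" "s \<in> S" by (auto simp: X_def)
      then have "r \<odot>\<^bsub>M\<^esub> y = r \<odot>\<^bsub>M\<^esub> s \<oplus> (r * t) \<odot>\<^bsub>M\<^esub> x" using x SM by (simp add: scl_add scl_scl)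
      then show "r \<odot>\<^bsub>M\<^esub> y \<in> X" using Sf(4) * unfolding X_def by blast
    qed
    moreover have "S \<subseteq> X"
    proof
      fix s assume "s \<in> S"
      moreover from this have "s = s \<oplus> 0 \<odot>\<^bsub>M\<^esub> x" using x SM by simp
      ultimately show "s \<in> X" unfolding X_def by blast
    qed
    moreover have "x \<notin> S" using no Wf(2) x by (metis r_zero)
    moreover have "x \<in> X"
    proof -
      have "x = \<zero> \<oplus> 1 \<odot>\<^bsub>M\<^esub> x" using x by simp
      then show ?thesis using Sf(2) unfolding X_def by blast
    qed
    ultimately have "X \<inter> W \<noteq> {\<zero>}" using max by blast
    moreover have "\<zero> \<in> X \<inter> W" using \<open>S \<subseteq> X\<close> Sf Wf by blast
    ultimately obtain y where y: "y \<in> X" "y \<in> W" "y \<noteq> \<zero>" by blast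
    then obtain s t where st: "y = s \<oplus> t \<odot>\<^bsub>M\<^esub> x" "s \<in> S" by (auto simp: X_def)
    show False
    proof (cases "t = 0")
      case True
      then have "y \<in> S" using st x SM by simp
      then show False using y S by blast
    next
      case False
      have "y \<oplus> (- 1) \<odot>\<^bsub>M\<^esub> s = t \<odot>\<^bsub>M\<^esub> x"
        using st x SM by (simp add: scl_minus_one a_ac r_neg2)
      then have "inverse t \<odot>\<^bsub>M\<^esub> (y \<oplus> (- 1) \<odot>\<^bsub>M\<^esub> s) = x"
        using False x by (simp add: scl_scl)
      moreover have "inverse t \<odot>\<^bsub>M\<^esub> (y \<oplus> (- 1) \<odot>\<^bsub>M\<^esub> s)
          = inverse t \<odot>\<^bsub>M\<^esub> ((- 1) \<odot>\<^bsub>M\<^esub> s) \<oplus> inverse t \<odot>\<^bsub>M\<^esub> y"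
        using y st SM WM by (simp add: scl_add a_comm)
      ultimately show False using no Sf(4) Wf(4) st y by metis
    qed
  qed
  then show thesis using that S by blast
qed

text \<open>The condition on the kernel of \<open>\<phi>\<close> makes \<open>\<phi> x \<mapsto> f x\<close> a well-defined form on the image of \<open>\<phi>\<close>,
  which is extended by zero on a complement of the image.\<close>

lemma linear_form_factor:
  assumes f: "linear_form M f"
    and \<phi>: "\<And>x. x \<in> carrier M \<Longrightarrow> \<phi> x \<in> carrier M"
      "\<And>x y. x \<in> carrier M \<Longrightarrow> y \<in> carrier M \<Longrightarrow> \<phi> (x \<oplus> y) = \<phi> x \<oplus> \<phi> y"
      "\<And>t x. x \<in> carrier M \<Longrightarrow> \<phi> (t \<odot>\<^bsub>M\<^esub> x) = t \<odot>\<^bsub>M\<^esub> \<phi> x"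
    and ker: "\<And>x. x \<in> carrier M \<Longrightarrow> \<phi> x = \<zero> \<Longrightarrow> f x = 0"
  obtains h where "linear_form M h" "\<And>x. x \<in> carrier M \<Longrightarrow> h (\<phi> x) = f x"
proof -
  have phi0: "\<phi> \<zero> = \<zero>" using \<phi>(1)[of \<zero>] \<phi>(3)[of \<zero> 0] by simp
  have W: "ksubspace (\<phi> ` carrier M) M"
  proof (rule ksubspaceI)
    show "\<zero> \<in> \<phi> ` carrier M" using phi0 by (metis imageI zero_closed)
  qed (use \<phi> in \<open>auto simp flip: \<phi>(2,3)\<close>)
  obtain S where S: "ksubspace S M" "S \<inter> \<phi> ` carrier M = {\<zero>}"
    and dec: "\<And>x. x \<in> carrier M \<Longrightarrow> \<exists>s\<in>S. \<exists>w\<in>\<phi> ` carrier M. x = s \<oplus> w"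
    using ksubspace_complement[OF W] by metis
  note Sf = ksubspace_facts[OF S(1)]
  have SM: "s \<in> carrier M" if "s \<in> S" for s using that Sf by blast
  define h where "h x = f (SOME y. y \<in> carrier M \<and> (\<exists>s\<in>S. x = s \<oplus> \<phi> y))" for x
  \<comment> \<open>The chosen \<open>y\<close> is only determined up to the kernel of \<open>\<phi>\<close>, on which \<open>f\<close> vanishes.\<close>
  have uniq: "h (s \<oplus> \<phi> y) = f y" if "s \<in> S" "y \<in> carrier M" for s y
  proof -
    define y' where "y' = (SOME y'. y' \<in> carrier M \<and> (\<exists>s'\<in>S. s \<oplus> \<phi> y = s' \<oplus> \<phi> y'))"
    have "y' \<in> carrier M \<and> (\<exists>s'\<in>S. s \<oplus> \<phi> y = s' \<oplus> \<phi> y')"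
      unfolding y'_def by (rule someI[where x = y]) (use that in blast)
    then obtain s' where y': "y' \<in> carrier M" "s' \<in> S" "s \<oplus> \<phi> y = s' \<oplus> \<phi> y'" by blast
    have phidiff: "\<phi> (y \<ominus> y') = \<phi> y \<ominus> \<phi> y'"
      using \<phi>(2)[of y "\<ominus> y'"] \<phi>(3)[of y' "-1"] y' that \<phi>(1) by (simp add: scl_minus_one minus_eq)
    have "s' \<ominus> s = \<phi> y \<ominus> \<phi> y'"
      using y' that SM \<phi>(1) by (intro add_eq_swap) auto
    moreover have "s' \<ominus> s \<in> S" using y' that Sf(3)[of s' "\<ominus> s"] Sf(4)[of s "-1"] SM
      by (simp add: minus_eq scl_minus_one)
    moreover have "\<phi> (y \<ominus> y') \<in> \<phi> ` carrier M" using y'(1) that(2) by blast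
    ultimately have "\<phi> (y \<ominus> y') \<in> S \<inter> \<phi> ` carrier M" using phidiff by simp
    then have "f (y \<ominus> y') = 0" using ker[of "y \<ominus> y'"] S(2) y'(1) that(2) by blast
    then have "f y' = f y" using linear_form_minus[OF f, of y y'] y'(1) that(2) by simp
    then show ?thesis by (simp only: h_def y'_def)
  qed
  show thesis
  proof
    show "h (\<phi> x) = f x" if "x \<in> carrier M" for x
      using uniq[OF Sf(2) that] \<phi>(1)[OF that] by simp
    show "linear_form M h" unfolding linear_form_def
    proof (intro conjI ballI allI)
      fix a b assume "a \<in> carrier M" "b \<in> carrier M"
      obtain s y s' y' where *: "a = s \<oplus> \<phi> y" "b = s' \<oplus> \<phi> y'" "s \<in> S" "s' \<in> S"
        "y \<in> carrier M" "y' \<in> carrier M"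
        using dec[OF \<open>a \<in> carrier M\<close>] dec[OF \<open>b \<in> carrier M\<close>] by (elim bexE imageE) simp
      then have "a \<oplus> b = (s \<oplus> s') \<oplus> \<phi> (y \<oplus> y')" using SM \<phi> by (simp add: a_ac)
      then show "h (a \<oplus> b) = h a + h b"
        using * uniq Sf(3) linear_formD(1)[OF f] by simp
    next
      fix t a assume "a \<in> carrier M"
      obtain s y where *: "a = s \<oplus> \<phi> y" "s \<in> S" "y \<in> carrier M"
        using dec[OF \<open>a \<in> carrier M\<close>] by (elim bexE imageE) simp
      then have "t \<odot>\<^bsub>M\<^esub> a = t \<odot>\<^bsub>M\<^esub> s \<oplus> \<phi> (t \<odot>\<^bsub>M\<^esub> y)" using SM \<phi> by (simp add: scl_add)
      then show "h (t \<odot>\<^bsub>M\<^esub> a) = t * h a"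
        using * uniq Sf(4) linear_formD(2)[OF f] by simp
    qed
  qed
qed

end


section \<open>A criterion for quasi-heredity\<close>

locale kalgebra = kspace D
  for D :: "('k::field, 'd) module" (structure) +
  assumes mult_closed [simp, intro]: "x \<in> carrier D \<Longrightarrow> y \<in> carrier D \<Longrightarrow> x \<otimes> y \<in> carrier D"
    and mult_assoc: "x \<in> carrier D \<Longrightarrow> y \<in> carrier D \<Longrightarrow> z \<in> carrier D \<Longrightarrow> (x \<otimes> y) \<otimes> z = x \<otimes> (y \<otimes> z)"
    and mult_l_distr: "x \<in> carrier D \<Longrightarrow> y \<in> carrier D \<Longrightarrow> z \<in> carrier D \<Longrightarrow> (x \<oplus> y) \<otimes> z = x \<otimes> z \<oplus> y \<otimes> z"
    and mult_r_distr: "x \<in> carrier D \<Longrightarrow> y \<in> carrier D \<Longrightarrow> z \<in> carrier D \<Longrightarrow> z \<otimes> (x \<oplus> y) = z \<otimes> x \<oplus> z \<otimes> y"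
    and scl_mult: "x \<in> carrier D \<Longrightarrow> y \<in> carrier D \<Longrightarrow> (t \<odot>\<^bsub>D\<^esub> x) \<otimes> y = t \<odot>\<^bsub>D\<^esub> (x \<otimes> y)"
    and mult_scl: "x \<in> carrier D \<Longrightarrow> y \<in> carrier D \<Longrightarrow> x \<otimes> (t \<odot>\<^bsub>D\<^esub> y) = t \<odot>\<^bsub>D\<^esub> (x \<otimes> y)"
begin

lemma zero_mult [simp]: "x \<in> carrier D \<Longrightarrow> \<zero> \<otimes> x = \<zero>"
  using scl_mult[of \<zero> x 0] by simp

lemma mult_zero [simp]: "x \<in> carrier D \<Longrightarrow> x \<otimes> \<zero> = \<zero>"
  using mult_scl[of x \<zero> 0] by simp

lemma minus_mult:
  "x \<in> carrier D \<Longrightarrow> y \<in> carrier D \<Longrightarrow> z \<in> carrier D \<Longrightarrow> (x \<ominus> y) \<otimes> z = x \<otimes> z \<ominus> y \<otimes> z"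
  using scl_mult[of y z "-1"] by (simp add: minus_eq mult_l_distr scl_minus_one)

lemma mult_minus:
  "x \<in> carrier D \<Longrightarrow> y \<in> carrier D \<Longrightarrow> z \<in> carrier D \<Longrightarrow> z \<otimes> (x \<ominus> y) = z \<otimes> x \<ominus> z \<otimes> y"
  using mult_scl[of z y "-1"] by (simp add: minus_eq mult_r_distr scl_minus_one)

definition principal :: "'d \<Rightarrow> 'd set" where
  "principal x = (\<lambda>d. d \<otimes> x) ` carrier D"

lemma principal_carrier: "x \<in> carrier D \<Longrightarrow> principal x \<subseteq> carrier D"
  by (auto simp: principal_def)

lemma principalD: "x \<in> carrier D \<Longrightarrow> y \<in> principal x \<Longrightarrow> y \<in> carrier D"
  using principal_carrier by blast

lemma principalI: "d \<in> carrier D \<Longrightarrow> d \<otimes> x \<in> principal x"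
  by (auto simp: principal_def)

lemma principal_left_mult: "x \<in> carrier D \<Longrightarrow> y \<in> principal x \<Longrightarrow> d \<in> carrier D \<Longrightarrow> d \<otimes> y \<in> principal x"
  by (auto simp: principal_def simp flip: mult_assoc)

lemma principal_ksubspace:
  assumes "x \<in> carrier D"
  shows "ksubspace (principal x) D"
proof (rule ksubspaceI)
  show "principal x \<subseteq> carrier D" using assms by (rule principal_carrier)
  show "\<zero> \<in> principal x" using principalI[of \<zero> x] assms by simp
  show "y \<oplus> z \<in> principal x" if "y \<in> principal x" "z \<in> principal x" for y z
    using that assms by (auto simp: principal_def simp flip: mult_l_distr)
  show "t \<odot>\<^bsub>D\<^esub> y \<in> principal x" if "y \<in> principal x" for t y
    using that assms by (auto simp: principal_def simp flip: scl_mult)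
qed

lemma principal_additive: "x \<in> carrier D \<Longrightarrow> additive_subgroup (principal x) D"
  using principal_ksubspace ksubspace_facts(5) by blast

lemma proj_module_simps [simp]:
  "carrier (proj_module D x) = principal x"
  "add (proj_module D x) = add D" "zero (proj_module D x) = \<zero>"
  "smult (proj_module D x) = mult D" "scale (proj_module D x) = smult D"
  by (simp_all add: proj_module_def principal_def)

text \<open>Below, \<open>P\<close> is a left ideal \<open>X\<close> regarded as a module.  The projective modules are of this
  form, and so are the members of their filtrations, whose carriers are changed by record updates.\<close>

context
  fixes P :: "('k, 'd, 'd) alg_module" and X
  assumes X: "ksubspace X D"
    and P: "carrier P = X" "add P = add D" "zero P = \<zero>" "smult P = mult D" "scale P = smult D"
begin

lemma alg_submodule_iff:
  assumes "F \<subseteq> X"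
  shows "alg_submodule D P F \<longleftrightarrow> ksubspace F D \<and> (\<forall>d\<in>carrier D. \<forall>x\<in>F. d \<otimes> x \<in> F)"
proof
  assume "alg_submodule D P F"
  then have sub: "submodule F D P" and scl: "\<And>t x. x \<in> F \<Longrightarrow> t \<odot>\<^bsub>D\<^esub> x \<in> F"
    using P by (auto simp: alg_submodule_def)
  interpret subgroup F "add_monoid P" using sub by (rule submodule.axioms)
  have "ksubspace F D"
    using assms ksubspace_facts(1)[OF X] m_closed one_closed P scl by (intro ksubspaceI) auto
  then show "ksubspace F D \<and> (\<forall>d\<in>carrier D. \<forall>x\<in>F. d \<otimes> x \<in> F)"
    using submodule.smult_closed[OF sub] P by simp
next
  assume F: "ksubspace F D \<and> (\<forall>d\<in>carrier D. \<forall>x\<in>F. d \<otimes> x \<in> F)"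
  interpret PP: abelian_group P using abelian_group_on[OF ksubspace_facts(5)[OF X]] P by blast
  note Ff = ksubspace_facts[OF conjunct1[OF F]]
  interpret FF: additive_subgroup F D by (rule Ff)
  have "F \<noteq> {}" using Ff(2) by blast
  moreover have "\<ominus>\<^bsub>P\<^esub> x \<in> F" if "x \<in> F" for x
    using a_inv_on[OF ksubspace_facts(5)[OF X] P(1,2,3), of x] that assms by auto
  ultimately have "subgroup F (add_monoid P)"
    using assms Ff(3) P by (intro group.subgroupI[OF PP.a_group]) (auto simp: a_inv_def)
  then show "alg_submodule D P F"
    using F Ff P by (auto simp: alg_submodule_def submodule_def submodule_axioms_def)
qed

context
  fixes S assumes S: "ksubspace S D" "\<And>d x. d \<in> carrier D \<Longrightarrow> x \<in> S \<Longrightarrow> d \<otimes> x \<in> S"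
begin

lemma quot_module_carrier: "carrier (quot_module P S) = (\<lambda>x. S +> x) ` X"
  by (simp add: quot_module_def a_rcosets_alt P a_r_coset_cong[of P D])

lemma quot_module_add:
  "x \<in> carrier D \<Longrightarrow> y \<in> carrier D \<Longrightarrow> (S +> x) \<oplus>\<^bsub>quot_module P S\<^esub> (S +> y) = S +> (x \<oplus> y)"
  using coset_add[OF ksubspace_facts(5)[OF S(1)]]
  by (simp add: quot_module_def P set_add_cong[of P D])

lemma quot_module_smult:
  assumes "x \<in> carrier D" "d \<in> carrier D"
  shows "d \<odot>\<^bsub>quot_module P S\<^esub> (S +> x) = S +> (d \<otimes> x)"
proof -
  have "(\<Union>z\<in>S +> x. S +> (d \<otimes> z)) = S +> (d \<otimes> x)"
    using ksubspace_facts[OF S(1)] S(2) assms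
    by (intro coset_UN) (auto simp: coset_eq_iff mult_minus[symmetric])
  then show ?thesis by (simp add: quot_module_def P a_r_coset_cong[of P D])
qed

lemma quot_module_scale:
  assumes "x \<in> carrier D"
  shows "scale (quot_module P S) t (S +> x) = S +> (t \<odot>\<^bsub>D\<^esub> x)"
proof -
  have "(\<Union>z\<in>S +> x. S +> (t \<odot>\<^bsub>D\<^esub> z)) = S +> (t \<odot>\<^bsub>D\<^esub> x)"
    using ksubspace_facts[OF S(1)] assms
    by (intro coset_UN) (auto simp: coset_eq_iff scl_minus[symmetric])
  then show ?thesis by (simp add: quot_module_def P a_r_coset_cong[of P D])
qed

end

end

end

text \<open>The model is the matrix algebra, where \<open>u (x, i) j\<close> is the class of the idempotent \<open>e\<^sub>x\<close> in row
  \<open>i - j\<close> and column \<open>i\<close>.  Then the elements \<open>u (x, i) 0\<close> are the diagonal idempotents, and \<open>u (x, i) N\<close>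
  is zero because it lies outside the band of nonzero entries.\<close>

locale shift_algebra = kalgebra D
  for D :: "('k::field, 'd) module" (structure) +
  fixes V :: "'v set" and N :: nat and u :: "'v \<times> int \<Rightarrow> nat \<Rightarrow> 'd"
  assumes u_closed [simp, intro]: "x \<in> V \<Longrightarrow> u (x, i) j \<in> carrier D"
    and u_mult: "x \<in> V \<Longrightarrow> u (x, i - int j) l \<otimes> u (x, i) j = u (x, i) (j + l)"
    and u_N: "x \<in> V \<Longrightarrow> u (x, i) N = \<zero>"
    and N_pos: "0 < N"
begin

lemma u_idem: "x \<in> V \<Longrightarrow> u (x, i) 0 \<otimes> u (x, i) 0 = u (x, i) 0"
  using u_mult[of x i 0 0] by simp

lemma u_right: "x \<in> V \<Longrightarrow> u (x, i) j \<otimes> u (x, i) 0 = u (x, i) j"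
  using u_mult[of x i 0 j] by simp

lemma u_left: "x \<in> V \<Longrightarrow> u (x, i - int j) 0 \<otimes> u (x, i) j = u (x, i) j"
  using u_mult[of x i j 0] by simp

end

text \<open>The purpose of these conditions is that the left ideals of \<open>u (x, i) j\<close>, for \<open>j = 0, \<dots>, N\<close>, filter
  the projective module at \<open>(x, i)\<close> with the standard modules at \<open>(x, i - j)\<close> as layers.  The condition
  \<open>above\<close> identifies the standard modules as quotients by \<open>u (x, i) 1\<close>, \<open>cancel\<close> gives the layers,
  \<open>local\<close> and \<open>proper\<close> make the endomorphisms of the standard modules scalar.\<close>

locale shift_quasi_hereditary = shift_algebra D V N u
  for D :: "('k::field, 'd) module" (structure) and V :: "'v set" and N u +
  fixes gt :: "'v \<times> int \<Rightarrow> 'v \<times> int \<Rightarrow> bool"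
  assumes gt_shift: "x \<in> V \<Longrightarrow> 0 < j \<Longrightarrow> gt (x, i - int j) (x, i)"
    and above: "\<lbrakk>\<mu> \<in> V \<times> UNIV; \<nu> \<in> V \<times> UNIV; gt \<mu> \<nu>; d \<in> carrier D\<rbrakk>
      \<Longrightarrow> u \<mu> 0 \<otimes> d \<otimes> u \<nu> 0 \<in> principal (u \<nu> (Suc 0))"
    and cancel: "\<lbrakk>x \<in> V; j < N; d \<in> principal (u (x, i - int j) 0); d \<otimes> u (x, i) j = \<zero>\<rbrakk>
      \<Longrightarrow> d \<in> principal (u (x, i - int j) (Suc 0))"
    and local: "\<lbrakk>x \<in> V; d \<in> carrier D\<rbrakk>
      \<Longrightarrow> \<exists>t. \<exists>w\<in>principal (u (x, i) (Suc 0)). u (x, i) 0 \<otimes> d \<otimes> u (x, i) 0 = t \<odot>\<^bsub>D\<^esub> u (x, i) 0 \<oplus> w"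
    and proper: "x \<in> V \<Longrightarrow> u (x, i) 0 \<notin> principal (u (x, i) (Suc 0))"
begin

abbreviation "idm \<nu> \<equiv> u \<nu> 0"
abbreviation "\<Lambda> \<equiv> V \<times> (UNIV :: int set)"
abbreviation "P \<nu> \<equiv> proj_module D (idm \<nu>)"
abbreviation "\<Delta> \<equiv> standard_module D \<Lambda> idm gt"

lemma principal_mono: "x \<in> V \<Longrightarrow> principal (u (x, i) j) \<subseteq> principal (idm (x, i))"
proof
  fix y assume x: "x \<in> V" and "y \<in> principal (u (x, i) j)"
  then obtain d where "d \<in> carrier D" "y = d \<otimes> u (x, i) j" by (auto simp: principal_def)
  then have "y = d \<otimes> u (x, i) j \<otimes> idm (x, i)" using u_right[OF x, of i j] x by (simp add: mult_assoc)
  then show "y \<in> principal (idm (x, i))" using \<open>d \<in> carrier D\<close> x by (auto intro: principalI)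
qed

lemma right_mult_hom:
  assumes "x \<in> V"
  shows "restrict (\<lambda>d. d \<otimes> u (x, i) j) (principal (idm (x, i - int j)))
           \<in> module_hom D (P (x, i - int j)) (P (x, i))"
proof -
  have mem: "d \<otimes> u (x, i) j \<in> principal (idm (x, i))" if "d \<in> carrier D" for d
    using principal_mono[OF assms] principalI[OF that] by blast
  have cl: "d \<in> carrier D" if "d \<in> principal (idm (x, i - int j))" for d
    using that assms principalD by blast
  have add: "d \<oplus> d' \<in> principal (idm (x, i - int j))"
    and scl: "t \<odot>\<^bsub>D\<^esub> d \<in> principal (idm (x, i - int j))"
    if "d \<in> principal (idm (x, i - int j))" "d' \<in> principal (idm (x, i - int j))" for d d' t
    using ksubspace_facts(3,4)[OF principal_ksubspace[OF u_closed[OF assms]]] that by blast+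
  show ?thesis
    unfolding module_hom_def
    using assms by (auto simp: mem cl add scl mult_l_distr scl_mult mult_assoc principal_left_mult)
qed

text \<open>Right multiplication by \<open>u (x, i) 1\<close> is one of the homomorphisms from a larger projective module,
  so its image belongs to the trace.  Conversely a homomorphism from the projective module at \<open>\<mu>\<close> sends
  the generator \<open>e\<^sub>\<mu>\<close> to an element fixed by \<open>e\<^sub>\<mu>\<close>, to which \<open>above\<close> applies.\<close>

lemma trace_eq:
  assumes "x \<in> V"
  shows "trace_above D \<Lambda> idm gt (x, i) = principal (u (x, i) (Suc 0))"
proof
  have "principal (u (x, i) (Suc 0)) \<subseteq> S"
    if "\<forall>\<mu>\<in>\<Lambda>. gt \<mu> (x, i) \<longrightarrow> (\<forall>h\<in>module_hom D (P \<mu>) (P (x, i)). h ` carrier (P \<mu>) \<subseteq> S)" for S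
  proof
    fix y assume "y \<in> principal (u (x, i) (Suc 0))"
    then obtain d where d: "d \<in> carrier D" "y = d \<otimes> u (x, i) (Suc 0)" by (auto simp: principal_def)
    let ?h = "restrict (\<lambda>d. d \<otimes> u (x, i) (Suc 0)) (principal (idm (x, i - int (Suc 0))))"
    have "?h ` principal (idm (x, i - int (Suc 0))) \<subseteq> S"
      using that right_mult_hom[OF assms, of i "Suc 0"] gt_shift[OF assms, of "Suc 0" i] assms
      by (metis (no_types, lifting) SigmaI UNIV_I proj_module_simps(1) zero_less_Suc)
    moreover have "?h (d \<otimes> idm (x, i - int (Suc 0))) = y"
      using d assms u_left[OF assms, of i "Suc 0"] principalI[of d] by (simp add: mult_assoc)
    ultimately show "y \<in> S" using principalI[OF d(1), of "idm (x, i - int (Suc 0))"] by blast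
  qed
  then show "principal (u (x, i) (Suc 0)) \<subseteq> trace_above D \<Lambda> idm gt (x, i)"
    unfolding trace_above_def by blast
  have "h ` carrier (P \<mu>) \<subseteq> principal (u (x, i) (Suc 0))"
    if \<mu>: "\<mu> \<in> \<Lambda>" "gt \<mu> (x, i)" and h: "h \<in> module_hom D (P \<mu>) (P (x, i))" for \<mu> h
  proof
    have [simp]: "idm \<mu> \<in> carrier D" "idm \<mu> \<otimes> idm \<mu> = idm \<mu>" using \<mu> u_idem by (auto simp: u_closed)
    have idP: "idm \<mu> \<in> principal (idm \<mu>)" using principalI[of "idm \<mu>" "idm \<mu>"] by simp
    have hD: "h (d \<otimes> y) = d \<otimes> h y" if "d \<in> carrier D" "y \<in> principal (idm \<mu>)" for d y
      using h that by (auto simp: module_hom_def)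
    have "h (idm \<mu>) \<in> principal (idm (x, i))" using h idP by (auto simp: module_hom_def)
    then obtain c where c: "c \<in> carrier D" "h (idm \<mu>) = c \<otimes> idm (x, i)" by (auto simp: principal_def)
    have "h (idm \<mu>) = idm \<mu> \<otimes> c \<otimes> idm (x, i)"
      using hD[of "idm \<mu>" "idm \<mu>"] idP c assms by (simp add: mult_assoc)
    also have "\<dots> \<in> principal (u (x, i) (Suc 0))" using above[OF \<mu>(1) _ \<mu>(2) c(1)] assms by simp
    finally have hid: "h (idm \<mu>) \<in> principal (u (x, i) (Suc 0))" .
    fix y assume "y \<in> h ` carrier (P \<mu>)"
    then obtain d where d: "d \<in> carrier D" "y = h (d \<otimes> idm \<mu>)" by (auto simp: principal_def)
    then have "y = d \<otimes> h (idm \<mu>)" using hD idP by simp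
    then show "y \<in> principal (u (x, i) (Suc 0))" using principal_left_mult hid d assms by simp
  qed
  moreover have "alg_submodule D (P (x, i)) (principal (u (x, i) (Suc 0)))"
    using principal_mono[OF assms] assms
    by (subst alg_submodule_iff[OF principal_ksubspace[of "idm (x, i)"]])
      (auto simp: principal_ksubspace principal_left_mult)
  ultimately show "trace_above D \<Lambda> idm gt (x, i) \<subseteq> principal (u (x, i) (Suc 0))"
    unfolding trace_above_def by blast
qed

context
  fixes x :: 'v and i :: int assumes x: "x \<in> V"
begin

abbreviation (input) "T \<equiv> principal (u (x, i) (Suc 0))"

lemma std_carrier: "carrier (\<Delta> (x, i)) = (\<lambda>d. T +> d) ` principal (idm (x, i))"
  and std_add: "a \<in> carrier D \<Longrightarrow> b \<in> carrier D \<Longrightarrow> (T +> a) \<oplus>\<^bsub>\<Delta> (x, i)\<^esub> (T +> b) = T +> (a \<oplus> b)"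
  and std_smult: "a \<in> carrier D \<Longrightarrow> d \<in> carrier D \<Longrightarrow> d \<odot>\<^bsub>\<Delta> (x, i)\<^esub> (T +> a) = T +> (d \<otimes> a)"
  and std_scale: "a \<in> carrier D \<Longrightarrow> scale (\<Delta> (x, i)) t (T +> a) = T +> (t \<odot>\<^bsub>D\<^esub> a)"
proof -
  have e: "ksubspace (principal (idm (x, i))) D" and T: "ksubspace T D"
    using x by (auto simp: principal_ksubspace)
  have \<Delta>: "\<Delta> (x, i) = quot_module (P (x, i)) T" by (simp add: standard_module_def trace_eq[OF x])
  show "carrier (\<Delta> (x, i)) = (\<lambda>d. T +> d) ` principal (idm (x, i))"
    unfolding \<Delta> by (rule quot_module_carrier[OF e]) (simp_all add: T principal_left_mult x)
  show "a \<in> carrier D \<Longrightarrow> b \<in> carrier D \<Longrightarrow> (T +> a) \<oplus>\<^bsub>\<Delta> (x, i)\<^esub> (T +> b) = T +> (a \<oplus> b)"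
    unfolding \<Delta> by (rule quot_module_add[OF e]) (simp_all add: T principal_left_mult x)
  show "a \<in> carrier D \<Longrightarrow> d \<in> carrier D \<Longrightarrow> d \<odot>\<^bsub>\<Delta> (x, i)\<^esub> (T +> a) = T +> (d \<otimes> a)"
    unfolding \<Delta> by (rule quot_module_smult[OF e]) (simp_all add: T principal_left_mult x)
  show "a \<in> carrier D \<Longrightarrow> scale (\<Delta> (x, i)) t (T +> a) = T +> (t \<odot>\<^bsub>D\<^esub> a)"
    unfolding \<Delta> by (rule quot_module_scale[OF e]) (simp_all add: T principal_left_mult x)
qed

text \<open>An endomorphism is determined by the image of the class of the generator \<open>e\<close>.  This image is fixed
  by \<open>e\<close>, hence a scalar multiple of that class by \<open>local\<close>; different scalars give different
  endomorphisms since the class is not zero by \<open>proper\<close>.\<close>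

lemma std_endo:
  "bij_betw (\<lambda>t. \<lambda>X\<in>carrier (\<Delta> (x, i)). scale (\<Delta> (x, i)) t X) UNIV (module_hom D (\<Delta> (x, i)) (\<Delta> (x, i)))"
proof -
  let ?e = "idm (x, i)" and ?s = "\<lambda>t. \<lambda>X\<in>carrier (\<Delta> (x, i)). scale (\<Delta> (x, i)) t X"
  have e [simp]: "?e \<in> carrier D" "?e \<otimes> ?e = ?e" "?e \<in> principal ?e"
    using x u_idem[OF x, of i] principalI[of ?e ?e] by auto
  have T: "additive_subgroup T D" "T \<subseteq> carrier D" using x by (auto simp: principal_additive principal_carrier)
  have sub: "d \<in> carrier D" if "d \<in> principal ?e" for d using principalD[OF e(1) that] .
  note pe = ksubspace_facts[OF principal_ksubspace[OF e(1)]]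
  have mem: "T +> d \<in> carrier (\<Delta> (x, i))" if "d \<in> principal ?e" for d
    using that by (simp add: std_carrier)
  have hom: "?s t \<in> module_hom D (\<Delta> (x, i)) (\<Delta> (x, i))" for t
    unfolding module_hom_def std_carrier
    by (auto simp: std_add std_smult std_scale sub pe principal_left_mult scl_add mult_scl scl_scl mult.commute)
  have inj: "t = t'" if "?s t = ?s t'" for t t'
  proof (rule ccontr)
    assume ne: "t \<noteq> t'"
    have "T +> (t \<odot>\<^bsub>D\<^esub> ?e) = T +> (t' \<odot>\<^bsub>D\<^esub> ?e)"
      using fun_cong[OF that, of "T +> ?e"] mem[of ?e] by (simp add: std_scale)
    then have "t \<odot>\<^bsub>D\<^esub> ?e \<ominus> t' \<odot>\<^bsub>D\<^esub> ?e \<in> T" using coset_eq_iff[OF T(1)] by simp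
    moreover have "t \<odot>\<^bsub>D\<^esub> ?e \<ominus> t' \<odot>\<^bsub>D\<^esub> ?e = (t - t') \<odot>\<^bsub>D\<^esub> ?e"
      using add_scl[of ?e t "- t'"] scl_scl[of ?e "-1" t'] scl_minus_one[of "t' \<odot>\<^bsub>D\<^esub> ?e"] by (simp add: minus_eq)
    ultimately have "inverse (t - t') \<odot>\<^bsub>D\<^esub> ((t - t') \<odot>\<^bsub>D\<^esub> ?e) \<in> T"
      using ksubspace_facts(4)[OF principal_ksubspace[OF u_closed[OF x]]] by simp
    then show False using ne proper[OF x, of i] by (simp add: scl_scl)
  qed
  have surj: "\<exists>t. f = ?s t" if f: "f \<in> module_hom D (\<Delta> (x, i)) (\<Delta> (x, i))" for f
  proof -
    have fe: "f (T +> ?e) \<in> carrier (\<Delta> (x, i))" using f mem[of ?e] by (auto simp: module_hom_def)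
    then obtain y where y: "y \<in> principal ?e" "f (T +> ?e) = T +> y" by (auto simp: std_carrier)
    then obtain c where c: "c \<in> carrier D" "y = c \<otimes> ?e" by (auto simp: principal_def)
    have lin: "f (d \<odot>\<^bsub>\<Delta> (x, i)\<^esub> X) = d \<odot>\<^bsub>\<Delta> (x, i)\<^esub> f X" if "d \<in> carrier D" "X \<in> carrier (\<Delta> (x, i))" for d X
      using f that by (auto simp: module_hom_def)
    obtain t w where t: "w \<in> T" "?e \<otimes> c \<otimes> ?e = t \<odot>\<^bsub>D\<^esub> ?e \<oplus> w" using local[OF x c(1)] by blast
    have w: "w \<in> carrier D" using t T by blast
    have "f (T +> ?e) = f (?e \<odot>\<^bsub>\<Delta> (x, i)\<^esub> (T +> ?e))" by (simp add: std_smult)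
    also have "\<dots> = ?e \<odot>\<^bsub>\<Delta> (x, i)\<^esub> f (T +> ?e)" using lin[of ?e "T +> ?e"] mem[of ?e] by simp
    also have "\<dots> = T +> (?e \<otimes> c \<otimes> ?e)" using y c by (simp add: std_smult mult_assoc)
    also have "\<dots> = T +> (t \<odot>\<^bsub>D\<^esub> ?e)"
      using t w T by (subst coset_eq_iff) (auto simp: t(2) minus_eq a_ac r_neg)
    finally have ft: "f (T +> ?e) = T +> (t \<odot>\<^bsub>D\<^esub> ?e)" .
    have "f X = ?s t X" for X
    proof (cases "X \<in> carrier (\<Delta> (x, i))")
      case True
      then obtain d where d: "d \<in> carrier D" "X = T +> (d \<otimes> ?e)" by (auto simp: std_carrier principal_def)
      have "f X = f (d \<odot>\<^bsub>\<Delta> (x, i)\<^esub> (T +> ?e))" using d by (simp add: std_smult)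
      also have "\<dots> = d \<odot>\<^bsub>\<Delta> (x, i)\<^esub> (T +> (t \<odot>\<^bsub>D\<^esub> ?e))" using lin[OF d(1) mem[of ?e]] ft by simp
      also have "\<dots> = scale (\<Delta> (x, i)) t X" using d by (simp add: std_smult std_scale mult_scl)
      finally show ?thesis using True by simp
    next
      case False
      then show ?thesis using f by (auto simp: module_hom_def PiE_def extensional_def)
    qed
    then show ?thesis by blast
  qed
  show ?thesis
    unfolding bij_betw_def inj_on_def using hom surj inj by blast
qed

end

text \<open>Right multiplication by \<open>u (x, i) j\<close> maps the projective module at \<open>(x, i - j)\<close> onto the \<open>j\<close>-th
  member of the filtration.  The preimage of the next member is exactly the trace that is divided out
  in the standard module: if \<open>z u (x, i) j = d u (x, i) (j + 1)\<close>, then \<open>z - d u (x, i - j) 1\<close> is killed by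
  \<open>u (x, i) j\<close> and \<open>cancel\<close> applies.\<close>

lemma layer_iso:
  assumes x: "x \<in> V" and j: "j < N"
  shows "module_isomorphic D (quot_module (P (x, i)\<lparr>carrier := principal (u (x, i) j)\<rparr>)
           (principal (u (x, i) (Suc j)))) (\<Delta> (x, i - int j))"
proof -
  let ?u = "u (x, i) j" and ?e' = "idm (x, i - int j)"
    and ?T = "principal (u (x, i - int j) (Suc 0))" and ?F = "principal (u (x, i) j)" and ?F' = "principal (u (x, i) (Suc j))"
  let ?Q = "quot_module (P (x, i)\<lparr>carrier := ?F\<rparr>) ?F'"
  have [simp]: "?u \<in> carrier D" "?e' \<in> carrier D" "u (x, i - int j) (Suc 0) \<in> carrier D" "u (x, i) (Suc j) \<in> carrier D"
    using x by auto
  have T: "additive_subgroup ?T D" "additive_subgroup ?F' D" by (auto simp: principal_additive)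
  have Fk: "ksubspace ?F D" and Fk': "ksubspace ?F' D" by (auto simp: principal_ksubspace)
  have e'u: "?e' \<otimes> ?u = ?u" using u_left[OF x] .
  have F_alt: "?F = (\<lambda>d. d \<otimes> ?u) ` principal ?e'"
    unfolding principal_def image_image using e'u by (intro image_cong) (simp_all add: mult_assoc)
  have sub: "d \<in> carrier D" if "d \<in> principal ?e'" for d using that principalD[of ?e'] by simp
  have key: "z \<otimes> ?u \<in> ?F' \<longleftrightarrow> z \<in> ?T" if z: "z \<in> principal ?e'" for z
  proof
    have u1: "d \<otimes> u (x, i - int j) (Suc 0) \<otimes> ?u = d \<otimes> u (x, i) (Suc j)" if "d \<in> carrier D" for d
      using u_mult[OF x, of i j 1] that by (simp add: mult_assoc)
    show "z \<otimes> ?u \<in> ?F'" if "z \<in> ?T" using that u1 by (auto simp: principal_def)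
    assume "z \<otimes> ?u \<in> ?F'"
    then obtain d where d: "d \<in> carrier D" "z \<otimes> ?u = d \<otimes> u (x, i) (Suc j)" by (auto simp: principal_def)
    let ?w = "d \<otimes> u (x, i - int j) (Suc 0)"
    have w: "?w \<in> ?T" "?w \<in> carrier D" using d by (auto intro: principalI)
    have "?w \<in> principal ?e'" using w principal_mono[OF x] by blast
    then have "z \<ominus> ?w \<in> principal ?e'"
      using z ksubspace_facts(3)[OF principal_ksubspace[of ?e'], of z "\<ominus> ?w"]
        ksubspace_facts(4)[OF principal_ksubspace[of ?e'], of ?w "-1"] w
      by (simp add: minus_eq scl_minus_one)
    moreover have "(z \<ominus> ?w) \<otimes> ?u = \<zero>"
      using z d w sub u1 by (simp add: minus_mult) (simp add: minus_eq r_neg)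
    ultimately have "z \<ominus> ?w \<in> ?T" using cancel[OF x j] by blast
    then have "(z \<ominus> ?w) \<oplus> ?w \<in> ?T" using additive_subgroup.a_closed[OF T(1)] w by blast
    then show "z \<in> ?T" using z w sub by (simp add: minus_eq a_assoc l_neg)
  qed
  have diff: "d \<ominus> d' \<in> principal ?e'" if "d \<in> principal ?e'" "d' \<in> principal ?e'" for d d'
    using that ksubspace_facts(3)[OF principal_ksubspace[of ?e'], of d "\<ominus> d'"]
      ksubspace_facts(4)[OF principal_ksubspace[of ?e'], of d' "-1"] sub
    by (simp add: minus_eq scl_minus_one)
  have key2: "?F' +> (d \<otimes> ?u) = ?F' +> (d' \<otimes> ?u) \<longleftrightarrow> ?T +> d = ?T +> d'"
    if "d \<in> principal ?e'" "d' \<in> principal ?e'" for d d'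
    using that sub key[OF diff[OF that]] T by (simp add: coset_eq_iff minus_mult)
  have q_carrier: "carrier ?Q = (\<lambda>d. ?F' +> (d \<otimes> ?u)) ` principal ?e'"
    by (subst quot_module_carrier[OF Fk _ _ _ _ _ Fk'])
      (auto simp: principal_left_mult F_alt image_image)
  have q_add: "(?F' +> a) \<oplus>\<^bsub>?Q\<^esub> (?F' +> b) = ?F' +> (a \<oplus> b)" if "a \<in> carrier D" "b \<in> carrier D" for a b
    using that by (subst quot_module_add[OF Fk _ _ _ _ _ Fk']) (simp_all add: principal_left_mult)
  have q_smult: "c \<odot>\<^bsub>?Q\<^esub> (?F' +> a) = ?F' +> (c \<otimes> a)" if "a \<in> carrier D" "c \<in> carrier D" for a c
    using that by (subst quot_module_smult[OF Fk _ _ _ _ _ Fk']) (simp_all add: principal_left_mult)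
  have q_scale: "scale ?Q t (?F' +> a) = ?F' +> (t \<odot>\<^bsub>D\<^esub> a)" if "a \<in> carrier D" for a t
    using that by (subst quot_module_scale[OF Fk _ _ _ _ _ Fk']) (simp_all add: principal_left_mult)
  define f where "f = (\<lambda>X\<in>carrier ?Q. ?T +> (SOME d. d \<in> principal ?e' \<and> X = ?F' +> (d \<otimes> ?u)))"
  have f: "f (?F' +> (d \<otimes> ?u)) = ?T +> d" if d: "d \<in> principal ?e'" for d
  proof -
    define d' where "d' = (SOME d'. d' \<in> principal ?e' \<and> ?F' +> (d \<otimes> ?u) = ?F' +> (d' \<otimes> ?u))"
    have "d' \<in> principal ?e' \<and> ?F' +> (d \<otimes> ?u) = ?F' +> (d' \<otimes> ?u)"
      unfolding d'_def by (rule someI[where x = d]) (use d in blast)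
    then have "?T +> d' = ?T +> d" using key2 d by auto
    then show ?thesis using d unfolding f_def q_carrier by (simp add: d'_def)
  qed
  note pe = ksubspace_facts[OF principal_ksubspace[of ?e']]
  have "f \<in> module_hom D ?Q (\<Delta> (x, i - int j))"
  proof -
    have "f \<in> carrier ?Q \<rightarrow>\<^sub>E carrier (\<Delta> (x, i - int j))"
      using f by (auto simp: std_carrier[OF x] q_carrier f_def)
    moreover have "f (X \<oplus>\<^bsub>?Q\<^esub> Y) = f X \<oplus>\<^bsub>\<Delta> (x, i - int j)\<^esub> f Y" if XY: "X \<in> carrier ?Q" "Y \<in> carrier ?Q" for X Y
    proof -
      obtain a b where ab: "a \<in> principal ?e'" "X = ?F' +> (a \<otimes> ?u)" "b \<in> principal ?e'" "Y = ?F' +> (b \<otimes> ?u)"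
        using XY unfolding q_carrier by blast
      have "X \<oplus>\<^bsub>?Q\<^esub> Y = ?F' +> ((a \<oplus> b) \<otimes> ?u)" using ab sub by (simp add: q_add mult_l_distr)
      then show ?thesis using f[OF pe(3), of a b] f[of a] f[of b] ab sub by (simp add: std_add[OF x])
    qed
    moreover have "f (c \<odot>\<^bsub>?Q\<^esub> X) = c \<odot>\<^bsub>\<Delta> (x, i - int j)\<^esub> f X" if c: "c \<in> carrier D" and X: "X \<in> carrier ?Q" for c X
    proof -
      obtain a where a: "a \<in> principal ?e'" "X = ?F' +> (a \<otimes> ?u)" using X unfolding q_carrier by blast
      have "c \<odot>\<^bsub>?Q\<^esub> X = ?F' +> ((c \<otimes> a) \<otimes> ?u)" using a c sub by (simp add: q_smult mult_assoc)
      then show ?thesis using f[OF principal_left_mult, of a c] f[of a] a c sub by (simp add: std_smult[OF x])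
    qed
    moreover have "f (scale ?Q t X) = scale (\<Delta> (x, i - int j)) t (f X)" if X: "X \<in> carrier ?Q" for t X
    proof -
      obtain a where a: "a \<in> principal ?e'" "X = ?F' +> (a \<otimes> ?u)" using X unfolding q_carrier by blast
      have "scale ?Q t X = ?F' +> ((t \<odot>\<^bsub>D\<^esub> a) \<otimes> ?u)" using a sub by (simp add: q_scale scl_mult)
      then show ?thesis using f[OF pe(4), of a t] f[of a] a sub by (simp add: std_scale[OF x])
    qed
    ultimately show ?thesis by (simp add: module_hom_def)
  qed
  moreover have "bij_betw f (carrier ?Q) (carrier (\<Delta> (x, i - int j)))"
    unfolding bij_betw_def
  proof
    show "inj_on f (carrier ?Q)" using f key2 by (auto simp: inj_on_def q_carrier)
    show "f ` carrier ?Q = carrier (\<Delta> (x, i - int j))"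
      unfolding q_carrier std_carrier[OF x] image_image using f by (intro image_cong) auto
  qed
  ultimately show ?thesis unfolding module_isomorphic_def by blast
qed

theorem quasi_hereditary: "quasi_hereditary D \<Lambda> idm gt"
  unfolding quasi_hereditary_def Let_def
proof (intro ballI conjI)
  fix \<nu> assume "\<nu> \<in> \<Lambda>"
  then obtain x i where \<nu>: "\<nu> = (x, i)" and x: "x \<in> V" by auto
  show "bij_betw (\<lambda>t. \<lambda>X\<in>carrier (\<Delta> \<nu>). scale (\<Delta> \<nu>) t X) UNIV (module_hom D (\<Delta> \<nu>) (\<Delta> \<nu>))"
    unfolding \<nu> by (rule std_endo[OF x])
  obtain m where m: "N = Suc m" using N_pos gr0_implies_Suc by blast
  let ?F = "\<lambda>j. principal (u (x, i) j)"
  have F0: "?F N = {\<zero>}"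
    using u_N[OF x] zero_closed by (auto simp: principal_def image_iff intro!: bexI[of _ \<zero>])
  have sub: "?F (Suc j) \<subseteq> ?F j" for j
  proof
    fix y assume "y \<in> ?F (Suc j)"
    then obtain d where "d \<in> carrier D" "y = d \<otimes> u (x, i) (Suc j)" by (auto simp: principal_def)
    then have "y = d \<otimes> u (x, i - int j) (Suc 0) \<otimes> u (x, i) j"
      using u_mult[OF x, of i j "Suc 0"] x by (simp add: mult_assoc)
    then show "y \<in> ?F j" using \<open>d \<in> carrier D\<close> x by (auto intro: principalI)
  qed
  have "alg_submodule D (P (x, i)) (?F j)" for j
    using principal_mono[OF x] x
    by (subst alg_submodule_iff[OF principal_ksubspace[of "idm (x, i)"]])
      (auto simp: principal_ksubspace principal_left_mult)
  then show "\<exists>m F \<mu>. F 0 = carrier (P \<nu>) \<and> F (Suc m) = {\<zero>\<^bsub>P \<nu>\<^esub>} \<and>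
         (\<forall>j\<le>Suc m. alg_submodule D (P \<nu>) (F j)) \<and>
         (\<forall>j\<le>m. F (Suc j) \<subseteq> F j \<and>
            module_isomorphic D (quot_module (P \<nu>\<lparr>carrier := F j\<rparr>) (F (Suc j))) (\<Delta> (\<mu> j))) \<and>
         \<mu> 0 = \<nu> \<and> (\<forall>j\<in>{1..m}. \<mu> j \<in> \<Lambda> \<and> gt (\<mu> j) \<nu>)"
    using F0 sub layer_iso[OF x] gt_shift[OF x] x m
    by (intro exI[of _ m] exI[of _ ?F] exI[of _ "\<lambda>j. (x, i - int j)"]) (auto simp: \<nu> less_Suc_eq_le)
qed

end


section \<open>Trivial extensions\<close>

context kalgebra
begin

lemma finsum_mult_right:
  "finite F \<Longrightarrow> g \<in> F \<rightarrow> carrier D \<Longrightarrow> x \<in> carrier D \<Longrightarrow> finsum D g F \<otimes> x = finsum D (\<lambda>s. g s \<otimes> x) F"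
  by (induction F rule: finite_induct) (auto simp: finsum_insert mult_l_distr Pi_def)

lemma finsum_mult_left:
  "finite F \<Longrightarrow> g \<in> F \<rightarrow> carrier D \<Longrightarrow> x \<in> carrier D \<Longrightarrow> x \<otimes> finsum D g F = finsum D (\<lambda>s. x \<otimes> g s) F"
  by (induction F rule: finite_induct) (auto simp: finsum_insert mult_r_distr Pi_def)

end

text \<open>The last two conditions say that every element is supported on finitely many idempotents.  They
  keep the restricted dual stable under the actions of the algebra.\<close>

locale local_unit_algebra = kalgebra C
  for C :: "('k::field, 'c) module" (structure) +
  fixes \<Lambda> :: "'l set" and e :: "'l \<Rightarrow> 'c"
  assumes e_closed [simp, intro]: "\<nu> \<in> \<Lambda> \<Longrightarrow> e \<nu> \<in> carrier C"
    and e_idem: "\<nu> \<in> \<Lambda> \<Longrightarrow> e \<nu> \<otimes> e \<nu> = e \<nu>"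
    and e_orth: "\<mu> \<in> \<Lambda> \<Longrightarrow> \<nu> \<in> \<Lambda> \<Longrightarrow> \<mu> \<noteq> \<nu> \<Longrightarrow> e \<mu> \<otimes> e \<nu> = \<zero>"
    and l_unit: "a \<in> carrier C \<Longrightarrow> \<exists>F\<subseteq>\<Lambda>. finite F \<and> a = finsum C (\<lambda>\<nu>. e \<nu> \<otimes> a) F"
    and r_unit: "a \<in> carrier C \<Longrightarrow> \<exists>F\<subseteq>\<Lambda>. finite F \<and> a = finsum C (\<lambda>\<nu>. a \<otimes> e \<nu>) F"
begin

abbreviation "dual \<equiv> restricted_dual C \<Lambda> e"

lemma dual_iff:
  "f \<in> dual \<longleftrightarrow> (\<forall>a. a \<notin> carrier C \<longrightarrow> f a = 0) \<and> linear_form C f \<and>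
     finite {(\<mu>, \<nu>). \<mu> \<in> \<Lambda> \<and> \<nu> \<in> \<Lambda> \<and> (\<exists>a\<in>carrier C. f (e \<mu> \<otimes> a \<otimes> e \<nu>) \<noteq> 0)}"
  unfolding restricted_dual_def linear_form_def by auto

lemma dual_linear: "f \<in> dual \<Longrightarrow> linear_form C f"
  by (simp add: dual_iff)

lemma dual_outside: "f \<in> dual \<Longrightarrow> a \<notin> carrier C \<Longrightarrow> f a = 0"
  by (simp add: dual_iff)

lemma l_support:
  assumes "a \<in> carrier C" "F \<subseteq> \<Lambda>" "finite F" "a = finsum C (\<lambda>\<nu>. e \<nu> \<otimes> a) F" "\<mu> \<in> \<Lambda>" "\<mu> \<notin> F"
  shows "e \<mu> \<otimes> a = \<zero>"
proof -
  have "e \<mu> \<otimes> a = e \<mu> \<otimes> finsum C (\<lambda>\<nu>. e \<nu> \<otimes> a) F" using assms(4) by simp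
  also have "\<dots> = finsum C (\<lambda>\<nu>. e \<mu> \<otimes> (e \<nu> \<otimes> a)) F"
    using assms by (intro finsum_mult_left) auto
  also have "\<dots> = \<zero>"
  proof (rule add.finprod_one_eqI)
    fix \<nu> assume \<nu>: "\<nu> \<in> F"
    then have "e \<mu> \<otimes> (e \<nu> \<otimes> a) = e \<mu> \<otimes> e \<nu> \<otimes> a" using assms by (subst mult_assoc) auto
    then show "e \<mu> \<otimes> (e \<nu> \<otimes> a) = \<zero>" using e_orth[of \<mu> \<nu>] \<nu> assms(1,2,5,6) by (cases "\<mu> = \<nu>") auto
  qed
  finally show ?thesis .
qed

lemma r_support:
  assumes "a \<in> carrier C" "F \<subseteq> \<Lambda>" "finite F" "a = finsum C (\<lambda>\<nu>. a \<otimes> e \<nu>) F" "\<mu> \<in> \<Lambda>" "\<mu> \<notin> F"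
  shows "a \<otimes> e \<mu> = \<zero>"
proof -
  have "a \<otimes> e \<mu> = finsum C (\<lambda>\<nu>. a \<otimes> e \<nu>) F \<otimes> e \<mu>" using assms(4) by simp
  also have "\<dots> = finsum C (\<lambda>\<nu>. a \<otimes> e \<nu> \<otimes> e \<mu>) F"
    using assms by (intro finsum_mult_right) auto
  also have "\<dots> = \<zero>"
  proof (rule add.finprod_one_eqI)
    fix \<nu> assume \<nu>: "\<nu> \<in> F"
    then have "a \<otimes> e \<nu> \<otimes> e \<mu> = a \<otimes> (e \<nu> \<otimes> e \<mu>)" using assms by (subst mult_assoc) auto
    then show "a \<otimes> e \<nu> \<otimes> e \<mu> = \<zero>" using e_orth[of \<nu> \<mu>] \<nu> assms(1,2,5,6) by (cases "\<mu> = \<nu>") auto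
  qed
  finally show ?thesis .
qed

text \<open>A value \<open>f (e\<^sub>\<mu> b e\<^sub>\<nu> a)\<close> can only be nonzero for the finitely many \<open>\<nu>\<close> with \<open>e\<^sub>\<nu> a \<noteq> 0\<close>.  Since \<open>a\<close> is the
  sum of finitely many \<open>a e\<^sub>\<lambda>\<close>, moreover \<open>f\<close> has to be nonzero on some component \<open>e\<^sub>\<mu> C e\<^sub>\<lambda>\<close>, which
  leaves finitely many \<open>\<mu>\<close>.\<close>

lemma dual_lact_closed:
  assumes a: "a \<in> carrier C" and f: "f \<in> dual"
  shows "dual_lact C a f \<in> dual"
proof -
  note lin = linear_formD[OF dual_linear[OF f]]
  obtain F where F: "F \<subseteq> \<Lambda>" "finite F" "a = finsum C (\<lambda>\<nu>. a \<otimes> e \<nu>) F" using r_unit[OF a] by blast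
  obtain F' where F': "F' \<subseteq> \<Lambda>" "finite F'" "a = finsum C (\<lambda>\<nu>. e \<nu> \<otimes> a) F'" using l_unit[OF a] by blast
  let ?S = "{(\<mu>, \<nu>). \<mu> \<in> \<Lambda> \<and> \<nu> \<in> \<Lambda> \<and> (\<exists>b\<in>carrier C. f (e \<mu> \<otimes> b \<otimes> e \<nu>) \<noteq> 0)}"
  have "{(\<mu>, \<nu>). \<mu> \<in> \<Lambda> \<and> \<nu> \<in> \<Lambda> \<and> (\<exists>b\<in>carrier C. dual_lact C a f (e \<mu> \<otimes> b \<otimes> e \<nu>) \<noteq> 0)}
      \<subseteq> fst ` ?S \<times> F'"
  proof clarify
    fix \<mu> \<nu> b assume *: "\<mu> \<in> \<Lambda>" "\<nu> \<in> \<Lambda>" "b \<in> carrier C" "dual_lact C a f (e \<mu> \<otimes> b \<otimes> e \<nu>) \<noteq> 0"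
    have ne: "f (e \<mu> \<otimes> b \<otimes> e \<nu> \<otimes> a) \<noteq> 0" using * by (simp add: dual_lact_def)
    let ?b = "b \<otimes> e \<nu> \<otimes> a"
    have "e \<mu> \<otimes> b \<otimes> e \<nu> \<otimes> a = e \<mu> \<otimes> b \<otimes> e \<nu> \<otimes> finsum C (\<lambda>\<nu>. a \<otimes> e \<nu>) F" using F(3) by simp
    also have "\<dots> = finsum C (\<lambda>\<nu>'. e \<mu> \<otimes> b \<otimes> e \<nu> \<otimes> (a \<otimes> e \<nu>')) F"
      using * a F by (intro finsum_mult_left) auto
    also have "\<dots> = finsum C (\<lambda>\<nu>'. e \<mu> \<otimes> ?b \<otimes> e \<nu>') F"
      using * a F by (intro finsum_cong') (auto simp: mult_assoc)
    finally have eq: "e \<mu> \<otimes> b \<otimes> e \<nu> \<otimes> a = finsum C (\<lambda>\<nu>'. e \<mu> \<otimes> ?b \<otimes> e \<nu>') F" .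
    have "f (e \<mu> \<otimes> b \<otimes> e \<nu> \<otimes> a) = (\<Sum>\<nu>'\<in>F. f (e \<mu> \<otimes> ?b \<otimes> e \<nu>'))"
      unfolding eq using * a F by (intro linear_form_finsum[OF dual_linear[OF f]]) auto
    then obtain \<nu>' where \<nu>': "\<nu>' \<in> F" "f (e \<mu> \<otimes> ?b \<otimes> e \<nu>') \<noteq> 0"
      using ne by (auto elim: sum.not_neutral_contains_not_neutral)
    then have "(\<mu>, \<nu>') \<in> ?S" using *(1-3) a F(1) by (auto intro!: bexI[of _ ?b])
    moreover have "\<nu> \<in> F'"
    proof (rule ccontr)
      assume "\<nu> \<notin> F'"
      then have "e \<nu> \<otimes> a = \<zero>" using l_support[OF a F'] * by blast
      then show False using ne * a linear_form_zero[OF dual_linear[OF f]] by (simp add: mult_assoc)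
    qed
    ultimately show "\<mu> \<in> fst ` ?S \<and> \<nu> \<in> F'" by force
  qed
  moreover have "finite (fst ` ?S \<times> F')" using f F'(2) by (simp add: dual_iff)
  moreover have "linear_form C (dual_lact C a f)"
    using a by (auto simp: linear_form_def dual_lact_def mult_l_distr scl_mult lin)
  ultimately show ?thesis
    by (simp add: dual_iff finite_subset) (simp add: dual_lact_def)
qed

lemma dual_ract_closed:
  assumes a: "a \<in> carrier C" and f: "f \<in> dual"
  shows "dual_ract C f a \<in> dual"
proof -
  note lin = linear_formD[OF dual_linear[OF f]]
  obtain F where F: "F \<subseteq> \<Lambda>" "finite F" "a = finsum C (\<lambda>\<nu>. e \<nu> \<otimes> a) F" using l_unit[OF a] by blast
  obtain F' where F': "F' \<subseteq> \<Lambda>" "finite F'" "a = finsum C (\<lambda>\<nu>. a \<otimes> e \<nu>) F'" using r_unit[OF a] by blast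
  let ?S = "{(\<mu>, \<nu>). \<mu> \<in> \<Lambda> \<and> \<nu> \<in> \<Lambda> \<and> (\<exists>b\<in>carrier C. f (e \<mu> \<otimes> b \<otimes> e \<nu>) \<noteq> 0)}"
  have "{(\<mu>, \<nu>). \<mu> \<in> \<Lambda> \<and> \<nu> \<in> \<Lambda> \<and> (\<exists>b\<in>carrier C. dual_ract C f a (e \<mu> \<otimes> b \<otimes> e \<nu>) \<noteq> 0)}
      \<subseteq> F' \<times> snd ` ?S"
  proof clarify
    fix \<mu> \<nu> b assume *: "\<mu> \<in> \<Lambda>" "\<nu> \<in> \<Lambda>" "b \<in> carrier C" "dual_ract C f a (e \<mu> \<otimes> b \<otimes> e \<nu>) \<noteq> 0"
    let ?b = "a \<otimes> e \<mu> \<otimes> b"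
    have ne: "f (a \<otimes> (e \<mu> \<otimes> b \<otimes> e \<nu>)) \<noteq> 0" using * by (simp add: dual_ract_def)
    have "a \<otimes> (e \<mu> \<otimes> b \<otimes> e \<nu>) = finsum C (\<lambda>\<nu>. e \<nu> \<otimes> a) F \<otimes> (e \<mu> \<otimes> b \<otimes> e \<nu>)" using F(3) by simp
    also have "\<dots> = finsum C (\<lambda>\<nu>'. e \<nu>' \<otimes> a \<otimes> (e \<mu> \<otimes> b \<otimes> e \<nu>)) F"
      using * a F by (intro finsum_mult_right) auto
    also have "\<dots> = finsum C (\<lambda>\<nu>'. e \<nu>' \<otimes> ?b \<otimes> e \<nu>) F"
      using * a F by (intro finsum_cong') (auto simp: mult_assoc)
    finally have eq: "a \<otimes> (e \<mu> \<otimes> b \<otimes> e \<nu>) = finsum C (\<lambda>\<nu>'. e \<nu>' \<otimes> ?b \<otimes> e \<nu>) F" .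
    have "f (a \<otimes> (e \<mu> \<otimes> b \<otimes> e \<nu>)) = (\<Sum>\<nu>'\<in>F. f (e \<nu>' \<otimes> ?b \<otimes> e \<nu>))"
      unfolding eq using * a F by (intro linear_form_finsum[OF dual_linear[OF f]]) auto
    then obtain \<nu>' where \<nu>': "\<nu>' \<in> F" "f (e \<nu>' \<otimes> ?b \<otimes> e \<nu>) \<noteq> 0"
      using ne by (auto elim: sum.not_neutral_contains_not_neutral)
    then have "(\<nu>', \<nu>) \<in> ?S" using *(1-3) a F(1) by (auto intro!: bexI[of _ ?b])
    moreover have "\<mu> \<in> F'"
    proof (rule ccontr)
      assume "\<mu> \<notin> F'"
      then have "a \<otimes> e \<mu> = \<zero>" using r_support[OF a F'] * by blast
      then have "a \<otimes> (e \<mu> \<otimes> b \<otimes> e \<nu>) = \<zero>" using * a by (simp flip: mult_assoc)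
      then show False using ne linear_form_zero[OF dual_linear[OF f]] by simp
    qed
    ultimately show "\<mu> \<in> F' \<and> \<nu> \<in> snd ` ?S" by force
  qed
  moreover have "finite (F' \<times> snd ` ?S)" using f F'(2) by (simp add: dual_iff)
  moreover have "linear_form C (dual_ract C f a)"
    using a by (auto simp: linear_form_def dual_ract_def mult_r_distr mult_scl lin)
  ultimately show ?thesis
    by (simp add: dual_iff finite_subset) (simp add: dual_ract_def)
qed

lemma dual_zero: "(\<lambda>_. 0) \<in> dual"
  by (simp add: dual_iff linear_form_def)

lemma dual_add:
  assumes "f \<in> dual" "g \<in> dual"
  shows "(\<lambda>x. f x + g x) \<in> dual"
proof -
  let ?S = "\<lambda>f. {(\<mu>, \<nu>). \<mu> \<in> \<Lambda> \<and> \<nu> \<in> \<Lambda> \<and> (\<exists>b\<in>carrier C. f (e \<mu> \<otimes> b \<otimes> e \<nu>) \<noteq> 0)}"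
  have "f x \<noteq> 0 \<or> g x \<noteq> 0" if "f x + g x \<noteq> 0" for x using that by auto
  then have "?S (\<lambda>x. f x + g x) \<subseteq> ?S f \<union> ?S g" by blast
  moreover have "finite (?S f \<union> ?S g)" using assms by (simp add: dual_iff)
  ultimately have "finite (?S (\<lambda>x. f x + g x))" by (rule finite_subset)
  then show ?thesis using assms by (simp add: dual_iff linear_form_def algebra_simps)
qed

lemma dual_scl:
  assumes "f \<in> dual"
  shows "(\<lambda>x. t * f x) \<in> dual"
proof -
  let ?S = "\<lambda>f. {(\<mu>, \<nu>). \<mu> \<in> \<Lambda> \<and> \<nu> \<in> \<Lambda> \<and> (\<exists>b\<in>carrier C. f (e \<mu> \<otimes> b \<otimes> e \<nu>) \<noteq> 0)}"
  have "?S (\<lambda>x. t * f x) \<subseteq> ?S f" by auto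
  moreover have "finite (?S f)" using assms by (simp add: dual_iff)
  ultimately have "finite (?S (\<lambda>x. t * f x))" by (rule finite_subset)
  then show ?thesis using assms by (simp add: dual_iff linear_form_def algebra_simps)
qed

lemma trivial_extension_simps:
  "carrier (trivial_extension C \<Lambda> e) = carrier C \<times> dual"
  "(a, f) \<otimes>\<^bsub>trivial_extension C \<Lambda> e\<^esub> (b, g) = (a \<otimes> b, \<lambda>x. dual_lact C a g x + dual_ract C f b x)"
  "(a, f) \<oplus>\<^bsub>trivial_extension C \<Lambda> e\<^esub> (b, g) = (a \<oplus> b, \<lambda>x. f x + g x)"
  "\<zero>\<^bsub>trivial_extension C \<Lambda> e\<^esub> = (\<zero>, \<lambda>_. 0)"
  "t \<odot>\<^bsub>trivial_extension C \<Lambda> e\<^esub> (a, f) = (t \<odot>\<^bsub>C\<^esub> a, \<lambda>x. t * f x)"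
  by (simp_all add: trivial_extension_def)

lemma trivial_extension_kalgebra: "kalgebra (trivial_extension C \<Lambda> e)"
proof -
  note s = trivial_extension_simps
  interpret T: abelian_group "trivial_extension C \<Lambda> e"
  proof (rule abelian_groupI)
    fix x assume "x \<in> carrier (trivial_extension C \<Lambda> e)"
    then obtain a f where x: "x = (a, f)" "a \<in> carrier C" "f \<in> dual" by (auto simp: s)
    show "\<exists>y\<in>carrier (trivial_extension C \<Lambda> e). y \<oplus>\<^bsub>trivial_extension C \<Lambda> e\<^esub> x = \<zero>\<^bsub>trivial_extension C \<Lambda> e\<^esub>"
      using x dual_scl[of f "-1"] by (intro bexI[of _ "(\<ominus> a, \<lambda>x. - 1 * f x)"]) (auto simp: s l_neg)
  qed (auto simp: s dual_add dual_zero a_ac fun_eq_iff algebra_simps)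
  show ?thesis
  proof
    fix x y z assume "x \<in> carrier (trivial_extension C \<Lambda> e)" "y \<in> carrier (trivial_extension C \<Lambda> e)"
      "z \<in> carrier (trivial_extension C \<Lambda> e)"
    then show "x \<otimes>\<^bsub>trivial_extension C \<Lambda> e\<^esub> y \<otimes>\<^bsub>trivial_extension C \<Lambda> e\<^esub> z
        = x \<otimes>\<^bsub>trivial_extension C \<Lambda> e\<^esub> (y \<otimes>\<^bsub>trivial_extension C \<Lambda> e\<^esub> z)"
      by (auto simp: s mult_assoc dual_lact_def dual_ract_def fun_eq_iff)
    show "x \<otimes>\<^bsub>trivial_extension C \<Lambda> e\<^esub> y \<in> carrier (trivial_extension C \<Lambda> e)"
      using \<open>x \<in> _\<close> \<open>y \<in> _\<close> by (auto simp: s intro: dual_add[OF dual_lact_closed dual_ract_closed])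
  qed (auto simp: s dual_add dual_scl dual_lact_closed dual_ract_closed scl_add add_scl scl_scl
        mult_l_distr mult_r_distr scl_mult mult_scl dual_lact_def dual_ract_def fun_eq_iff
        algebra_simps linear_formD dual_linear)
qed

end

text \<open>The conditions of \<^locale>\<open>shift_quasi_hereditary\<close> on the algebra itself, and their companions for
  right ideals.  The latter are what the conditions on the trivial extension require of linear forms:
  a form factors through left multiplication by some \<open>u\<close> if it vanishes on the kernel of that map,
  so this kernel has to be small.\<close>

locale symmetric_shift_algebra = shift_algebra C V N u + local_unit_algebra C "V \<times> UNIV" "\<lambda>\<nu>. u \<nu> 0"
  for C :: "('k::field, 'c) module" (structure) and V :: "'v set" and N u +
  fixes gt :: "'v \<times> int \<Rightarrow> 'v \<times> int \<Rightarrow> bool"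
  assumes row_finite: "\<nu> \<in> V \<times> UNIV \<Longrightarrow> finite {\<mu> \<in> V \<times> UNIV. \<exists>a\<in>carrier C. u \<nu> 0 \<otimes> a \<otimes> u \<mu> 0 \<noteq> \<zero>}"
    and gt_shift: "x \<in> V \<Longrightarrow> 0 < j \<Longrightarrow> gt (x, i - int j) (x, i)"
    and above_l: "\<lbrakk>\<mu> \<in> V \<times> UNIV; \<nu> \<in> V \<times> UNIV; gt \<mu> \<nu>; a \<in> carrier C\<rbrakk>
      \<Longrightarrow> u \<mu> 0 \<otimes> a \<otimes> u \<nu> 0 \<in> principal (u \<nu> (Suc 0))"
    and above_r: "\<lbrakk>\<mu> \<in> V \<times> UNIV; \<nu> \<in> V \<times> UNIV; gt \<mu> \<nu>; b \<in> carrier C;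
        u \<nu> (Suc 0) \<otimes> (u \<nu> 0 \<otimes> b \<otimes> u \<mu> 0) = \<zero>\<rbrakk> \<Longrightarrow> u \<nu> 0 \<otimes> b \<otimes> u \<mu> 0 = \<zero>"
    and cancel_l: "\<lbrakk>x \<in> V; j < N; a \<in> principal (u (x, i - int j) 0); a \<otimes> u (x, i) j = \<zero>\<rbrakk>
      \<Longrightarrow> a \<in> principal (u (x, i - int j) (Suc 0))"
    and cancel_r: "\<lbrakk>x \<in> V; j < N; b \<in> carrier C; u (x, i - int j) 0 \<otimes> b = b;
        u (x, i - int j) (Suc 0) \<otimes> b = \<zero>\<rbrakk> \<Longrightarrow> \<exists>b'\<in>carrier C. b = u (x, i) j \<otimes> b'"
    and local_l: "\<lbrakk>x \<in> V; a \<in> carrier C\<rbrakk> \<Longrightarrow>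
      \<exists>t. \<exists>w\<in>principal (u (x, i) (Suc 0)). u (x, i) 0 \<otimes> a \<otimes> u (x, i) 0 = t \<odot>\<^bsub>C\<^esub> u (x, i) 0 \<oplus> w"
    and local_r: "\<lbrakk>x \<in> V; b \<in> carrier C; u (x, i) (Suc 0) \<otimes> (u (x, i) 0 \<otimes> b \<otimes> u (x, i) 0) = \<zero>\<rbrakk>
      \<Longrightarrow> u (x, i) 0 \<otimes> b \<otimes> u (x, i) 0 = \<zero>"
    and proper: "x \<in> V \<Longrightarrow> u (x, i) 0 \<notin> principal (u (x, i) (Suc 0))"
begin

abbreviation "TE \<equiv> trivial_extension C (V \<times> (UNIV :: int set)) (\<lambda>\<nu>. u \<nu> 0)"
abbreviation "uT \<equiv> \<lambda>\<nu> j. (u \<nu> j, \<lambda>_ :: 'c. 0 :: 'k)"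

text \<open>The extension \<open>h0\<close> of the form \<open>u b \<mapsto> f b\<close> to the whole algebra need not have finite support;
  precomposing it with the multiplication by \<open>e'\<close>, which fixes \<open>u\<close>, makes the support finite.\<close>

lemma dual_factor:
  assumes x: "x \<in> V" and f: "f \<in> dual"
    and fe: "\<And>b. b \<in> carrier C \<Longrightarrow> f (u (x, i) 0 \<otimes> b) = f b"
    and ker: "\<And>b. b \<in> carrier C \<Longrightarrow> u (x, i) 0 \<otimes> b = b \<Longrightarrow> u (x, i) j \<otimes> b = \<zero> \<Longrightarrow> f b = 0"
  shows "\<exists>h\<in>dual. f = dual_ract C h (u (x, i) j)"
proof -
  let ?u = "u (x, i) j" and ?e = "u (x, i) 0" and ?e' = "u (x, i - int j) 0"
  have [simp]: "?u \<in> carrier C" "?e \<in> carrier C" "?e' \<in> carrier C" using x by auto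
  have kerf: "f b = 0" if b: "b \<in> carrier C" "?u \<otimes> b = \<zero>" for b
  proof -
    have "?u \<otimes> (?e \<otimes> b) = \<zero>" using b u_right[OF x, of i j] by (simp flip: mult_assoc)
    moreover have "?e \<otimes> (?e \<otimes> b) = ?e \<otimes> b" using b u_idem[OF x, of i] by (simp flip: mult_assoc)
    ultimately have "f (?e \<otimes> b) = 0" using ker b by simp
    then show ?thesis using fe b by simp
  qed
  obtain h0 where h0: "linear_form C h0" "\<And>b. b \<in> carrier C \<Longrightarrow> h0 (?u \<otimes> b) = f b"
    using linear_form_factor[OF dual_linear[OF f], of "\<lambda>b. ?u \<otimes> b"] kerf
    by (auto simp: mult_r_distr mult_scl)
  define h where "h b = (if b \<in> carrier C then h0 (?e' \<otimes> b) else 0)" for b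
  have "linear_form C h"
    by (auto simp: linear_form_def h_def mult_r_distr mult_scl linear_formD[OF h0(1)])
  moreover have "finite {(\<mu>, \<nu>). \<mu> \<in> V \<times> UNIV \<and> \<nu> \<in> V \<times> UNIV \<and> (\<exists>a\<in>carrier C. h (u \<mu> 0 \<otimes> a \<otimes> u \<nu> 0) \<noteq> 0)}"
    (is "finite ?S")
  proof -
    have "?S \<subseteq> {(x, i - int j)} \<times> {\<nu> \<in> V \<times> UNIV. \<exists>a\<in>carrier C. ?e' \<otimes> a \<otimes> u \<nu> 0 \<noteq> \<zero>}"
    proof (rule subsetI, clarify)
      fix y k z l a
      assume *: "y \<in> V" "z \<in> V" "a \<in> carrier C" "h (u (y, k) 0 \<otimes> a \<otimes> u (z, l) 0) \<noteq> 0"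
      have ne: "?e' \<otimes> (u (y, k) 0 \<otimes> a \<otimes> u (z, l) 0) \<noteq> \<zero>"
        using * linear_form_zero[OF h0(1)] by (auto simp: h_def)
      have yk: "(y, k) = (x, i - int j)"
      proof (rule ccontr)
        assume "(y, k) \<noteq> (x, i - int j)"
        then have "?e' \<otimes> u (y, k) 0 = \<zero>" using e_orth[of "(x, i - int j)" "(y, k)"] x * by auto
        then show False using ne * by (simp flip: mult_assoc)
      qed
      then have "?e' \<otimes> a \<otimes> u (z, l) 0 \<noteq> \<zero>"
        using ne * u_idem[OF x, of "i - int j"] by (simp flip: mult_assoc)
      then show "(y, k) \<in> {(x, i - int j)} \<and>
          (z, l) \<in> {\<nu> \<in> V \<times> UNIV. \<exists>a\<in>carrier C. ?e' \<otimes> a \<otimes> u \<nu> 0 \<noteq> \<zero>}"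
        using yk * by blast
    qed
    then show ?thesis by (rule finite_subset) (use row_finite[of "(x, i - int j)"] x in auto)
  qed
  ultimately have "h \<in> dual" by (auto simp: dual_iff h_def)
  moreover have "f = dual_ract C h ?u"
  proof
    fix b
    show "f b = dual_ract C h ?u b"
      using dual_outside[OF f, of b] h0(2)[of b] u_left[OF x, of i j]
      by (auto simp: dual_ract_def h_def simp flip: mult_assoc)
  qed
  ultimately show ?thesis by blast
qed

lemma uT_mult:
  assumes "x \<in> V" "a \<in> carrier C" "f \<in> dual"
  shows "(a, f) \<otimes>\<^bsub>TE\<^esub> uT (x, i) j = (a \<otimes> u (x, i) j, dual_ract C f (u (x, i) j))"
    and "uT (x, i) j \<otimes>\<^bsub>TE\<^esub> (a, f) = (u (x, i) j \<otimes> a, dual_lact C (u (x, i) j) f)"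
  using assms by (auto simp: trivial_extension_simps dual_lact_def dual_ract_def fun_eq_iff)

text \<open>In the first component the conditions are those with suffix \<open>_l\<close>.  In the second component one has
  a form that is carried by a right ideal \<open>e\<^sub>\<nu> C\<close> or a corner, and \<open>dual_factor\<close> reduces the claim to
  its vanishing on the kernel of the multiplication by \<open>u \<nu> 1\<close>, which follows from the conditions with
  suffix \<open>_r\<close>.\<close>

theorem trivial_extension_shift_quasi_hereditary: "shift_quasi_hereditary TE V N uT gt"
proof -
  interpret TE: kalgebra TE by (rule trivial_extension_kalgebra)
  interpret TE: shift_algebra TE V N uT
  proof
    show "uT (x, i) j \<in> carrier TE" if "x \<in> V" for x i j
      using that dual_zero by (simp add: trivial_extension_simps u_closed)
    show "uT (x, i - int j) l \<otimes>\<^bsub>TE\<^esub> uT (x, i) j = uT (x, i) (j + l)" if "x \<in> V" for x i j l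
      using that u_mult[of x i j l] by (simp add: trivial_extension_simps dual_lact_def dual_ract_def)
  qed (simp_all add: u_N N_pos trivial_extension_simps)
  have mem: "(w, f) \<in> TE.principal (uT (x, i) (Suc 0))"
    if asm: "x \<in> V" "w \<in> principal (u (x, i) (Suc 0))" "f \<in> dual"
      "\<And>b. b \<in> carrier C \<Longrightarrow> f (u (x, i) 0 \<otimes> b) = f b"
      "\<And>b. b \<in> carrier C \<Longrightarrow> u (x, i) 0 \<otimes> b = b \<Longrightarrow> u (x, i) (Suc 0) \<otimes> b = \<zero> \<Longrightarrow> f b = 0" for x i w f
  proof -
    obtain h where h: "h \<in> dual" "f = dual_ract C h (u (x, i) (Suc 0))"
      using dual_factor[OF asm(1,3,4,5)] by blast
    obtain d where d: "d \<in> carrier C" "w = d \<otimes> u (x, i) (Suc 0)" using asm(2) by (auto simp: principal_def)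
    have "(w, f) = (d, h) \<otimes>\<^bsub>TE\<^esub> uT (x, i) (Suc 0)" using uT_mult(1)[OF asm(1) d(1) h(1)] h d by simp
    moreover have "(d, h) \<in> carrier TE" using d h by (simp add: trivial_extension_simps)
    ultimately show ?thesis by (simp add: TE.principalI)
  qed
  have corner: "uT \<mu> 0 \<otimes>\<^bsub>TE\<^esub> (a, f) \<otimes>\<^bsub>TE\<^esub> uT \<nu> 0
      = (u \<mu> 0 \<otimes> a \<otimes> u \<nu> 0, dual_ract C (dual_lact C (u \<mu> 0) f) (u \<nu> 0))"
    and corner_dual: "dual_ract C (dual_lact C (u \<mu> 0) f) (u \<nu> 0) \<in> dual"
    and corner_val: "\<And>b. b \<in> carrier C \<Longrightarrow>
      dual_ract C (dual_lact C (u \<mu> 0) f) (u \<nu> 0) b = f (u \<nu> 0 \<otimes> b \<otimes> u \<mu> 0)"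
    if asm: "\<mu> \<in> V \<times> UNIV" "\<nu> \<in> V \<times> UNIV" "a \<in> carrier C" "f \<in> dual" for \<mu> \<nu> a f
  proof -
    obtain y k where \<mu>: "\<mu> = (y, k)" "y \<in> V" using asm(1) by auto
    obtain x i where \<nu>: "\<nu> = (x, i)" "x \<in> V" using asm(2) by auto
    have l: "dual_lact C (u \<mu> 0) f \<in> dual" using asm(4) \<mu> by (simp add: dual_lact_closed)
    then show "dual_ract C (dual_lact C (u \<mu> 0) f) (u \<nu> 0) \<in> dual" using \<nu> by (simp add: dual_ract_closed)
    show "uT \<mu> 0 \<otimes>\<^bsub>TE\<^esub> (a, f) \<otimes>\<^bsub>TE\<^esub> uT \<nu> 0
      = (u \<mu> 0 \<otimes> a \<otimes> u \<nu> 0, dual_ract C (dual_lact C (u \<mu> 0) f) (u \<nu> 0))"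
      using l asm \<mu> \<nu> by (simp add: uT_mult)
    show "\<And>b. b \<in> carrier C \<Longrightarrow>
      dual_ract C (dual_lact C (u \<mu> 0) f) (u \<nu> 0) b = f (u \<nu> 0 \<otimes> b \<otimes> u \<mu> 0)"
      using \<nu> by (simp add: dual_ract_def dual_lact_def)
  qed
  show ?thesis
  proof
    fix x :: 'v and i :: int and j :: nat assume "x \<in> V" "0 < j"
    then show "gt (x, i - int j) (x, i)" by (rule gt_shift)
  next
    fix \<mu> \<nu> :: "'v \<times> int" and d assume \<mu>: "\<mu> \<in> V \<times> UNIV" and \<nu>: "\<nu> \<in> V \<times> UNIV" and gt: "gt \<mu> \<nu>" and d: "d \<in> carrier TE"
    obtain a f where af: "d = (a, f)" "a \<in> carrier C" "f \<in> dual" using d by (auto simp: trivial_extension_simps)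
    obtain y k where y: "\<mu> = (y, k)" "y \<in> V" using \<mu> by auto
    obtain x i where x: "\<nu> = (x, i)" "x \<in> V" using \<nu> by auto
    have [simp]: "u \<mu> 0 \<in> carrier C" "u \<nu> 0 \<in> carrier C" "u \<nu> (Suc 0) \<in> carrier C" using x y by auto
    note c = corner[OF \<mu> \<nu> af(2,3)] corner_dual[OF \<mu> \<nu> af(2,3)] corner_val[OF \<mu> \<nu> af(2,3)]
    have "u \<nu> 0 \<otimes> b \<otimes> u \<mu> 0 = \<zero>" if "b \<in> carrier C" "u \<nu> 0 \<otimes> b = b" "u \<nu> (Suc 0) \<otimes> b = \<zero>" for b
      using that by (intro above_r[OF \<mu> \<nu> gt]) (auto simp flip: mult_assoc)
    then have "(u \<mu> 0 \<otimes> a \<otimes> u \<nu> 0, dual_ract C (dual_lact C (u \<mu> 0) f) (u \<nu> 0)) \<in> TE.principal (uT \<nu> (Suc 0))"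
      using c(2,3) above_l[OF \<mu> \<nu> gt af(2)] linear_form_zero[OF dual_linear[OF af(3)]] x u_idem[OF x(2), of i] af(2)
      unfolding x(1) by (intro mem) (auto simp flip: mult_assoc)
    then show "uT \<mu> 0 \<otimes>\<^bsub>TE\<^esub> d \<otimes>\<^bsub>TE\<^esub> uT \<nu> 0 \<in> TE.principal (uT \<nu> (Suc 0))"
      by (simp only: af(1) c(1))
  next
    fix x :: 'v and i :: int and j :: nat and d assume x: "x \<in> V" and j: "j < N" and d: "d \<in> TE.principal (uT (x, i - int j) 0)"
      and 0: "d \<otimes>\<^bsub>TE\<^esub> uT (x, i) j = \<zero>\<^bsub>TE\<^esub>"
    obtain a g where ag: "a \<in> carrier C" "g \<in> dual" "d = (a, g) \<otimes>\<^bsub>TE\<^esub> uT (x, i - int j) 0"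
      using d by (auto simp: TE.principal_def trivial_extension_simps)
    define a' g' where a': "a' = a \<otimes> u (x, i - int j) 0" and g': "g' = dual_ract C g (u (x, i - int j) 0)"
    have mem': "a' \<in> carrier C" "g' \<in> dual" "a' \<in> principal (u (x, i - int j) 0)"
      using ag x by (auto simp: a' g' dual_ract_closed principalI)
    have d': "d = (a', g')" using ag x by (simp add: uT_mult a' g')
    have z: "a' \<otimes> u (x, i) j = \<zero>" "dual_ract C g' (u (x, i) j) = (\<lambda>_. 0)"
      using 0 mem' x by (auto simp: d' uT_mult trivial_extension_simps(4))
    show "d \<in> TE.principal (uT (x, i - int j) (Suc 0))"
      unfolding d'
    proof (rule mem[OF x cancel_l[OF x j mem'(3) z(1)] mem'(2)])
      show "g' (u (x, i - int j) 0 \<otimes> b) = g' b" if "b \<in> carrier C" for b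
        using that x u_idem[OF x, of "i - int j"] by (simp add: g' dual_ract_def flip: mult_assoc)
      fix b assume b: "b \<in> carrier C" "u (x, i - int j) 0 \<otimes> b = b" "u (x, i - int j) (Suc 0) \<otimes> b = \<zero>"
      then obtain b' where "b' \<in> carrier C" "b = u (x, i) j \<otimes> b'" using cancel_r[OF x j] by blast
      then show "g' b = 0" using fun_cong[OF z(2), of b'] by (simp add: dual_ract_def)
    qed
  next
    fix x :: 'v and i :: int and d assume x: "x \<in> V" and d: "d \<in> carrier TE"
    obtain a f where af: "d = (a, f)" "a \<in> carrier C" "f \<in> dual" using d by (auto simp: trivial_extension_simps)
    have \<nu>: "(x, i) \<in> V \<times> UNIV" using x by simp
    have [simp]: "u (x, i) 0 \<in> carrier C" "u (x, i) (Suc 0) \<in> carrier C" using x by auto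
    note c = corner[OF \<nu> \<nu> af(2,3)] corner_dual[OF \<nu> \<nu> af(2,3)] corner_val[OF \<nu> \<nu> af(2,3)]
    let ?f = "dual_ract C (dual_lact C (u (x, i) 0) f) (u (x, i) 0)"
    obtain t w where tw: "w \<in> principal (u (x, i) (Suc 0))"
      "u (x, i) 0 \<otimes> a \<otimes> u (x, i) 0 = t \<odot>\<^bsub>C\<^esub> u (x, i) 0 \<oplus> w" using local_l[OF x af(2)] by blast
    have "u (x, i) 0 \<otimes> b \<otimes> u (x, i) 0 = \<zero>"
      if "b \<in> carrier C" "u (x, i) 0 \<otimes> b = b" "u (x, i) (Suc 0) \<otimes> b = \<zero>" for b
      using that by (intro local_r[OF x]) (auto simp flip: mult_assoc)
    then have "(w, ?f) \<in> TE.principal (uT (x, i) (Suc 0))"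
      using c tw linear_form_zero[OF dual_linear[OF af(3)]] u_idem[OF x, of i]
      by (intro mem[OF x]) (auto simp flip: mult_assoc)
    moreover have "uT (x, i) 0 \<otimes>\<^bsub>TE\<^esub> d \<otimes>\<^bsub>TE\<^esub> uT (x, i) 0 = t \<odot>\<^bsub>TE\<^esub> uT (x, i) 0 \<oplus>\<^bsub>TE\<^esub> (w, ?f)"
      unfolding af(1) c(1) tw(2) by (simp add: trivial_extension_simps)
    ultimately show "\<exists>t. \<exists>w\<in>TE.principal (uT (x, i) (Suc 0)).
        uT (x, i) 0 \<otimes>\<^bsub>TE\<^esub> d \<otimes>\<^bsub>TE\<^esub> uT (x, i) 0 = t \<odot>\<^bsub>TE\<^esub> uT (x, i) 0 \<oplus>\<^bsub>TE\<^esub> w" by blast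
  next
    fix x :: 'v and i :: int assume x: "x \<in> V"
    show "uT (x, i) 0 \<notin> TE.principal (uT (x, i) (Suc 0))"
      using proper[OF x, of i] x by (auto simp: TE.principal_def trivial_extension_simps(1) uT_mult principal_def)
  qed
qed

end


section \<open>Matrices over a filtered algebra\<close>

lemma finsum_hom:
  assumes "abelian_group G" "abelian_group H"
    and "\<And>a. a \<in> carrier G \<Longrightarrow> h a \<in> carrier H"
    and "\<And>a b. a \<in> carrier G \<Longrightarrow> b \<in> carrier G \<Longrightarrow> h (a \<oplus>\<^bsub>G\<^esub> b) = h a \<oplus>\<^bsub>H\<^esub> h b"
    and "finite S" "g \<in> S \<rightarrow> carrier G"
  shows "h (finsum G g S) = finsum H (\<lambda>s. h (g s)) S"
proof -
  interpret G: abelian_group G by fact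
  interpret H: abelian_group H by fact
  have h0: "h \<zero>\<^bsub>G\<^esub> = \<zero>\<^bsub>H\<^esub>"
    using assms(4)[of "\<zero>\<^bsub>G\<^esub>" "\<zero>\<^bsub>G\<^esub>"] assms(3)[of "\<zero>\<^bsub>G\<^esub>"]
      H.add.r_cancel_one[of "h \<zero>\<^bsub>G\<^esub>" "h \<zero>\<^bsub>G\<^esub>"] by simp
  show ?thesis
    using assms(5,6)
  proof (induction S rule: finite_induct)
    case empty
    show ?case by (simp add: h0)
  next
    case (insert s S)
    then have "finsum G g S \<in> carrier G" by (intro G.finsum_closed) auto
    then show ?case using insert assms(3,4) by (auto simp: G.finsum_insert H.finsum_insert Pi_def)
  qed
qed

lemma (in abelian_monoid) finsum_swap:
  assumes "finite S" "finite T" "\<And>s t. s \<in> S \<Longrightarrow> t \<in> T \<Longrightarrow> f s t \<in> carrier G"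
  shows "finsum G (\<lambda>s. finsum G (f s) T) S = finsum G (\<lambda>t. finsum G (\<lambda>s. f s t) S) T"
  using assms(1,3)
proof (induction S rule: finite_induct)
  case empty
  show ?case by (simp add: finsum_zero)
next
  case (insert s S)
  have "finsum G (\<lambda>s. finsum G (f s) T) (insert s S) = finsum G (f s) T \<oplus> finsum G (\<lambda>s. finsum G (f s) T) S"
    using insert by (intro finsum_insert) (auto intro!: finsum_closed)
  also have "\<dots> = finsum G (f s) T \<oplus> finsum G (\<lambda>t. finsum G (\<lambda>s. f s t) S) T" using insert by simp
  also have "\<dots> = finsum G (\<lambda>t. f s t \<oplus> finsum G (\<lambda>s. f s t) S) T"
    using insert by (intro finsum_addf[symmetric]) (auto intro!: finsum_closed)
  also have "\<dots> = finsum G (\<lambda>t. finsum G (\<lambda>s. f s t) (insert s S)) T"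
    using insert by (intro finsum_cong') (auto intro!: finsum_closed finsum_insert[symmetric])
  finally show ?case .
qed

lemma (in abelian_group) finsum_in_subgroup:
  assumes "additive_subgroup H G" "finite S" "\<And>s. s \<in> S \<Longrightarrow> g s \<in> H"
  shows "finsum G g S \<in> H"
proof -
  interpret additive_subgroup H G by fact
  show ?thesis using assms(2,3)
    by (induction S rule: finite_induct) (auto simp: finsum_insert Pi_def)
qed

locale filtered_algebra = kalgebra B
  for B :: "('k::field, 'a) module" (structure) +
  fixes V :: "'v set" and e :: "'v \<Rightarrow> 'a"
  assumes power_ksubspace: "ksubspace (radical_power B j) B"
    and power_Suc: "radical_power B (Suc j) \<subseteq> radical_power B j"
    and power_mult: "a \<in> radical_power B j \<Longrightarrow> b \<in> radical_power B l \<Longrightarrow> a \<otimes> b \<in> radical_power B (j + l)"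
    and power_nilpotency_degree: "radical_power B (nilpotency_degree B) = {\<zero>}"
    and V_finite: "finite V"
    and e_closed [simp, intro]: "x \<in> V \<Longrightarrow> e x \<in> carrier B"
    and e_idem: "x \<in> V \<Longrightarrow> e x \<otimes> e x = e x"
    and e_orth: "x \<in> V \<Longrightarrow> y \<in> V \<Longrightarrow> x \<noteq> y \<Longrightarrow> e x \<otimes> e y = \<zero>"
    and e_complete_l: "a \<in> carrier B \<Longrightarrow> finsum B (\<lambda>x. e x \<otimes> a) V = a"
    and e_complete_r: "a \<in> carrier B \<Longrightarrow> finsum B (\<lambda>x. a \<otimes> e x) V = a"
    and nilpotency_degree_pos: "0 < nilpotency_degree B"
begin

abbreviation "N \<equiv> nilpotency_degree B"

text \<open>Indexing the filtration by integers, constantly the whole algebra in negative degrees, gives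
  all matrix entries the uniform shape of \<^term>\<open>J (r - c)\<close> modulo \<^term>\<open>J (int N + r - c)\<close>.\<close>

definition J :: "int \<Rightarrow> 'a set" where "J z = radical_power B (nat z)"

lemma power_antimono: "j \<le> l \<Longrightarrow> radical_power B l \<subseteq> radical_power B j"
  by (rule lift_Suc_antimono_le[of "radical_power B"]) (use power_Suc in auto)

lemma J_antimono: "w \<le> z \<Longrightarrow> a \<in> J z \<Longrightarrow> a \<in> J w"
  using power_antimono[OF nat_mono, of w z] by (auto simp: J_def)

lemma J_ksubspace: "ksubspace (J z) B"
  by (simp add: J_def power_ksubspace)

lemmas J_facts = ksubspace_facts[OF J_ksubspace]

lemma J_carrier [simp]: "a \<in> J z \<Longrightarrow> a \<in> carrier B"
  using J_facts(1) by blast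

lemma J_zero [simp]: "\<zero> \<in> J z"
  by (rule J_facts)

lemma J_nonpos: "z \<le> 0 \<Longrightarrow> J z = carrier B"
  by (simp add: J_def)

lemma J_mult: "a \<in> J z \<Longrightarrow> b \<in> J w \<Longrightarrow> a \<otimes> b \<in> J (z + w)"
proof -
  assume "a \<in> J z" "b \<in> J w"
  then have "a \<otimes> b \<in> radical_power B (nat z + nat w)" by (simp add: J_def power_mult)
  moreover have "nat (z + w) \<le> nat z + nat w" by linarith
  ultimately show "a \<otimes> b \<in> J (z + w)" unfolding J_def by (rule subsetD[OF power_antimono, rotated])
qed

lemma J_mult_l: "a \<in> J z \<Longrightarrow> b \<in> carrier B \<Longrightarrow> a \<otimes> b \<in> J z"
  using J_mult[of a z b 0] by (simp add: J_nonpos)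

lemma J_mult_r: "a \<in> J z \<Longrightarrow> b \<in> carrier B \<Longrightarrow> b \<otimes> a \<in> J z"
  using J_mult[of b 0 a z] by (simp add: J_nonpos)

lemma J_big: "int N \<le> z \<Longrightarrow> J z = {\<zero>}"
proof -
  assume "int N \<le> z"
  moreover have "J (int N) = {\<zero>}" by (simp add: J_def power_nilpotency_degree)
  ultimately have "J z \<subseteq> {\<zero>}" using J_antimono by blast
  then show ?thesis using J_zero[of z] by (auto simp del: J_zero)
qed

lemma entry_top_eq: "entry_top B r c = J (r - c)"
  by (simp add: entry_top_def J_def)

text \<open>Below the diagonal the exponent is larger than \<open>N\<close>, so the power vanishes; from \<open>c - r \<ge> N\<close> on it is
  not positive, so the power is the whole algebra.\<close>

lemma entry_bot_eq: "entry_bot B r c = J (int N + r - c)"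
proof (cases "r > c")
  case True
  then show ?thesis by (simp add: entry_bot_def J_big)
next
  case False
  then show ?thesis by (simp add: entry_bot_def J_def Let_def algebra_simps)
qed

definition cls :: "int \<Rightarrow> int \<Rightarrow> 'a \<Rightarrow> 'a set" where
  "cls r c x = entry_bot B r c +> x"

abbreviation "E \<equiv> entry_space B"

lemma bot_ksubspace: "ksubspace (entry_bot B r c) B"
  by (simp add: entry_bot_eq J_ksubspace)

lemma E_carrier: "carrier (E r c) = cls r c ` J (r - c)"
  and E_zero: "\<zero>\<^bsub>E r c\<^esub> = cls r c \<zero>"
  and E_add: "x \<in> carrier B \<Longrightarrow> y \<in> carrier B \<Longrightarrow> cls r c x \<oplus>\<^bsub>E r c\<^esub> cls r c y = cls r c (x \<oplus> y)"
  and E_smult: "x \<in> carrier B \<Longrightarrow> t \<odot>\<^bsub>E r c\<^esub> cls r c x = cls r c (t \<odot>\<^bsub>B\<^esub> x)"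
  and E_kspace: "kspace (E r c)"
proof -
  note q = kspace_axioms J_ksubspace[of "r - c"] bot_ksubspace[of r c]
  show "carrier (E r c) = cls r c ` J (r - c)"
    using quot_carrier[OF q] by (simp add: entry_space_def entry_top_eq cls_def)
  show "\<zero>\<^bsub>E r c\<^esub> = cls r c \<zero>"
    using quot_zero[OF q] by (simp add: entry_space_def entry_top_eq cls_def)
  show "x \<in> carrier B \<Longrightarrow> y \<in> carrier B \<Longrightarrow> cls r c x \<oplus>\<^bsub>E r c\<^esub> cls r c y = cls r c (x \<oplus> y)"
    using quot_add[OF q] by (simp add: entry_space_def entry_top_eq cls_def)
  show "x \<in> carrier B \<Longrightarrow> t \<odot>\<^bsub>E r c\<^esub> cls r c x = cls r c (t \<odot>\<^bsub>B\<^esub> x)"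
    using quot_smult[OF q] by (simp add: entry_space_def entry_top_eq cls_def)
  show "kspace (E r c)"
    using quot_kspace[OF q] by (simp add: entry_space_def entry_top_eq)
qed

lemma cls_eq_iff: "x \<in> carrier B \<Longrightarrow> y \<in> carrier B \<Longrightarrow> cls r c x = cls r c y \<longleftrightarrow> x \<ominus> y \<in> J (int N + r - c)"
  unfolding cls_def entry_bot_eq by (rule coset_eq_iff[OF J_facts(5)])

lemma minus_zero_right: "x \<in> carrier B \<Longrightarrow> x \<ominus> \<zero> = x"
  using minus_equality[of \<zero> \<zero>] by (simp add: minus_eq)

lemma cls_zero_iff: "x \<in> carrier B \<Longrightarrow> cls r c x = cls r c \<zero> \<longleftrightarrow> x \<in> J (int N + r - c)"
  by (simp add: cls_eq_iff minus_zero_right)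

text \<open>The product is well defined because changing the factors by elements of \<open>J (N + r - s)\<close> and
  \<open>J (N + s - c)\<close> changes it by elements of \<open>J (N + r - s) J (s - c)\<close> and \<open>J (r - s) J (N + s - c)\<close>, which
  are both contained in \<open>J (N + r - c)\<close>.\<close>

lemma entry_mult_cls:
  assumes x: "x \<in> J (r - s)" and y: "y \<in> J (s - c)"
  shows "entry_mult B r c (cls r s x) (cls s c y) = cls r c (x \<otimes> y)"
proof -
  have inner: "(\<Union>y'\<in>cls s c y. cls r c (x' \<otimes> y')) = cls r c (x' \<otimes> y)" if "x' \<in> J (r - s)" for x'
    unfolding cls_def[of s c]
  proof (rule coset_UN)
    fix z assume z: "z \<in> carrier B" "z \<ominus> y \<in> entry_bot B s c"
    then have "x' \<otimes> (z \<ominus> y) \<in> J ((r - s) + (int N + s - c))"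
      using that by (intro J_mult) (auto simp: entry_bot_eq)
    then show "cls r c (x' \<otimes> z) = cls r c (x' \<otimes> y)"
      using that y z by (simp add: cls_eq_iff mult_minus algebra_simps)
  qed (use y bot_ksubspace ksubspace_facts(5) in auto)
  have inJ: "x' \<in> J (r - s)" if "x' \<in> carrier B" "x' \<ominus> x \<in> entry_bot B r s" for x'
  proof -
    have "x' \<ominus> x \<in> J (r - s)" using that by (auto simp: entry_bot_eq elim: J_antimono[rotated])
    then have "(x' \<ominus> x) \<oplus> x \<in> J (r - s)" using x J_facts(3) by blast
    then show ?thesis using that x by (simp add: minus_eq a_assoc l_neg)
  qed
  have "(\<Union>x'\<in>cls r s x. \<Union>y'\<in>cls s c y. cls r c (x' \<otimes> y')) = (\<Union>y'\<in>cls s c y. cls r c (x \<otimes> y'))"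
    unfolding cls_def[of r s]
  proof (rule coset_UN)
    fix z assume z: "z \<in> carrier B" "z \<ominus> x \<in> entry_bot B r s"
    then have "(z \<ominus> x) \<otimes> y \<in> J ((int N + r - s) + (s - c))"
      using y by (intro J_mult) (auto simp: entry_bot_eq)
    then have "cls r c (z \<otimes> y) = cls r c (x \<otimes> y)"
      using x y z by (simp add: cls_eq_iff minus_mult algebra_simps)
    then show "(\<Union>y'\<in>cls s c y. cls r c (z \<otimes> y')) = (\<Union>y'\<in>cls s c y. cls r c (x \<otimes> y'))"
      using inner[OF x] inner[OF inJ[OF z]] by simp
  qed (use x bot_ksubspace ksubspace_facts(5) in auto)
  then show ?thesis using inner[OF x] by (simp add: entry_mult_def cls_def)
qed

text \<open>Matrices are handled through representatives of their entries.  The products of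
  representatives range over a set \<open>S\<close> of inner indices that is given in advance instead of the support
  of the factors, so that the sums in several products run over the same set.\<close>

definition adm :: "(int \<Rightarrow> int \<Rightarrow> 'a) \<Rightarrow> bool" where
  "adm a \<longleftrightarrow> (\<forall>r c. a r c \<in> J (r - c)) \<and> finite {(r, c). a r c \<noteq> \<zero>}"

definition mat :: "(int \<Rightarrow> int \<Rightarrow> 'a) \<Rightarrow> int \<Rightarrow> int \<Rightarrow> 'a set" where
  "mat a = (\<lambda>r c. cls r c (a r c))"

definition sing :: "int \<Rightarrow> int \<Rightarrow> 'a \<Rightarrow> int \<Rightarrow> int \<Rightarrow> 'a" where
  "sing r0 c0 z = (\<lambda>r c. if r = r0 \<and> c = c0 then z else \<zero>)"

definition mprod :: "int set \<Rightarrow> (int \<Rightarrow> int \<Rightarrow> 'a) \<Rightarrow> (int \<Rightarrow> int \<Rightarrow> 'a) \<Rightarrow> int \<Rightarrow> int \<Rightarrow> 'a" where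
  "mprod S a b = (\<lambda>r c. finsum B (\<lambda>s. a r s \<otimes> b s c) S)"

abbreviation "MA \<equiv> matrix_algebra B"

lemma admD: "adm a \<Longrightarrow> a r c \<in> J (r - c)"
  by (simp add: adm_def)

lemma adm_carrier [simp]: "adm a \<Longrightarrow> a r c \<in> carrier B"
  using admD J_carrier by blast

lemma adm_subset:
  assumes "\<And>r c. a r c \<in> J (r - c)" "finite F" "\<And>r c. a r c \<noteq> \<zero> \<Longrightarrow> (r, c) \<in> F"
  shows "adm a"
  unfolding adm_def using assms by (auto intro: finite_subset[of _ F])

lemma adm_finite:
  assumes "adm a"
  shows "finite {s. \<exists>t. a s t \<noteq> \<zero>}" "finite {s. \<exists>t. a t s \<noteq> \<zero>}"
proof -
  have f: "finite {(r, c). a r c \<noteq> \<zero>}" using assms by (simp add: adm_def)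
  have "{s. \<exists>t. a s t \<noteq> \<zero>} \<subseteq> fst ` {(r, c). a r c \<noteq> \<zero>}" "{s. \<exists>t. a t s \<noteq> \<zero>} \<subseteq> snd ` {(r, c). a r c \<noteq> \<zero>}"
    by force+
  then show "finite {s. \<exists>t. a s t \<noteq> \<zero>}" "finite {s. \<exists>t. a t s \<noteq> \<zero>}"
    using finite_imageI[OF f] finite_subset by blast+
qed

lemma adm_add: "adm a \<Longrightarrow> adm b \<Longrightarrow> adm (\<lambda>r c. a r c \<oplus> b r c)"
  by (rule adm_subset[where F = "{(r, c). a r c \<noteq> \<zero>} \<union> {(r, c). b r c \<noteq> \<zero>}"])
    (auto simp: adm_def J_facts(3))

lemma adm_scl: "adm a \<Longrightarrow> adm (\<lambda>r c. t \<odot>\<^bsub>B\<^esub> a r c)"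
  by (rule adm_subset[where F = "{(r, c). a r c \<noteq> \<zero>}"]) (auto simp: adm_def J_facts(4))

lemma adm_zero: "adm (\<lambda>r c. \<zero>)"
  by (simp add: adm_def)

lemma adm_sing: "z \<in> J (r - c) \<Longrightarrow> adm (sing r c z)"
  by (rule adm_subset[where F = "{(r, c)}"]) (auto simp: sing_def split: if_splits)

lemma adm_mprod:
  assumes a: "adm a" and b: "adm b" and S: "finite S"
  shows "adm (mprod S a b)"
proof (rule adm_subset)
  show "mprod S a b r c \<in> J (r - c)" for r c
    unfolding mprod_def
  proof (rule finsum_in_subgroup[OF J_facts(5) S])
    fix s
    show "a r s \<otimes> b s c \<in> J (r - c)" using J_mult[OF admD[OF a, of r s] admD[OF b, of s c]] by simp
  qed
  show "finite ({s. \<exists>t. a s t \<noteq> \<zero>} \<times> {s. \<exists>t. b t s \<noteq> \<zero>})" using adm_finite a b by blast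
  show "(r, c) \<in> {s. \<exists>t. a s t \<noteq> \<zero>} \<times> {s. \<exists>t. b t s \<noteq> \<zero>}" if "mprod S a b r c \<noteq> \<zero>" for r c
  proof (rule ccontr)
    assume "(r, c) \<notin> {s. \<exists>t. a s t \<noteq> \<zero>} \<times> {s. \<exists>t. b t s \<noteq> \<zero>}"
    then have "a r s \<otimes> b s c = \<zero>" for s using a b by auto
    then have "mprod S a b r c = \<zero>" by (simp add: mprod_def finsum_zero)
    then show False using that by simp
  qed
qed

lemma MA_carrier: "carrier MA = mat ` Collect adm"
proof (intro equalityI subsetI)
  fix A assume "A \<in> mat ` Collect adm"
  then obtain a where a: "adm a" "A = mat a" by blast
  have "{(r, c). A r c \<noteq> \<zero>\<^bsub>E r c\<^esub>} \<subseteq> {(r, c). a r c \<noteq> \<zero>}" using a by (auto simp: mat_def E_zero)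
  then show "A \<in> carrier MA"
    using a by (auto simp: matrix_algebra_def mat_def E_carrier adm_def intro: finite_subset)
next
  fix A assume A: "A \<in> carrier MA"
  \<comment> \<open>Zero entries get the representative zero, which keeps the support finite.\<close>
  define a where "a r c = (if A r c = cls r c \<zero> then \<zero> else SOME x. x \<in> J (r - c) \<and> A r c = cls r c x)" for r c
  have *: "a r c \<in> J (r - c) \<and> A r c = cls r c (a r c)" for r c
  proof (cases "A r c = cls r c \<zero>")
    case False
    have "A r c \<in> cls r c ` J (r - c)" using A by (simp add: matrix_algebra_def E_carrier)
    then have "\<exists>x. x \<in> J (r - c) \<and> A r c = cls r c x" by blast
    then show ?thesis using someI_ex[of "\<lambda>x. x \<in> J (r - c) \<and> A r c = cls r c x"] False by (simp add: a_def)
  qed (simp add: a_def)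
  have fin: "finite {(r, c). A r c \<noteq> \<zero>\<^bsub>E r c\<^esub>}" using A by (simp add: matrix_algebra_def)
  have "adm a"
  proof (rule adm_subset[OF _ fin])
    show "a r c \<in> J (r - c)" for r c using * by blast
    show "(r, c) \<in> {(r, c). A r c \<noteq> \<zero>\<^bsub>E r c\<^esub>}" if "a r c \<noteq> \<zero>" for r c
      using that by (auto simp: a_def E_zero split: if_splits)
  qed
  moreover have "A = mat a" using * by (auto simp: mat_def fun_eq_iff)
  ultimately show "A \<in> mat ` Collect adm" by blast
qed

lemma MA_carrierI: "adm a \<Longrightarrow> mat a \<in> carrier MA"
  by (simp add: MA_carrier)

lemma MA_carrierE:
  assumes "A \<in> carrier MA"
  obtains a where "adm a" "A = mat a"
  using assms by (auto simp: MA_carrier)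

lemma mat_eq_iff:
  "adm a \<Longrightarrow> adm b \<Longrightarrow> mat a = mat b \<longleftrightarrow> (\<forall>r c. a r c \<ominus> b r c \<in> J (int N + r - c))"
  by (simp add: mat_def fun_eq_iff cls_eq_iff)

lemma MA_zero: "\<zero>\<^bsub>MA\<^esub> = mat (\<lambda>r c. \<zero>)"
  by (simp add: matrix_algebra_def mat_def E_zero)

lemma mat_zero_iff: "adm a \<Longrightarrow> mat a = \<zero>\<^bsub>MA\<^esub> \<longleftrightarrow> (\<forall>r c. a r c \<in> J (int N + r - c))"
  by (simp add: MA_zero mat_def fun_eq_iff cls_zero_iff)

lemma MA_add: "adm a \<Longrightarrow> adm b \<Longrightarrow> mat a \<oplus>\<^bsub>MA\<^esub> mat b = mat (\<lambda>r c. a r c \<oplus> b r c)"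
  by (simp add: matrix_algebra_def mat_def E_add)

lemma MA_smult: "adm a \<Longrightarrow> t \<odot>\<^bsub>MA\<^esub> mat a = mat (\<lambda>r c. t \<odot>\<^bsub>B\<^esub> a r c)"
  by (simp add: matrix_algebra_def mat_def E_smult)

lemma cls_finsum:
  assumes "finite S" "\<And>s. s \<in> S \<Longrightarrow> g s \<in> J (r - c)"
  shows "finsum (E r c) (\<lambda>s. cls r c (g s)) S = cls r c (finsum B g S)"
proof -
  interpret E: kspace "E r c" by (rule E_kspace)
  interpret Jr: abelian_group "B\<lparr>carrier := J (r - c)\<rparr>"
    by (rule abelian_group_on[OF J_facts(5)[of "r - c"]]) simp_all
  have "finsum (B\<lparr>carrier := J (r - c)\<rparr>) g S = finsum B g S"
    using assms
  proof (induction S rule: finite_induct)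
    case (insert s S)
    moreover from this have "g x \<in> carrier B" if "x \<in> insert s S" for x using that J_carrier by blast
    ultimately show ?case by (simp add: finsum_insert Jr.finsum_insert Pi_def)
  qed simp
  moreover have "cls r c (finsum (B\<lparr>carrier := J (r - c)\<rparr>) g S) = finsum (E r c) (\<lambda>s. cls r c (g s)) S"
    using assms
    by (intro finsum_hom) (auto simp: Jr.abelian_group_axioms E.abelian_group_axioms E_carrier E_add)
  ultimately show ?thesis by simp
qed

lemma MA_mult:
  assumes a: "adm a" and b: "adm b" and S: "finite S" "\<And>r c s. a r s \<noteq> \<zero> \<Longrightarrow> b s c \<noteq> \<zero> \<Longrightarrow> s \<in> S"
  shows "mat a \<otimes>\<^bsub>MA\<^esub> mat b = mat (mprod S a b)"
proof (intro ext)
  fix r c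
  interpret E: kspace "E r c" by (rule E_kspace)
  have J: "a r s \<otimes> b s c \<in> J (r - c)" for s
    using J_mult[OF admD[OF a, of r s] admD[OF b, of s c]] by simp
  have em: "entry_mult B r c (mat a r s) (mat b s c) = cls r c (a r s \<otimes> b s c)" for s
    unfolding mat_def by (rule entry_mult_cls[OF admD[OF a] admD[OF b]])
  have vanish: "cls r c (a r s \<otimes> b s c) = cls r c \<zero>" if "mat a r s = cls r s \<zero> \<or> mat b s c = cls s c \<zero>" for s
    using that
  proof
    assume "mat a r s = cls r s \<zero>"
    then have "a r s \<in> J (int N + r - s)" using a by (simp add: mat_def cls_zero_iff)
    then show ?thesis using a b J_mult[OF _ admD[OF b, of s c], of "a r s" "int N + r - s"]
      by (simp add: cls_zero_iff algebra_simps)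
  next
    assume "mat b s c = cls s c \<zero>"
    then have "b s c \<in> J (int N + s - c)" using b by (simp add: mat_def cls_zero_iff)
    then show ?thesis using a b J_mult[OF admD[OF a, of r s], of "b s c" "int N + s - c"]
      by (simp add: cls_zero_iff algebra_simps)
  qed
  let ?T = "{s. mat a r s \<noteq> \<zero>\<^bsub>E r s\<^esub> \<and> mat b s c \<noteq> \<zero>\<^bsub>E s c\<^esub>}"
  have "(mat a \<otimes>\<^bsub>MA\<^esub> mat b) r c = finsum (E r c) (\<lambda>s. cls r c (a r s \<otimes> b s c)) ?T"
    by (simp add: matrix_algebra_def em)
  also have "\<dots> = finsum (E r c) (\<lambda>s. cls r c (a r s \<otimes> b s c)) S"
  proof (rule E.add.finprod_mono_neutral_cong_left)
    show "?T \<subseteq> S"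
    proof
      fix s assume "s \<in> ?T"
      then have "a r s \<noteq> \<zero>" "b s c \<noteq> \<zero>" by (auto simp: mat_def E_zero)
      then show "s \<in> S" by (rule S(2))
    qed
    show "cls r c (a r s \<otimes> b s c) = \<zero>\<^bsub>E r c\<^esub>" if "s \<in> S - ?T" for s
      using that vanish[of s] by (auto simp: E_zero)
    show "(\<lambda>s. cls r c (a r s \<otimes> b s c)) \<in> S \<rightarrow> carrier (E r c)"
      using J by (auto simp: E_carrier)
  qed (use S in auto)
  also have "\<dots> = mat (mprod S a b) r c" using cls_finsum[OF S(1) J] by (simp add: mat_def mprod_def)
  finally show "(mat a \<otimes>\<^bsub>MA\<^esub> mat b) r c = mat (mprod S a b) r c" .
qed

lemma mprod_assoc:
  assumes "adm a" "adm b" "adm d" "finite S"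
  shows "mprod S (mprod S a b) d = mprod S a (mprod S b d)"
proof (intro ext)
  fix r c
  have fl: "finsum B g S \<otimes> x = finsum B (\<lambda>s. g s \<otimes> x) S" if "g \<in> S \<rightarrow> carrier B" "x \<in> carrier B" for g x
    using assms(4) that by (intro finsum_hom) (auto simp: abelian_group_axioms mult_l_distr)
  have fr: "x \<otimes> finsum B g S = finsum B (\<lambda>s. x \<otimes> g s) S" if "g \<in> S \<rightarrow> carrier B" "x \<in> carrier B" for g x
    using assms(4) that by (intro finsum_hom) (auto simp: abelian_group_axioms mult_r_distr)
  have "mprod S (mprod S a b) d r c = finsum B (\<lambda>s. finsum B (\<lambda>t. a r t \<otimes> b t s \<otimes> d s c) S) S"
    using assms unfolding mprod_def by (intro finsum_cong') (auto simp: fl intro!: finsum_closed)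
  also have "\<dots> = finsum B (\<lambda>t. finsum B (\<lambda>s. a r t \<otimes> b t s \<otimes> d s c) S) S"
    using assms by (intro finsum_swap) auto
  also have "\<dots> = mprod S a (mprod S b d) r c"
    using assms unfolding mprod_def by (intro finsum_cong') (auto simp: fr mult_assoc intro!: finsum_closed)
  finally show "mprod S (mprod S a b) d r c = mprod S a (mprod S b d) r c" .
qed

lemma MA_common_support:
  assumes "adm a" "adm b" "adm d"
  obtains S where "finite S" "\<And>x s t. x \<in> {a, b, d} \<Longrightarrow> x s t \<noteq> \<zero> \<Longrightarrow> s \<in> S \<and> t \<in> S"
proof
  let ?S = "\<lambda>a. {s. \<exists>t. a s t \<noteq> \<zero>} \<union> {s. \<exists>t. a t s \<noteq> \<zero>}"
  show "finite (?S a \<union> ?S b \<union> ?S d)" using adm_finite assms by blast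
qed auto

lemma MA_abelian_group: "abelian_group MA"
proof (rule abelian_groupI)
  show "\<zero>\<^bsub>MA\<^esub> \<in> carrier MA" by (simp add: MA_zero MA_carrierI adm_zero)
  fix X Y Z assume "X \<in> carrier MA" "Y \<in> carrier MA" "Z \<in> carrier MA"
  then obtain a b d where *: "adm a" "X = mat a" "adm b" "Y = mat b" "adm d" "Z = mat d"
    by (metis MA_carrierE)
  show "X \<oplus>\<^bsub>MA\<^esub> Y \<in> carrier MA" using * by (simp add: MA_add MA_carrierI adm_add)
  show "X \<oplus>\<^bsub>MA\<^esub> Y \<oplus>\<^bsub>MA\<^esub> Z = X \<oplus>\<^bsub>MA\<^esub> (Y \<oplus>\<^bsub>MA\<^esub> Z)" using * by (simp add: MA_add adm_add a_assoc)
  show "X \<oplus>\<^bsub>MA\<^esub> Y = Y \<oplus>\<^bsub>MA\<^esub> X" using * by (simp add: MA_add a_comm)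
  show "\<zero>\<^bsub>MA\<^esub> \<oplus>\<^bsub>MA\<^esub> X = X" using * by (simp add: MA_add MA_zero adm_zero)
  have "mat (\<lambda>r c. (- 1) \<odot>\<^bsub>B\<^esub> a r c) \<oplus>\<^bsub>MA\<^esub> X = \<zero>\<^bsub>MA\<^esub>"
    using * by (simp add: MA_add MA_zero adm_scl) (simp add: scl_minus_one l_neg)
  then show "\<exists>Y\<in>carrier MA. Y \<oplus>\<^bsub>MA\<^esub> X = \<zero>\<^bsub>MA\<^esub>" using * MA_carrierI adm_scl by blast
qed

lemma MA_kalgebra: "kalgebra MA"
proof -
  interpret MA: abelian_group MA by (rule MA_abelian_group)
  have mprod_add_l: "mprod S (\<lambda>r c. a r c \<oplus> b r c) d = (\<lambda>r c. mprod S a d r c \<oplus> mprod S b d r c)"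
    if "adm a" "adm b" "adm d" "finite S" for S a b d
    using that unfolding mprod_def
    by (intro ext) (simp add: mult_l_distr finsum_addf)
  have mprod_add_r: "mprod S d (\<lambda>r c. a r c \<oplus> b r c) = (\<lambda>r c. mprod S d a r c \<oplus> mprod S d b r c)"
    if "adm a" "adm b" "adm d" "finite S" for S a b d
    using that unfolding mprod_def
    by (intro ext) (simp add: mult_r_distr finsum_addf)
  have fs: "t \<odot>\<^bsub>B\<^esub> finsum B g S = finsum B (\<lambda>s. t \<odot>\<^bsub>B\<^esub> g s) S" if "finite S" "g \<in> S \<rightarrow> carrier B" for t g and S :: "int set"
    using that by (intro finsum_hom) (auto simp: abelian_group_axioms scl_add)
  have mprod_scl: "mprod S (\<lambda>r c. t \<odot>\<^bsub>B\<^esub> a r c) d = (\<lambda>r c. t \<odot>\<^bsub>B\<^esub> mprod S a d r c)"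
    "mprod S a (\<lambda>r c. t \<odot>\<^bsub>B\<^esub> d r c) = (\<lambda>r c. t \<odot>\<^bsub>B\<^esub> mprod S a d r c)"
    if "adm a" "adm d" "finite S" for S a d t
    using that unfolding mprod_def by (simp_all add: fs scl_mult mult_scl)
  show ?thesis
  proof
    fix X Y Z and s t :: 'k assume "X \<in> carrier MA" "Y \<in> carrier MA" "Z \<in> carrier MA"
    then obtain a b d where *: "adm a" "X = mat a" "adm b" "Y = mat b" "adm d" "Z = mat d"
      by (metis MA_carrierE)
    obtain S where S: "finite S" "\<And>x s t. x \<in> {a, b, d} \<Longrightarrow> x s t \<noteq> \<zero> \<Longrightarrow> s \<in> S \<and> t \<in> S"
      using MA_common_support *(1,3,5) by metis
    have prod: "mat x \<otimes>\<^bsub>MA\<^esub> mat y = mat (mprod S x y)" if "adm x" "adm y" "x \<in> {a, b, d} \<or> y \<in> {a, b, d}" for x y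
      using that S by (intro MA_mult) auto
    show "X \<otimes>\<^bsub>MA\<^esub> Y \<in> carrier MA" using * S(1) by (simp add: prod MA_carrierI adm_mprod)
    show "X \<otimes>\<^bsub>MA\<^esub> Y \<otimes>\<^bsub>MA\<^esub> Z = X \<otimes>\<^bsub>MA\<^esub> (Y \<otimes>\<^bsub>MA\<^esub> Z)"
      using * S(1) by (simp add: prod adm_mprod mprod_assoc)
    show "(X \<oplus>\<^bsub>MA\<^esub> Y) \<otimes>\<^bsub>MA\<^esub> Z = X \<otimes>\<^bsub>MA\<^esub> Z \<oplus>\<^bsub>MA\<^esub> Y \<otimes>\<^bsub>MA\<^esub> Z"
      using * S(1) by (simp add: prod adm_mprod MA_add adm_add mprod_add_l)
    show "Z \<otimes>\<^bsub>MA\<^esub> (X \<oplus>\<^bsub>MA\<^esub> Y) = Z \<otimes>\<^bsub>MA\<^esub> X \<oplus>\<^bsub>MA\<^esub> Z \<otimes>\<^bsub>MA\<^esub> Y"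
      using * S(1) by (simp add: prod adm_mprod MA_add adm_add mprod_add_r)
    show "(t \<odot>\<^bsub>MA\<^esub> X) \<otimes>\<^bsub>MA\<^esub> Y = t \<odot>\<^bsub>MA\<^esub> (X \<otimes>\<^bsub>MA\<^esub> Y)"
      using * S(1) by (simp add: prod adm_mprod MA_smult adm_scl mprod_scl)
    show "X \<otimes>\<^bsub>MA\<^esub> (t \<odot>\<^bsub>MA\<^esub> Y) = t \<odot>\<^bsub>MA\<^esub> (X \<otimes>\<^bsub>MA\<^esub> Y)"
      using * S(1) by (simp add: prod adm_mprod MA_smult adm_scl mprod_scl)
    show "t \<odot>\<^bsub>MA\<^esub> X \<in> carrier MA" using * by (simp add: MA_smult MA_carrierI adm_scl)
    show "t \<odot>\<^bsub>MA\<^esub> (X \<oplus>\<^bsub>MA\<^esub> Y) = t \<odot>\<^bsub>MA\<^esub> X \<oplus>\<^bsub>MA\<^esub> t \<odot>\<^bsub>MA\<^esub> Y"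
      using * by (simp add: MA_smult MA_add adm_scl adm_add scl_add)
    show "(s + t) \<odot>\<^bsub>MA\<^esub> X = s \<odot>\<^bsub>MA\<^esub> X \<oplus>\<^bsub>MA\<^esub> t \<odot>\<^bsub>MA\<^esub> X"
      using * by (simp add: MA_smult MA_add adm_scl add_scl)
    show "s \<odot>\<^bsub>MA\<^esub> (t \<odot>\<^bsub>MA\<^esub> X) = (s * t) \<odot>\<^bsub>MA\<^esub> X"
      using * by (simp add: MA_smult adm_scl scl_scl)
    show "1 \<odot>\<^bsub>MA\<^esub> X = X" using * by (simp add: MA_smult)
  qed
qed

lemma mat_mult_sing:
  assumes a: "adm a" and z: "z \<in> J (r0 - c0)"
  shows "mat a \<otimes>\<^bsub>MA\<^esub> mat (sing r0 c0 z) = mat (\<lambda>r c. if c = c0 then a r r0 \<otimes> z else \<zero>)"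
proof -
  have "mprod {r0} a (sing r0 c0 z) = (\<lambda>r c. if c = c0 then a r r0 \<otimes> z else \<zero>)"
    using a z by (intro ext) (simp add: mprod_def sing_def finsum_insert)
  moreover have "mat a \<otimes>\<^bsub>MA\<^esub> mat (sing r0 c0 z) = mat (mprod {r0} a (sing r0 c0 z))"
    by (rule MA_mult[OF a adm_sing[OF z]]) (auto simp: sing_def split: if_splits)
  ultimately show ?thesis by simp
qed

lemma sing_mult_mat:
  assumes a: "adm a" and z: "z \<in> J (r0 - c0)"
  shows "mat (sing r0 c0 z) \<otimes>\<^bsub>MA\<^esub> mat a = mat (\<lambda>r c. if r = r0 then z \<otimes> a c0 c else \<zero>)"
proof -
  have "mprod {c0} (sing r0 c0 z) a = (\<lambda>r c. if r = r0 then z \<otimes> a c0 c else \<zero>)"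
    using a z by (intro ext) (simp add: mprod_def sing_def finsum_insert)
  moreover have "mat (sing r0 c0 z) \<otimes>\<^bsub>MA\<^esub> mat a = mat (mprod {c0} (sing r0 c0 z) a)"
    by (rule MA_mult[OF adm_sing[OF z] a]) (auto simp: sing_def split: if_splits)
  ultimately show ?thesis by simp
qed

lemma sing_mult_sing:
  assumes "w \<in> J (r0 - s)" "z \<in> J (s - c0)"
  shows "mat (sing r0 s w) \<otimes>\<^bsub>MA\<^esub> mat (sing s c0 z) = mat (sing r0 c0 (w \<otimes> z))"
proof -
  have "(\<lambda>r c. if c = c0 then sing r0 s w r s \<otimes> z else \<zero>) = sing r0 c0 (w \<otimes> z)"
    using assms by (intro ext) (auto simp: sing_def)
  then show ?thesis using mat_mult_sing[OF adm_sing[OF assms(1)] assms(2)] by simp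
qed

lemma sing_zero_iff: "z \<in> J (r - c) \<Longrightarrow> mat (sing r c z) = \<zero>\<^bsub>MA\<^esub> \<longleftrightarrow> z \<in> J (int N + r - c)"
  by (auto simp: mat_zero_iff adm_sing) (auto simp: sing_def split: if_splits)

definition shift :: "'v \<times> int \<Rightarrow> nat \<Rightarrow> int \<Rightarrow> int \<Rightarrow> 'a set" where
  "shift = (\<lambda>(x, i) j. mat (sing (i - int j) i (e x)))"

lemma shift_idem: "shift (x, i) 0 = matrix_idem B e (x, i)"
  by (auto simp: shift_def matrix_idem_def mat_def sing_def cls_def E_zero fun_eq_iff)

lemma e_J: "x \<in> V \<Longrightarrow> z \<le> 0 \<Longrightarrow> e x \<in> J z"
  by (simp add: J_nonpos)

lemma adm_row: "adm a \<Longrightarrow> x \<in> V \<Longrightarrow> adm (\<lambda>r c. if r = i - int j then e x \<otimes> a i c else \<zero>)"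
proof (rule adm_subset[where F = "{i - int j} \<times> {s. \<exists>t. a t s \<noteq> \<zero>}"])
  assume a: "adm a" and x: "x \<in> V"
  show "(if r = i - int j then e x \<otimes> a i c else \<zero>) \<in> J (r - c)" for r c
  proof -
    have "- int j + (i - c) = i - int j - c" by simp
    then have "e x \<otimes> a i c \<in> J (i - int j - c)"
      using J_mult[OF e_J[OF x, of "- int j"] admD[OF a, of i c]] by (simp only: neg_le_0_iff_le of_nat_0_le_iff)
    then show ?thesis by simp
  qed
  show "finite ({i - int j} \<times> {s. \<exists>t. a t s \<noteq> \<zero>})" using adm_finite[OF a] by simp
  show "(if r = i - int j then e x \<otimes> a i c else \<zero>) \<noteq> \<zero> \<Longrightarrow> (r, c) \<in> {i - int j} \<times> {s. \<exists>t. a t s \<noteq> \<zero>}" for r c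
    using x by (auto split: if_splits intro!: exI[of _ i])
qed

lemma adm_col: "adm a \<Longrightarrow> x \<in> V \<Longrightarrow> adm (\<lambda>r c. if c = i then a r (i - int j) \<otimes> e x else \<zero>)"
proof (rule adm_subset[where F = "{s. \<exists>t. a s t \<noteq> \<zero>} \<times> {i}"])
  assume a: "adm a" and x: "x \<in> V"
  show "(if c = i then a r (i - int j) \<otimes> e x else \<zero>) \<in> J (r - c)" for r c
  proof -
    have "r - (i - int j) + - int j = r - i" by simp
    then have "a r (i - int j) \<otimes> e x \<in> J (r - i)"
      using J_mult[OF admD[OF a, of r "i - int j"] e_J[OF x, of "- int j"]] by (simp only: neg_le_0_iff_le of_nat_0_le_iff)
    then show ?thesis by simp
  qed
  show "finite ({s. \<exists>t. a s t \<noteq> \<zero>} \<times> {i})" using adm_finite[OF a] by simp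
  show "(if c = i then a r (i - int j) \<otimes> e x else \<zero>) \<noteq> \<zero> \<Longrightarrow> (r, c) \<in> {s. \<exists>t. a s t \<noteq> \<zero>} \<times> {i}" for r c
    using x by (auto split: if_splits intro!: exI[of _ "i - int j"])
qed

lemma mat_mult_shift:
  "adm a \<Longrightarrow> x \<in> V \<Longrightarrow> mat a \<otimes>\<^bsub>MA\<^esub> shift (x, i) j = mat (\<lambda>r c. if c = i then a r (i - int j) \<otimes> e x else \<zero>)"
  by (simp add: shift_def mat_mult_sing e_J)

lemma shift_mult_mat:
  "adm a \<Longrightarrow> x \<in> V \<Longrightarrow> shift (x, i) j \<otimes>\<^bsub>MA\<^esub> mat a = mat (\<lambda>r c. if r = i - int j then e x \<otimes> a i c else \<zero>)"
  by (simp add: shift_def sing_mult_mat e_J)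

lemma corner:
  assumes "adm a" "x \<in> V" "y \<in> V"
  shows "shift (y, k) 0 \<otimes>\<^bsub>MA\<^esub> mat a \<otimes>\<^bsub>MA\<^esub> shift (x, i) 0 = mat (sing k i (e y \<otimes> a k i \<otimes> e x))"
proof -
  have "shift (y, k) 0 \<otimes>\<^bsub>MA\<^esub> mat a \<otimes>\<^bsub>MA\<^esub> shift (x, i) 0
      = mat (\<lambda>r c. if c = i then (if r = k - int 0 then e y \<otimes> a k (i - int 0) else \<zero>) \<otimes> e x else \<zero>)"
    by (simp only: shift_mult_mat[OF assms(1,3)] mat_mult_shift[OF adm_row[OF assms(1,3)] assms(2)])
  also have "(\<lambda>r c. if c = i then (if r = k - int 0 then e y \<otimes> a k (i - int 0) else \<zero>) \<otimes> e x else \<zero>)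
      = sing k i (e y \<otimes> a k i \<otimes> e x)"
    using assms by (intro ext) (auto simp: sing_def)
  finally show ?thesis .
qed

lemma MA_shift_algebra: "shift_algebra MA V N shift"
proof -
  interpret MA: kalgebra MA by (rule MA_kalgebra)
  show ?thesis
  proof
    fix x :: 'v and i :: int and j l :: nat assume x: "x \<in> V"
    show "shift (x, i) j \<in> carrier MA" using x by (simp add: shift_def MA_carrierI adm_sing e_J)
    have "mat (sing (i - int (j + l)) (i - int j) (e x)) \<otimes>\<^bsub>MA\<^esub> mat (sing (i - int j) i (e x))
        = mat (sing (i - int (j + l)) i (e x \<otimes> e x))"
      using x by (intro sing_mult_sing) (auto simp: e_J)
    then show "shift (x, i - int j) l \<otimes>\<^bsub>MA\<^esub> shift (x, i) j = shift (x, i) (j + l)"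
      using x by (simp add: shift_def e_idem algebra_simps)
    show "shift (x, i) N = \<zero>\<^bsub>MA\<^esub>" using x by (simp add: shift_def sing_zero_iff e_J)
  qed (rule nilpotency_degree_pos)
qed

lemma MA_finsum_eval:
  assumes "finite F" "g \<in> F \<rightarrow> carrier MA"
  shows "finsum MA g F r c = finsum (E r c) (\<lambda>\<nu>. g \<nu> r c) F"
  using assms E_kspace MA_abelian_group
  by (intro finsum_hom[where h = "\<lambda>A. A r c" and G = MA])
    (auto simp: kspace_def matrix_algebra_def)

lemma finsum_indexed:
  assumes "finite S" "\<And>x. x \<in> V \<Longrightarrow> g x \<in> carrier B"
  shows "finsum B (\<lambda>(x, i). if i = r then g x else \<zero>) (V \<times> S) = (if r \<in> S then finsum B g V else \<zero>)"
proof (cases "r \<in> S")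
  case True
  have "finsum B (\<lambda>(x, i). if i = r then g x else \<zero>) (V \<times> S) = finsum B (\<lambda>p. g (fst p)) ((\<lambda>x. (x, r)) ` V)"
    using assms True V_finite by (intro add.finprod_mono_neutral_cong_right) (auto split: if_splits)
  also have "\<dots> = finsum B g V"
    using assms by (subst finsum_reindex) (auto simp: inj_on_def)
  finally show ?thesis using True by simp
next
  case False
  then show ?thesis by (auto intro!: add.finprod_one_eqI)
qed

lemma MA_local_unit_algebra: "local_unit_algebra MA (V \<times> UNIV) (\<lambda>\<nu>. shift \<nu> 0)"
proof -
  interpret MA: shift_algebra MA V N shift by (rule MA_shift_algebra)
  show ?thesis
  proof
    fix \<nu> :: "'v \<times> int" assume "\<nu> \<in> V \<times> UNIV"
    then obtain x i where "\<nu> = (x, i)" "x \<in> V" by auto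
    then show "shift \<nu> 0 \<in> carrier MA" "shift \<nu> 0 \<otimes>\<^bsub>MA\<^esub> shift \<nu> 0 = shift \<nu> 0"
      by (auto simp: MA.u_idem)
  next
    fix \<mu> \<nu> :: "'v \<times> int" assume *: "\<mu> \<in> V \<times> UNIV" "\<nu> \<in> V \<times> UNIV" "\<mu> \<noteq> \<nu>"
    then obtain x i y k where \<mu>\<nu>: "\<mu> = (x, i)" "x \<in> V" "\<nu> = (y, k)" "y \<in> V" by auto
    have "(\<lambda>r c. if c = k then sing i i (e x) r k \<otimes> e y else \<zero>) = (\<lambda>r c. \<zero>)"
      using \<mu>\<nu> * e_orth[of x y] by (intro ext) (auto simp: sing_def)
    moreover have "mat (sing i i (e x)) \<otimes>\<^bsub>MA\<^esub> shift (y, k) 0 = mat (\<lambda>r c. if c = k then sing i i (e x) r k \<otimes> e y else \<zero>)"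
      using mat_mult_shift[of "sing i i (e x)" y k 0, unfolded of_nat_0 diff_zero] \<mu>\<nu> by (simp add: adm_sing e_J)
    ultimately have "mat (sing i i (e x)) \<otimes>\<^bsub>MA\<^esub> shift (y, k) 0 = \<zero>\<^bsub>MA\<^esub>"
      by (simp only: MA_zero)
    then show "shift \<mu> 0 \<otimes>\<^bsub>MA\<^esub> shift \<nu> 0 = \<zero>\<^bsub>MA\<^esub>"
      by (simp add: \<mu>\<nu> shift_def)
  next
    fix A assume "A \<in> carrier MA"
    then obtain a where a: "adm a" "A = mat a" by (rule MA_carrierE)
    let ?S = "{s. \<exists>t. a s t \<noteq> \<zero>}" and ?S' = "{s. \<exists>t. a t s \<noteq> \<zero>}"
    note fin = adm_finite[OF a(1)]
    have Jl: "e x \<otimes> a r c \<in> J (r - c)" and Jr: "a r c \<otimes> e x \<in> J (r - c)" if "x \<in> V" for x r c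
      using J_mult_r[OF admD[OF a(1)]] J_mult_l[OF admD[OF a(1)]] that by simp_all
    have val_l: "(shift (x, i) 0 \<otimes>\<^bsub>MA\<^esub> A) r c = cls r c (if i = r then e x \<otimes> a r c else \<zero>)" if "x \<in> V" for x i r c
      by (simp only: a(2) shift_mult_mat[OF a(1) that]) (simp add: mat_def)
    have val_r: "(A \<otimes>\<^bsub>MA\<^esub> shift (x, i) 0) r c = cls r c (if i = c then a r c \<otimes> e x else \<zero>)" if "x \<in> V" for x i r c
      by (simp only: a(2) mat_mult_shift[OF a(1) that]) (simp add: mat_def)
    have "finsum MA (\<lambda>\<nu>. shift \<nu> 0 \<otimes>\<^bsub>MA\<^esub> A) (V \<times> ?S) = A"
    proof (intro ext)
      fix r c
      have "finsum MA (\<lambda>\<nu>. shift \<nu> 0 \<otimes>\<^bsub>MA\<^esub> A) (V \<times> ?S) r c = finsum (E r c) (\<lambda>\<nu>. (shift \<nu> 0 \<otimes>\<^bsub>MA\<^esub> A) r c) (V \<times> ?S)"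
        using V_finite fin a by (intro MA_finsum_eval) (auto simp: MA_carrierI)
      also have "\<dots> = finsum (E r c) (\<lambda>p. cls r c (case p of (x, i) \<Rightarrow> if i = r then e x \<otimes> a r c else \<zero>)) (V \<times> ?S)"
        using val_l Jl
        by (intro abelian_monoid.finsum_cong' abelian_group.axioms(1) kspace.axioms(1) E_kspace)
          (auto simp: E_carrier)
      also have "\<dots> = cls r c (finsum B (\<lambda>(x, i). if i = r then e x \<otimes> a r c else \<zero>) (V \<times> ?S))"
        using V_finite fin Jl by (intro cls_finsum) auto
      also have "\<dots> = A r c" using a fin by (auto simp: finsum_indexed e_complete_l mat_def)
      finally show "finsum MA (\<lambda>\<nu>. shift \<nu> 0 \<otimes>\<^bsub>MA\<^esub> A) (V \<times> ?S) r c = A r c" .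
    qed
    then show "\<exists>F\<subseteq>V \<times> UNIV. finite F \<and> A = finsum MA (\<lambda>\<nu>. shift \<nu> 0 \<otimes>\<^bsub>MA\<^esub> A) F"
      using V_finite fin by (intro exI[of _ "V \<times> ?S"]) auto
    have "finsum MA (\<lambda>\<nu>. A \<otimes>\<^bsub>MA\<^esub> shift \<nu> 0) (V \<times> ?S') = A"
    proof (intro ext)
      fix r c
      have "finsum MA (\<lambda>\<nu>. A \<otimes>\<^bsub>MA\<^esub> shift \<nu> 0) (V \<times> ?S') r c = finsum (E r c) (\<lambda>\<nu>. (A \<otimes>\<^bsub>MA\<^esub> shift \<nu> 0) r c) (V \<times> ?S')"
        using V_finite fin a by (intro MA_finsum_eval) (auto simp: MA_carrierI)
      also have "\<dots> = finsum (E r c) (\<lambda>p. cls r c (case p of (x, i) \<Rightarrow> if i = c then a r c \<otimes> e x else \<zero>)) (V \<times> ?S')"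
        using val_r Jr
        by (intro abelian_monoid.finsum_cong' abelian_group.axioms(1) kspace.axioms(1) E_kspace)
          (auto simp: E_carrier)
      also have "\<dots> = cls r c (finsum B (\<lambda>(x, i). if i = c then a r c \<otimes> e x else \<zero>) (V \<times> ?S'))"
        using V_finite fin Jr by (intro cls_finsum) auto
      also have "\<dots> = A r c" using a fin by (auto simp: finsum_indexed e_complete_r mat_def)
      finally show "finsum MA (\<lambda>\<nu>. A \<otimes>\<^bsub>MA\<^esub> shift \<nu> 0) (V \<times> ?S') r c = A r c" .
    qed
    then show "\<exists>F\<subseteq>V \<times> UNIV. finite F \<and> A = finsum MA (\<lambda>\<nu>. A \<otimes>\<^bsub>MA\<^esub> shift \<nu> 0) F"
      using V_finite fin by (intro exI[of _ "V \<times> ?S'"]) auto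
  qed
qed

end


text \<open>The set \<open>W\<close> stands for the vertices attached to the quiver, which are sinks.  The conditions
  \<open>off_diagonal\<close> and \<open>sinks\<close> serve the comparison of indices \<open>(y, i)\<close> and \<open>(x, i)\<close>, \<open>socle\<close> makes the
  contribution of the restricted dual to the endomorphisms of standard modules vanish.\<close>

locale second_order_algebra = filtered_algebra B V e
  for B :: "('k::field, 'a) module" (structure) and V :: "'v set" and e +
  fixes W :: "'v set" and gt :: "'v \<times> int \<Rightarrow> 'v \<times> int \<Rightarrow> bool"
  assumes gt_iff: "gt (y, k) (x, i) \<longleftrightarrow> k < i \<or> (k = i \<and> y \<in> W \<and> x \<notin> W)"
    and off_diagonal: "\<lbrakk>x \<in> V; y \<in> V; x \<noteq> y; a \<in> carrier B\<rbrakk> \<Longrightarrow> e y \<otimes> a \<otimes> e x \<in> radical_power B 1"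
    and diagonal: "\<lbrakk>x \<in> V; a \<in> carrier B\<rbrakk>
      \<Longrightarrow> \<exists>t. \<exists>w\<in>radical_power B 1. e x \<otimes> a \<otimes> e x = t \<odot>\<^bsub>B\<^esub> e x \<oplus> w"
    and e_notin_radical: "x \<in> V \<Longrightarrow> e x \<notin> radical_power B 1"
    and sinks: "\<lbrakk>x \<in> V; y \<in> V; x \<notin> W; y \<in> W; a \<in> carrier B\<rbrakk> \<Longrightarrow> e x \<otimes> a \<otimes> e y = \<zero>"
    and socle: "\<lbrakk>x \<in> V; a \<in> radical_power B (nilpotency_degree B - 1)\<rbrakk> \<Longrightarrow> e x \<otimes> a \<otimes> e x = \<zero>"
begin

text \<open>All conditions reduce to comparisons of exponents of \<open>J\<close>.  Write \<open>\<mu> = (y, k)\<close> and \<open>\<nu> = (x, i)\<close> with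
  \<open>\<mu> > \<nu>\<close>.  An entry in \<open>(k, i)\<close> factors through \<open>u \<nu> 1\<close> if it lies in \<open>J (k - i + 1)\<close>; this holds for
  \<open>k < i\<close> because the exponent is not positive, and for \<open>k = i\<close> by \<open>off_diagonal\<close>.  An entry in \<open>(i, k)\<close>
  that is killed by \<open>u \<nu> 1\<close> lies in \<open>J (N + i - k - 1)\<close>, which is zero for \<open>k < i\<close>, while for \<open>k = i\<close> the
  entry vanishes by \<open>sinks\<close>; for \<open>\<mu> = \<nu>\<close> it vanishes by \<open>socle\<close>.  Finally, what is killed by
  \<open>u (x, i) j\<close> from the right, or by \<open>u (x, i - j) 1\<close> from the left, factors as desired since \<open>j + 1 \<le> N\<close>.\<close>

theorem MA_symmetric_shift_algebra: "symmetric_shift_algebra MA V N shift gt"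
proof -
  interpret MA: shift_algebra MA V N shift by (rule MA_shift_algebra)
  interpret MA: local_unit_algebra MA "V \<times> UNIV" "\<lambda>\<nu>. shift \<nu> 0" by (rule MA_local_unit_algebra)
  have corner_J: "e y \<otimes> a k i \<otimes> e x \<in> J (k - i)" if "adm a" "x \<in> V" "y \<in> V" for a x y k i
    using J_mult_l[OF J_mult_r[OF admD[OF that(1)]]] that by simp
  have lift: "mat (sing k (i - 1) w) \<otimes>\<^bsub>MA\<^esub> shift (x, i) (Suc 0) = mat (sing k i (w \<otimes> e x))"
    if "w \<in> J (k - i + 1)" "x \<in> V" for k i w x
    using sing_mult_sing[of w k "i - 1" "e x" i] that by (simp add: shift_def e_J algebra_simps)
  have lift_r: "shift (x, i) (Suc 0) \<otimes>\<^bsub>MA\<^esub> mat (sing i k w) = mat (sing (i - 1) k (e x \<otimes> w))"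
    if "w \<in> J (i - k)" "x \<in> V" for k i w x
    using sing_mult_sing[of "e x" "i - 1" i w k] that by (simp add: shift_def e_J)
  have lift_r_zero: "w \<in> J (int N + i - k - 1)"
    if "shift (x, i) (Suc 0) \<otimes>\<^bsub>MA\<^esub> mat (sing i k w) = \<zero>\<^bsub>MA\<^esub>" "w \<in> J (i - k)" "x \<in> V" "e x \<otimes> w = w" for k i w x
    using that lift_r[OF that(2,3)] sing_zero_iff[of w "i - 1" k] J_antimono[of "i - 1 - k" "i - k" w]
    by (simp add: algebra_simps)
  have corner_e: "e y \<otimes> (e y \<otimes> a \<otimes> e x) = e y \<otimes> a \<otimes> e x" "e y \<otimes> a \<otimes> e x \<otimes> e x = e y \<otimes> a \<otimes> e x"
    if "a \<in> carrier B" "x \<in> V" "y \<in> V" for a x y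
    using that e_idem[of y] e_idem[of x] by (simp_all add: mult_assoc) (simp flip: mult_assoc)
  show ?thesis
  proof
    fix \<nu> :: "'v \<times> int" assume "\<nu> \<in> V \<times> UNIV"
    then obtain x i where \<nu>: "\<nu> = (x, i)" "x \<in> V" by auto
    have "{\<mu> \<in> V \<times> UNIV. \<exists>A\<in>carrier MA. shift \<nu> 0 \<otimes>\<^bsub>MA\<^esub> A \<otimes>\<^bsub>MA\<^esub> shift \<mu> 0 \<noteq> \<zero>\<^bsub>MA\<^esub>} \<subseteq> V \<times> {i - int N..i + int N}"
    proof
      fix \<mu> assume "\<mu> \<in> {\<mu> \<in> V \<times> UNIV. \<exists>A\<in>carrier MA. shift \<nu> 0 \<otimes>\<^bsub>MA\<^esub> A \<otimes>\<^bsub>MA\<^esub> shift \<mu> 0 \<noteq> \<zero>\<^bsub>MA\<^esub>}"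
      then obtain y k A where *: "y \<in> V" "A \<in> carrier MA"
        "shift \<nu> 0 \<otimes>\<^bsub>MA\<^esub> A \<otimes>\<^bsub>MA\<^esub> shift (y, k) 0 \<noteq> \<zero>\<^bsub>MA\<^esub>" and \<mu>: "\<mu> = (y, k)" by auto
      then obtain a where a: "adm a" "A = mat a" by (blast elim: MA_carrierE)
      have w: "e x \<otimes> a i k \<otimes> e y \<in> J (i - k)" using corner_J a \<nu> * by blast
      have "e x \<otimes> a i k \<otimes> e y \<notin> J (int N + i - k)"
        using *(3) a \<nu> *(1) w by (simp add: corner sing_zero_iff)
      then have "i - k < int N" "0 < int N + i - k"
        using w J_big[of "i - k"] J_nonpos[of "int N + i - k"] by (force, force)
      then show "\<mu> \<in> V \<times> {i - int N..i + int N}" using * \<mu> by auto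
    qed
    then show "finite {\<mu> \<in> V \<times> UNIV. \<exists>A\<in>carrier MA. shift \<nu> 0 \<otimes>\<^bsub>MA\<^esub> A \<otimes>\<^bsub>MA\<^esub> shift \<mu> 0 \<noteq> \<zero>\<^bsub>MA\<^esub>}"
      by (rule finite_subset) (simp add: V_finite)
  next
    fix x :: 'v and i :: int and j :: nat assume "x \<in> V" "0 < j"
    then show "gt (x, i - int j) (x, i)" by (simp add: gt_iff)
  next
    fix \<mu> \<nu> :: "'v \<times> int" and A assume "\<mu> \<in> V \<times> UNIV" "\<nu> \<in> V \<times> UNIV" and gt: "gt \<mu> \<nu>" and "A \<in> carrier MA"
    then obtain y k x i a where *: "\<mu> = (y, k)" "y \<in> V" "\<nu> = (x, i)" "x \<in> V" "adm a" "A = mat a"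
      by (auto elim: MA_carrierE)
    let ?w = "e y \<otimes> a k i \<otimes> e x"
    have w: "?w \<in> J (k - i + 1)"
      using gt * off_diagonal[of x y "a k i"] by (cases "x = y") (auto simp: gt_iff J_nonpos J_def)
    have "shift \<mu> 0 \<otimes>\<^bsub>MA\<^esub> A \<otimes>\<^bsub>MA\<^esub> shift \<nu> 0 = mat (sing k (i - 1) ?w) \<otimes>\<^bsub>MA\<^esub> shift (x, i) (Suc 0)"
      using * w by (simp add: corner lift corner_e)
    moreover have "mat (sing k (i - 1) ?w) \<in> carrier MA"
      using w by (intro MA_carrierI adm_sing) (simp add: algebra_simps)
    ultimately show "shift \<mu> 0 \<otimes>\<^bsub>MA\<^esub> A \<otimes>\<^bsub>MA\<^esub> shift \<nu> 0 \<in> MA.principal (shift \<nu> (Suc 0))"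
      using * by (simp add: MA.principalI)
  next
    fix \<mu> \<nu> :: "'v \<times> int" and A assume "\<mu> \<in> V \<times> UNIV" "\<nu> \<in> V \<times> UNIV" and gt: "gt \<mu> \<nu>" and "A \<in> carrier MA"
      and z: "shift \<nu> (Suc 0) \<otimes>\<^bsub>MA\<^esub> (shift \<nu> 0 \<otimes>\<^bsub>MA\<^esub> A \<otimes>\<^bsub>MA\<^esub> shift \<mu> 0) = \<zero>\<^bsub>MA\<^esub>"
    then obtain y k x i a where *: "\<mu> = (y, k)" "y \<in> V" "\<nu> = (x, i)" "x \<in> V" "adm a" "A = mat a"
      by (auto elim: MA_carrierE)
    let ?w = "e x \<otimes> a i k \<otimes> e y"
    have w: "?w \<in> J (i - k)" using corner_J * by blast
    have c: "shift \<nu> 0 \<otimes>\<^bsub>MA\<^esub> A \<otimes>\<^bsub>MA\<^esub> shift \<mu> 0 = mat (sing i k ?w)" using * by (simp add: corner)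
    have "?w \<in> J (int N + i - k - 1)"
      using z w * unfolding c *(3) by (intro lift_r_zero[where x = x]) (auto simp: corner_e corner)
    then have "?w = \<zero>"
      using gt * sinks[of x y "a i k"] J_big[of "int N + i - k - 1"] by (auto simp: gt_iff)
    then show "shift \<nu> 0 \<otimes>\<^bsub>MA\<^esub> A \<otimes>\<^bsub>MA\<^esub> shift \<mu> 0 = \<zero>\<^bsub>MA\<^esub>"
      unfolding c by (simp add: sing_zero_iff)
  next
    fix x :: 'v and i :: int and j :: nat and A
    assume x: "x \<in> V" and j: "j < N" and A: "A \<in> MA.principal (shift (x, i - int j) 0)"
      and z: "A \<otimes>\<^bsub>MA\<^esub> shift (x, i) j = \<zero>\<^bsub>MA\<^esub>"
    let ?i = "i - int j"
    obtain a where a: "adm a" "A = mat a \<otimes>\<^bsub>MA\<^esub> shift (x, ?i) 0"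
      using A by (auto simp: MA.principal_def elim: MA_carrierE)
    define a' where "a' = (\<lambda>r c. if c = ?i then a r ?i \<otimes> e x else \<zero>)"
    have a': "adm a'" "A = mat a'"
      using adm_col[OF a(1) x, of ?i 0, unfolded of_nat_0 diff_zero]
        mat_mult_shift[OF a(1) x, of ?i 0, unfolded of_nat_0 diff_zero] a(2) by (simp_all only: a'_def)
    have a'e: "a' r ?i \<otimes> e x = a' r ?i" for r using a x by (simp add: a'_def mult_assoc e_idem)
    have "mat (\<lambda>r c. if c = i then a' r ?i \<otimes> e x else \<zero>) = \<zero>\<^bsub>MA\<^esub>"
      using z mat_mult_shift[OF a'(1) x, of i j] by (simp only: a'(2))
    then have "\<forall>r c. (if c = i then a' r ?i \<otimes> e x else \<zero>) \<in> J (int N + r - c)"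
      by (rule iffD1[OF mat_zero_iff[OF adm_col[OF a'(1) x]]])
    then have a'J: "a' r ?i \<in> J (int N + r - i)" for r using a'e by metis
    define d where "d = (\<lambda>r c. if c = ?i - 1 then a' r ?i else \<zero>)"
    have d: "adm d"
    proof (rule adm_subset)
      show "d r c \<in> J (r - c)" for r c
        using j J_antimono[OF _ a'J[of r], of "r - c"] by (auto simp: d_def)
      show "finite ({s. \<exists>t. a' s t \<noteq> \<zero>} \<times> {?i - 1})" using adm_finite[OF a'(1)] by simp
      show "(r, c) \<in> {s. \<exists>t. a' s t \<noteq> \<zero>} \<times> {?i - 1}" if "d r c \<noteq> \<zero>" for r c
        using that by (auto simp: d_def split: if_splits)
    qed
    have "(\<lambda>r c. if c = ?i then d r (?i - int (Suc 0)) \<otimes> e x else \<zero>) = a'"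
      using a'e by (intro ext) (simp add: d_def, simp add: a'_def)
    then have "A = mat d \<otimes>\<^bsub>MA\<^esub> shift (x, ?i) (Suc 0)"
      by (simp only: mat_mult_shift[OF d x] a'(2))
    then show "A \<in> MA.principal (shift (x, ?i) (Suc 0))" using d by (simp add: MA.principalI MA_carrierI)
  next
    fix x :: 'v and i :: int and j :: nat and A
    assume x: "x \<in> V" and j: "j < N" and A: "A \<in> carrier MA" "shift (x, i - int j) 0 \<otimes>\<^bsub>MA\<^esub> A = A"
      and z: "shift (x, i - int j) (Suc 0) \<otimes>\<^bsub>MA\<^esub> A = \<zero>\<^bsub>MA\<^esub>"
    let ?i = "i - int j"
    obtain a where a: "adm a" "A = mat a" using A by (auto elim: MA_carrierE)
    define a' where "a' = (\<lambda>r c. if r = ?i then e x \<otimes> a ?i c else \<zero>)"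
    have a': "adm a'" "A = mat a'"
      using adm_row[OF a(1) x, of ?i 0, unfolded of_nat_0 diff_zero]
        shift_mult_mat[OF a(1) x, of ?i 0, unfolded of_nat_0 diff_zero] a(2) A(2) by (simp_all only: a'_def)
    have a'e: "e x \<otimes> a' ?i c = a' ?i c" for c using a x by (simp add: a'_def e_idem flip: mult_assoc)
    have "mat (\<lambda>r c. if r = ?i - int (Suc 0) then e x \<otimes> a' ?i c else \<zero>) = \<zero>\<^bsub>MA\<^esub>"
      using z shift_mult_mat[OF a'(1) x, of ?i "Suc 0"] by (simp only: a'(2))
    then have "\<forall>r c. (if r = ?i - int (Suc 0) then e x \<otimes> a' ?i c else \<zero>) \<in> J (int N + r - c)"
      by (rule iffD1[OF mat_zero_iff[OF adm_row[OF a'(1) x]]])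
    then have a'J: "a' ?i c \<in> J (int N + (?i - int (Suc 0)) - c)" for c using a'e by metis
    define d where "d = (\<lambda>r c. if r = i then a' ?i c else \<zero>)"
    have d: "adm d"
    proof (rule adm_subset)
      show "d r c \<in> J (r - c)" for r c
        using j J_antimono[OF _ a'J[of c], of "r - c"] by (auto simp: d_def)
      show "finite ({i} \<times> {s. \<exists>t. a' t s \<noteq> \<zero>})" using adm_finite[OF a'(1)] by simp
      show "(r, c) \<in> {i} \<times> {s. \<exists>t. a' t s \<noteq> \<zero>}" if "d r c \<noteq> \<zero>" for r c
        using that by (auto simp: d_def split: if_splits)
    qed
    have "(\<lambda>r c. if r = ?i then e x \<otimes> d i c else \<zero>) = a'"
      using a'e by (intro ext) (simp add: d_def, simp add: a'_def)
    then have "A = shift (x, i) j \<otimes>\<^bsub>MA\<^esub> mat d"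
      by (simp only: shift_mult_mat[OF d x] a'(2))
    then show "\<exists>A'\<in>carrier MA. A = shift (x, i) j \<otimes>\<^bsub>MA\<^esub> A'" using d MA_carrierI by blast
  next
    fix x :: 'v and i :: int and A assume x: "x \<in> V" and "A \<in> carrier MA"
    then obtain a where a: "adm a" "A = mat a" by (blast elim: MA_carrierE)
    let ?w = "e x \<otimes> a i i \<otimes> e x"
    obtain t v where t: "v \<in> J 1" "?w = t \<odot>\<^bsub>B\<^esub> e x \<oplus> v" using diagonal[OF x, of "a i i"] a by (auto simp: J_def)
    have "?w \<otimes> e x = t \<odot>\<^bsub>B\<^esub> e x \<oplus> v \<otimes> e x"
      using t x by (subst t(2)) (simp add: mult_l_distr scl_mult e_idem)
    then have v: "v \<otimes> e x = v" using corner_e(2)[of "a i i" x x] x a t by simp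
    have vJ: "v \<in> J (i - (i - 1))" "v \<in> J (i - i)" using t(1) by (simp_all add: J_nonpos)
    have "shift (x, i) 0 \<otimes>\<^bsub>MA\<^esub> A \<otimes>\<^bsub>MA\<^esub> shift (x, i) 0 = mat (sing i i ?w)"
      using a x by (simp add: corner)
    also have "sing i i ?w = (\<lambda>r c. t \<odot>\<^bsub>B\<^esub> sing i i (e x) r c \<oplus> sing i i v r c)"
      using t by (intro ext) (simp add: sing_def)
    also have "mat (\<lambda>r c. t \<odot>\<^bsub>B\<^esub> sing i i (e x) r c \<oplus> sing i i v r c)
        = t \<odot>\<^bsub>MA\<^esub> shift (x, i) 0 \<oplus>\<^bsub>MA\<^esub> mat (sing i i v)"
      using x vJ by (simp add: shift_def MA_smult MA_add adm_sing adm_scl e_J)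
    also have "mat (sing i i v) = mat (sing i (i - 1) v) \<otimes>\<^bsub>MA\<^esub> shift (x, i) (Suc 0)"
      using lift[of v i i x] t x v by simp
    finally have "shift (x, i) 0 \<otimes>\<^bsub>MA\<^esub> A \<otimes>\<^bsub>MA\<^esub> shift (x, i) 0
        = t \<odot>\<^bsub>MA\<^esub> shift (x, i) 0 \<oplus>\<^bsub>MA\<^esub> mat (sing i (i - 1) v) \<otimes>\<^bsub>MA\<^esub> shift (x, i) (Suc 0)" .
    moreover have "mat (sing i (i - 1) v) \<otimes>\<^bsub>MA\<^esub> shift (x, i) (Suc 0) \<in> MA.principal (shift (x, i) (Suc 0))"
      using vJ by (intro MA.principalI MA_carrierI adm_sing)
    ultimately show "\<exists>t. \<exists>v\<in>MA.principal (shift (x, i) (Suc 0)).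
        shift (x, i) 0 \<otimes>\<^bsub>MA\<^esub> A \<otimes>\<^bsub>MA\<^esub> shift (x, i) 0 = t \<odot>\<^bsub>MA\<^esub> shift (x, i) 0 \<oplus>\<^bsub>MA\<^esub> v" by blast
  next
    fix x :: 'v and i :: int and A assume x: "x \<in> V" and "A \<in> carrier MA"
      and z: "shift (x, i) (Suc 0) \<otimes>\<^bsub>MA\<^esub> (shift (x, i) 0 \<otimes>\<^bsub>MA\<^esub> A \<otimes>\<^bsub>MA\<^esub> shift (x, i) 0) = \<zero>\<^bsub>MA\<^esub>"
    then obtain a where a: "adm a" "A = mat a" by (blast elim: MA_carrierE)
    let ?w = "e x \<otimes> a i i \<otimes> e x"
    have c: "shift (x, i) 0 \<otimes>\<^bsub>MA\<^esub> A \<otimes>\<^bsub>MA\<^esub> shift (x, i) 0 = mat (sing i i ?w)" using a x by (simp add: corner)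
    have "?w \<in> J (int N + i - i - 1)"
      using z a x corner_J[OF a(1) x x, of i i] unfolding c by (intro lift_r_zero[where x = x]) (auto simp: corner_e corner)
    then have "?w \<in> radical_power B (N - 1)" by (simp add: J_def nat_diff_distrib')
    then have "e x \<otimes> ?w \<otimes> e x = \<zero>" by (rule socle[OF x])
    then have "?w = \<zero>" using a x by (simp add: corner_e)
    then show "shift (x, i) 0 \<otimes>\<^bsub>MA\<^esub> A \<otimes>\<^bsub>MA\<^esub> shift (x, i) 0 = \<zero>\<^bsub>MA\<^esub>"
      unfolding c by (simp add: sing_zero_iff)
  next
    fix x :: 'v and i :: int assume x: "x \<in> V"
    show "shift (x, i) 0 \<notin> MA.principal (shift (x, i) (Suc 0))"
    proof
      assume "shift (x, i) 0 \<in> MA.principal (shift (x, i) (Suc 0))"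
      then obtain d where d: "adm d" "shift (x, i) 0 = mat d \<otimes>\<^bsub>MA\<^esub> shift (x, i) (Suc 0)"
        by (auto simp: MA.principal_def elim: MA_carrierE)
      let ?d = "\<lambda>r c. if c = i then d r (i - int (Suc 0)) \<otimes> e x else \<zero>"
      have "mat (sing i i (e x)) = mat ?d" using d(2) mat_mult_shift[OF d(1) x, of i "Suc 0"] by (simp add: shift_def)
      then have "\<forall>r c. sing i i (e x) r c \<ominus> ?d r c \<in> J (int N + r - c)"
        using mat_eq_iff[OF adm_sing adm_col[OF d(1) x], of "e x" i i] x by (simp add: e_J)
      then have "e x \<ominus> d i (i - 1) \<otimes> e x \<in> J (int N)" by (auto simp: sing_def dest!: spec[of _ i])
      then have "e x \<ominus> d i (i - 1) \<otimes> e x = \<zero>" by (simp add: J_big)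
      moreover have "e x = (e x \<ominus> d i (i - 1) \<otimes> e x) \<oplus> d i (i - 1) \<otimes> e x"
        using x d(1) by (simp add: minus_eq a_assoc l_neg)
      ultimately have "e x = d i (i - 1) \<otimes> e x" using x d(1) by simp
      moreover have "d i (i - 1) \<otimes> e x \<in> J 1" using J_mult_l[OF admD[OF d(1), of i "i - 1"], of "e x"] x by simp
      ultimately show False using e_notin_radical[OF x] by (simp add: J_def)
    qed
  qed
qed

end


section \<open>Path algebras\<close>

text \<open>The parameter \<open>K\<close> only serves to fix the type of coefficients.\<close>

locale finite_quiver = fin_digraph Q
  for Q :: "('v, 'a) pre_digraph" +
  fixes K :: "'k::field itself"
begin

abbreviation "PA \<equiv> path_algebra Q :: ('k, 'v \<times> 'a list \<Rightarrow> 'k) module"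

lemma path_Nil: "(u, []) \<in> quiver_paths Q \<longleftrightarrow> u \<in> verts Q"
  by (auto simp: quiver_paths_def awalk_Nil_iff)

lemma path_append: "(u, p @ q) \<in> quiver_paths Q \<longleftrightarrow> (u, p) \<in> quiver_paths Q \<and> (awlast u p, q) \<in> quiver_paths Q"
  by (auto simp: quiver_paths_def)

lemma path_vertices:
  assumes "(u, p) \<in> quiver_paths Q"
  shows "u \<in> verts Q" "awlast u p \<in> verts Q"
  using assms by (auto simp: quiver_paths_def)

lemma PA_simps:
  "f \<in> carrier PA \<longleftrightarrow> finite {x. f x \<noteq> 0} \<and> {x. f x \<noteq> 0} \<subseteq> quiver_paths Q"
  "(f \<otimes>\<^bsub>PA\<^esub> g) (u, p) = (\<Sum>i\<le>length p. f (awlast u (take i p), drop i p) * g (u, take i p))"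
  "f \<oplus>\<^bsub>PA\<^esub> g = (\<lambda>x. f x + g x)"
  "\<zero>\<^bsub>PA\<^esub> = (\<lambda>_. 0)"
  "t \<odot>\<^bsub>PA\<^esub> f = (\<lambda>x. t * f x)"
  "\<one>\<^bsub>PA\<^esub> = (\<lambda>(u, p). if u \<in> verts Q \<and> p = [] then 1 else 0)"
  by (simp_all add: path_algebra_def)

lemma PA_path: "f \<in> carrier PA \<Longrightarrow> f x \<noteq> 0 \<Longrightarrow> x \<in> quiver_paths Q"
  by (auto simp: PA_simps)

lemma PA_add_closed: "f \<in> carrier PA \<Longrightarrow> g \<in> carrier PA \<Longrightarrow> f \<oplus>\<^bsub>PA\<^esub> g \<in> carrier PA"
proof -
  assume f: "f \<in> carrier PA" and g: "g \<in> carrier PA"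
  have "{x. f x + g x \<noteq> 0} \<subseteq> {x. f x \<noteq> 0} \<union> {x. g x \<noteq> 0}" by auto
  then have "{x. f x + g x \<noteq> 0} \<subseteq> quiver_paths Q" using f g unfolding PA_simps(1) by blast
  moreover have "finite ({x. f x \<noteq> 0} \<union> {x. g x \<noteq> 0})" using f g by (simp add: PA_simps)
  then have "finite {x. f x + g x \<noteq> 0}" by (rule rev_finite_subset) auto
  ultimately show ?thesis by (simp add: PA_simps)
qed

lemma PA_smult_closed: "f \<in> carrier PA \<Longrightarrow> t \<odot>\<^bsub>PA\<^esub> f \<in> carrier PA"
proof -
  assume f: "f \<in> carrier PA"
  have "{x. t * f x \<noteq> 0} \<subseteq> {x. f x \<noteq> 0}" by auto
  moreover have "finite {x. f x \<noteq> 0}" using f by (simp add: PA_simps)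
  ultimately have "finite {x. t * f x \<noteq> 0}" by (rule finite_subset)
  then show ?thesis using f by (auto simp: PA_simps)
qed

lemma PA_mult_nonzero:
  assumes "(f \<otimes>\<^bsub>PA\<^esub> g) (u, p) \<noteq> 0"
  obtains q r where "p = q @ r" "f (awlast u q, r) \<noteq> 0" "g (u, q) \<noteq> 0"
proof -
  have "(\<Sum>i\<le>length p. f (awlast u (take i p), drop i p) * g (u, take i p)) \<noteq> 0"
    using assms by (simp add: PA_simps)
  then obtain i where "f (awlast u (take i p), drop i p) * g (u, take i p) \<noteq> 0"
    by (rule sum.not_neutral_contains_not_neutral)
  then show thesis by (intro that[of "take i p" "drop i p"]) auto
qed

lemma PA_mult_closed: "f \<in> carrier PA \<Longrightarrow> g \<in> carrier PA \<Longrightarrow> f \<otimes>\<^bsub>PA\<^esub> g \<in> carrier PA"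
proof -
  assume f: "f \<in> carrier PA" and g: "g \<in> carrier PA"
  let ?F = "(\<lambda>((v, r), (u, q)). (u, q @ r)) ` ({x. f x \<noteq> 0} \<times> {x. g x \<noteq> 0})"
  have "x \<in> ?F \<and> x \<in> quiver_paths Q" if nz: "(f \<otimes>\<^bsub>PA\<^esub> g) x \<noteq> 0" for x
  proof -
    obtain u p where x: "x = (u, p)" by force
    obtain q r where qr: "p = q @ r" "f (awlast u q, r) \<noteq> 0" "g (u, q) \<noteq> 0"
      using PA_mult_nonzero nz unfolding x by metis
    have "((awlast u q, r), (u, q)) \<in> {x. f x \<noteq> 0} \<times> {x. g x \<noteq> 0}" using qr by simp
    then have "x \<in> ?F" unfolding x qr(1) by (rule rev_image_eqI) simp
    then show ?thesis using PA_path[OF f qr(2)] PA_path[OF g qr(3)] x qr(1) by (simp add: path_append)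
  qed
  then have sub: "{x. (f \<otimes>\<^bsub>PA\<^esub> g) x \<noteq> 0} \<subseteq> ?F" "{x. (f \<otimes>\<^bsub>PA\<^esub> g) x \<noteq> 0} \<subseteq> quiver_paths Q" by blast+
  have "finite ?F" using f g by (simp add: PA_simps)
  then show ?thesis using sub finite_subset unfolding PA_simps(1) by blast
qed

text \<open>Both sides sum over all ways of cutting a path into three pieces, at positions \<open>i \<le> j\<close>.\<close>

lemma PA_mult_assoc: "(f \<otimes>\<^bsub>PA\<^esub> g) \<otimes>\<^bsub>PA\<^esub> h = f \<otimes>\<^bsub>PA\<^esub> (g \<otimes>\<^bsub>PA\<^esub> h)"
proof (rule ext, clarify)
  fix u :: 'v and p :: "'a list"
  let ?n = "length p"
  define T where "T i j = f (awlast u (take j p), drop j p) * g (awlast u (take i p), drop i (take j p)) * h (u, take i p)" for i j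
  have "((f \<otimes>\<^bsub>PA\<^esub> g) \<otimes>\<^bsub>PA\<^esub> h) (u, p) = (\<Sum>i\<le>?n. \<Sum>l\<le>?n - i. T i (i + l))"
    unfolding PA_simps sum_distrib_right
    by (intro sum.cong) (auto simp: T_def take_add awlast_append drop_take add.commute)
  also have "\<dots> = (\<Sum>(i, l)\<in>Sigma {..?n} (\<lambda>i. {..?n - i}). T i (i + l))"
    by (rule sum.Sigma) auto
  also have "Sigma {..?n} (\<lambda>i. {..?n - i}) = {(i, l). i + l \<le> ?n}" by auto
  also have "(\<Sum>(i, l)\<in>{(i, l). i + l \<le> ?n}. T i (i + l)) = (\<Sum>j\<le>?n. \<Sum>i\<le>j. T i (i + (j - i)))"
    by (rule sum.triangle_reindex_eq)
  also have "\<dots> = (\<Sum>j\<le>?n. \<Sum>i\<le>j. T i j)" by (intro sum.cong) auto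
  also have "\<dots> = (f \<otimes>\<^bsub>PA\<^esub> (g \<otimes>\<^bsub>PA\<^esub> h)) (u, p)"
    unfolding PA_simps sum_distrib_left
    by (intro sum.cong) (auto simp: T_def min.absorb1 min.absorb2 mult.assoc)
  finally show "((f \<otimes>\<^bsub>PA\<^esub> g) \<otimes>\<^bsub>PA\<^esub> h) (u, p) = (f \<otimes>\<^bsub>PA\<^esub> (g \<otimes>\<^bsub>PA\<^esub> h)) (u, p)" .
qed

lemma PA_kalgebra: "kalgebra PA"
proof -
  interpret PA: abelian_group PA
  proof (rule abelian_groupI)
    fix f assume "f \<in> carrier PA"
    then show "\<exists>g\<in>carrier PA. g \<oplus>\<^bsub>PA\<^esub> f = \<zero>\<^bsub>PA\<^esub>"
      by (intro bexI[of _ "(- 1) \<odot>\<^bsub>PA\<^esub> f"] PA_smult_closed) (simp add: PA_simps)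
  next
    show "\<zero>\<^bsub>PA\<^esub> \<in> carrier PA" by (simp add: PA_simps)
  qed (simp_all only: PA_add_closed, simp_all add: PA_simps(3,4) algebra_simps)
  show ?thesis
  proof
    fix f g h and t :: 'k
    show "(f \<oplus>\<^bsub>PA\<^esub> g) \<otimes>\<^bsub>PA\<^esub> h = f \<otimes>\<^bsub>PA\<^esub> h \<oplus>\<^bsub>PA\<^esub> g \<otimes>\<^bsub>PA\<^esub> h"
      "h \<otimes>\<^bsub>PA\<^esub> (f \<oplus>\<^bsub>PA\<^esub> g) = h \<otimes>\<^bsub>PA\<^esub> f \<oplus>\<^bsub>PA\<^esub> h \<otimes>\<^bsub>PA\<^esub> g"
      "(t \<odot>\<^bsub>PA\<^esub> f) \<otimes>\<^bsub>PA\<^esub> g = t \<odot>\<^bsub>PA\<^esub> (f \<otimes>\<^bsub>PA\<^esub> g)"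
      "f \<otimes>\<^bsub>PA\<^esub> (t \<odot>\<^bsub>PA\<^esub> g) = t \<odot>\<^bsub>PA\<^esub> (f \<otimes>\<^bsub>PA\<^esub> g)"
      by (auto simp: PA_simps fun_eq_iff algebra_simps sum.distrib sum_distrib_left)
  qed (simp_all only: PA_mult_closed PA_smult_closed PA_mult_assoc, simp_all add: PA_simps(3,4,5) algebra_simps)
qed

lemma mult_path_elem: "(f \<otimes>\<^bsub>PA\<^esub> path_elem (x, [])) (u, p) = (if u = x then f (u, p) else 0)"
proof -
  have "(f \<otimes>\<^bsub>PA\<^esub> path_elem (x, [])) (u, p) = (\<Sum>i\<le>length p. if i = 0 \<and> u = x then f (u, p) else 0)"
    unfolding PA_simps by (intro sum.cong) (auto simp: path_elem_def)
  also have "\<dots> = (if u = x then f (u, p) else 0)" by (cases "u = x") simp_all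
  finally show ?thesis .
qed

lemma path_elem_mult: "(path_elem (x, []) \<otimes>\<^bsub>PA\<^esub> f) (u, p) = (if awlast u p = x then f (u, p) else 0)"
proof -
  have "(path_elem (x, []) \<otimes>\<^bsub>PA\<^esub> f) (u, p) = (\<Sum>i\<le>length p. if i = length p \<and> awlast u p = x then f (u, p) else 0)"
    unfolding PA_simps
  proof (rule sum.cong[OF refl])
    fix i assume "i \<in> {..length p}"
    then show "path_elem (x, []) (awlast u (take i p), drop i p) * f (u, take i p)
        = (if i = length p \<and> awlast u p = x then f (u, p) else 0)"
      by (cases "i = length p") (simp_all add: path_elem_def)
  qed
  also have "\<dots> = (if awlast u p = x then f (u, p) else 0)" by (cases "awlast u p = x") simp_all
  finally show ?thesis .
qed

lemma path_elem_closed: "x \<in> quiver_paths Q \<Longrightarrow> path_elem x \<in> carrier PA"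
  by (auto simp: PA_simps path_elem_def)

lemma idem_closed [simp]: "x \<in> verts Q \<Longrightarrow> path_elem (x, []) \<in> carrier PA"
  by (simp add: path_elem_closed path_Nil)

lemma PA_finsum: "finite F \<Longrightarrow> g \<in> F \<rightarrow> carrier PA \<Longrightarrow> finsum PA g F = (\<lambda>y. \<Sum>x\<in>F. g x y)"
proof (induction F rule: finite_induct)
  interpret PA: kalgebra PA by (rule PA_kalgebra)
  case empty
  show ?case by (simp add: PA_simps)
next
  interpret PA: kalgebra PA by (rule PA_kalgebra)
  case (insert x F)
  then show ?case by (simp add: PA.finsum_insert Pi_def) (simp add: PA_simps)
qed

lemma PA_complete:
  assumes "f \<in> carrier PA"
  shows "finsum PA (\<lambda>x. path_elem (x, []) \<otimes>\<^bsub>PA\<^esub> f) (verts Q) = f"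
    "finsum PA (\<lambda>x. f \<otimes>\<^bsub>PA\<^esub> path_elem (x, [])) (verts Q) = f"
proof -
  have c: "(\<lambda>x. path_elem (x, []) \<otimes>\<^bsub>PA\<^esub> f) \<in> verts Q \<rightarrow> carrier PA"
    "(\<lambda>x. f \<otimes>\<^bsub>PA\<^esub> path_elem (x, [])) \<in> verts Q \<rightarrow> carrier PA"
    using assms PA_mult_closed by auto
  show "finsum PA (\<lambda>x. path_elem (x, []) \<otimes>\<^bsub>PA\<^esub> f) (verts Q) = f"
    unfolding PA_finsum[OF finite_verts c(1)]
  proof (rule ext, clarify)
    fix u p
    show "(\<Sum>x\<in>verts Q. (path_elem (x, []) \<otimes>\<^bsub>PA\<^esub> f) (u, p)) = f (u, p)"
      using PA_path[OF assms, of "(u, p)"] path_vertices[of u p] finite_verts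
      by (auto simp: path_elem_mult sum.delta')
  qed
  show "finsum PA (\<lambda>x. f \<otimes>\<^bsub>PA\<^esub> path_elem (x, [])) (verts Q) = f"
    unfolding PA_finsum[OF finite_verts c(2)]
  proof (rule ext, clarify)
    fix u p
    show "(\<Sum>x\<in>verts Q. (f \<otimes>\<^bsub>PA\<^esub> path_elem (x, [])) (u, p)) = f (u, p)"
      using PA_path[OF assms, of "(u, p)"] path_vertices[of u p] finite_verts
      by (auto simp: mult_path_elem sum.delta')
  qed
qed

lemma PA_one_closed: "\<one>\<^bsub>PA\<^esub> \<in> carrier PA"
proof -
  have "{x. \<one>\<^bsub>PA\<^esub> x \<noteq> (0 :: 'k)} = (\<lambda>u. (u, [])) ` verts Q" by (auto simp: PA_simps split: if_splits)
  then show ?thesis using finite_verts by (auto simp: PA_simps(1) path_Nil)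
qed

lemma PA_ring: "ring PA"
proof -
  interpret PA: kalgebra PA by (rule PA_kalgebra)
  have one: "\<one>\<^bsub>PA\<^esub> \<otimes>\<^bsub>PA\<^esub> f = f" "f \<otimes>\<^bsub>PA\<^esub> \<one>\<^bsub>PA\<^esub> = f" if f: "f \<in> carrier PA" for f :: "'v \<times> 'a list \<Rightarrow> 'k"
  proof -
    have 1: "\<one>\<^bsub>PA\<^esub> = finsum PA (\<lambda>x. path_elem (x, [])) (verts Q)"
    proof (subst PA_finsum)
      show "\<one>\<^bsub>PA\<^esub> = (\<lambda>y. \<Sum>x\<in>verts Q. path_elem (x, []) y)"
      proof (rule ext, clarify)
        fix u p
        show "\<one>\<^bsub>PA\<^esub> (u, p) = (\<Sum>x\<in>verts Q. path_elem (x, []) (u, p))"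
          using finite_verts by (cases "p = []") (auto simp: PA_simps(6) path_elem_def)
      qed
    qed (use finite_verts in auto)
    show "\<one>\<^bsub>PA\<^esub> \<otimes>\<^bsub>PA\<^esub> f = f"
    proof -
      have "finsum PA (\<lambda>x. path_elem (x, [])) (verts Q) \<otimes>\<^bsub>PA\<^esub> f = finsum PA (\<lambda>x. path_elem (x, []) \<otimes>\<^bsub>PA\<^esub> f) (verts Q)"
        using f finite_verts by (intro PA.finsum_mult_right) auto
      then show ?thesis using PA_complete(1)[OF f] 1 by simp
    qed
    show "f \<otimes>\<^bsub>PA\<^esub> \<one>\<^bsub>PA\<^esub> = f"
    proof -
      have "f \<otimes>\<^bsub>PA\<^esub> finsum PA (\<lambda>x. path_elem (x, [])) (verts Q) = finsum PA (\<lambda>x. f \<otimes>\<^bsub>PA\<^esub> path_elem (x, [])) (verts Q)"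
        using f finite_verts by (intro PA.finsum_mult_left) auto
      then show ?thesis using PA_complete(2)[OF f] 1 by simp
    qed
  qed
  show ?thesis
    by (intro ringI PA.abelian_group_axioms monoidI)
      (auto simp: PA_one_closed one PA.mult_assoc PA.mult_l_distr PA.mult_r_distr)
qed

lemma arrow_ideal_power_iff: "f \<in> arrow_ideal_power Q m \<longleftrightarrow> f \<in> carrier PA \<and> (\<forall>u p. f (u, p) \<noteq> 0 \<longrightarrow> m \<le> length p)"
  by (simp add: arrow_ideal_power_def)

lemma arrow_ideal_power_mult:
  assumes "f \<in> arrow_ideal_power Q l" "g \<in> arrow_ideal_power Q m"
  shows "f \<otimes>\<^bsub>PA\<^esub> g \<in> arrow_ideal_power Q (l + m)"
  unfolding arrow_ideal_power_iff
proof (intro conjI allI impI)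
  show "f \<otimes>\<^bsub>PA\<^esub> g \<in> carrier PA" using assms PA_mult_closed by (simp add: arrow_ideal_power_iff)
  fix u p assume "(f \<otimes>\<^bsub>PA\<^esub> g) (u, p) \<noteq> 0"
  then obtain q r where "p = q @ r" "f (awlast u q, r) \<noteq> 0" "g (u, q) \<noteq> 0" by (rule PA_mult_nonzero)
  then have "l \<le> length r" "m \<le> length q" "p = q @ r" using assms by (simp_all add: arrow_ideal_power_iff)
  then show "l + m \<le> length p" by simp
qed

lemma arrow_ideal_power_0: "arrow_ideal_power Q 0 = carrier PA"
  by (auto simp: arrow_ideal_power_iff)

lemma arrow_ideal_power_antimono:
  "l \<le> m \<Longrightarrow> (arrow_ideal_power Q m :: ('v \<times> 'a list \<Rightarrow> 'k) set) \<subseteq> arrow_ideal_power Q l"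
  unfolding subset_eq Ball_def arrow_ideal_power_iff by (meson le_trans)

lemma arrow_ideal_power_add:
  "f \<in> arrow_ideal_power Q m \<Longrightarrow> g \<in> arrow_ideal_power Q m \<Longrightarrow> f \<oplus>\<^bsub>PA\<^esub> g \<in> arrow_ideal_power Q m"
proof -
  assume f: "f \<in> arrow_ideal_power Q m" and g: "g \<in> arrow_ideal_power Q m"
  have "f y \<noteq> 0 \<or> g y \<noteq> 0" if "f y + g y \<noteq> 0" for y using that by auto
  then show ?thesis using f g PA_add_closed[of f g] unfolding arrow_ideal_power_iff PA_simps(3) by blast
qed

lemma arrow_ideal_power_smult:
  "f \<in> arrow_ideal_power Q m \<Longrightarrow> t \<odot>\<^bsub>PA\<^esub> f \<in> arrow_ideal_power Q m"
  by (auto simp: arrow_ideal_power_iff PA_smult_closed) (auto simp: PA_simps)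

lemma arrow_ideal_power_ksubspace: "ksubspace (arrow_ideal_power Q m) PA"
proof -
  interpret PA: kalgebra PA by (rule PA_kalgebra)
  show ?thesis
    by (rule PA.ksubspaceI)
      (auto simp: arrow_ideal_power_add arrow_ideal_power_smult, auto simp: arrow_ideal_power_iff PA_simps)
qed

lemma arrow_ideal_power_ideal: "ideal (arrow_ideal_power Q m) PA"
proof (rule idealI[OF PA_ring])
  show "subgroup (arrow_ideal_power Q m) (add_monoid PA)"
    using ksubspace_facts(5)[OF arrow_ideal_power_ksubspace] by (simp add: additive_subgroup.a_subgroup)
  show "g \<otimes>\<^bsub>PA\<^esub> f \<in> arrow_ideal_power Q m" "f \<otimes>\<^bsub>PA\<^esub> g \<in> arrow_ideal_power Q m"
    if "f \<in> arrow_ideal_power Q m" "g \<in> carrier PA" for f g :: "'v \<times> 'a list \<Rightarrow> 'k"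
    using arrow_ideal_power_mult[of g 0 f m] arrow_ideal_power_mult[of f m g 0] that
    by (simp_all add: arrow_ideal_power_0)
qed

lemma mult_at_Nil: "(f \<otimes>\<^bsub>PA\<^esub> g) (x, []) = f (x, []) * g (x, [])"
  by (simp add: PA_simps)

lemma ideal_ksubspace:
  assumes "ideal I PA"
  shows "ksubspace I PA"
proof -
  interpret PA: kalgebra PA by (rule PA_kalgebra)
  interpret R: ring PA by (rule PA_ring)
  interpret ideal I PA by fact
  have "t \<odot>\<^bsub>PA\<^esub> f \<in> I" if "f \<in> I" for t f
    using I_l_closed[of f "t \<odot>\<^bsub>PA\<^esub> \<one>\<^bsub>PA\<^esub>"] that PA.scl_mult[of "\<one>\<^bsub>PA\<^esub>" f t] by simp
  then show ?thesis using is_additive_subgroup by (simp add: ksubspace_def)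
qed

end


section \<open>The radical of a bound quiver algebra\<close>

locale bound_quiver = finite_quiver Q K
  for Q :: "('v, 'a) pre_digraph" and K :: "'k::field itself" +
  fixes I :: "('v \<times> 'a list \<Rightarrow> 'k) set" and m :: nat
  assumes I_ideal: "ideal I (path_algebra Q)"
    and I_arrows: "I \<subseteq> arrow_ideal_power Q 1"
    and arrows_I: "arrow_ideal_power Q m \<subseteq> I"
begin

abbreviation "B \<equiv> quot_algebra (path_algebra Q) I"

definition proj :: "('v \<times> 'a list \<Rightarrow> 'k) \<Rightarrow> ('v \<times> 'a list \<Rightarrow> 'k) set" where
  "proj f = I +>\<^bsub>path_algebra Q\<^esub> f"

sublocale PA: kalgebra PA by (rule PA_kalgebra)
sublocale PR: ring PA by (rule PA_ring)
sublocale I: ideal I PA by (rule I_ideal)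

lemma B_carrier: "carrier B = proj ` carrier PA"
  and B_zero: "\<zero>\<^bsub>B\<^esub> = proj \<zero>\<^bsub>PA\<^esub>"
  and B_add: "f \<in> carrier PA \<Longrightarrow> g \<in> carrier PA \<Longrightarrow> proj f \<oplus>\<^bsub>B\<^esub> proj g = proj (f \<oplus>\<^bsub>PA\<^esub> g)"
  and B_smult: "f \<in> carrier PA \<Longrightarrow> t \<odot>\<^bsub>B\<^esub> proj f = proj (t \<odot>\<^bsub>PA\<^esub> f)"
  and B_mult: "f \<in> carrier PA \<Longrightarrow> g \<in> carrier PA \<Longrightarrow> proj f \<otimes>\<^bsub>B\<^esub> proj g = proj (f \<otimes>\<^bsub>PA\<^esub> g)"
  and B_one: "\<one>\<^bsub>B\<^esub> = proj \<one>\<^bsub>PA\<^esub>"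
  and B_kspace: "kspace B"
proof -
  have "ksubspace (carrier PA) PA" by (rule PA.ksubspaceI) auto
  note q = PA.kspace_axioms this ideal_ksubspace[OF I_ideal]
  have upd: "PA\<lparr>carrier := carrier PA\<rparr> = PA" by simp
  show "carrier B = proj ` carrier PA" using quot_carrier[OF q] by (simp add: proj_def)
  show "\<zero>\<^bsub>B\<^esub> = proj \<zero>\<^bsub>PA\<^esub>" using quot_zero[OF q] by (simp add: proj_def)
  show "f \<in> carrier PA \<Longrightarrow> g \<in> carrier PA \<Longrightarrow> proj f \<oplus>\<^bsub>B\<^esub> proj g = proj (f \<oplus>\<^bsub>PA\<^esub> g)"
    using quot_add[OF q] by (simp add: proj_def)
  show "f \<in> carrier PA \<Longrightarrow> t \<odot>\<^bsub>B\<^esub> proj f = proj (t \<odot>\<^bsub>PA\<^esub> f)"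
    using quot_smult[OF q] by (simp add: proj_def)
  show "f \<in> carrier PA \<Longrightarrow> g \<in> carrier PA \<Longrightarrow> proj f \<otimes>\<^bsub>B\<^esub> proj g = proj (f \<otimes>\<^bsub>PA\<^esub> g)"
    using I.rcoset_mult_add by (simp add: quot_algebra_def FactRing_def proj_def)
  show "\<one>\<^bsub>B\<^esub> = proj \<one>\<^bsub>PA\<^esub>" by (simp add: quot_algebra_def FactRing_def proj_def)
  show "kspace B" using quot_kspace[OF q] by simp
qed

lemma B_carrierE:
  assumes "b \<in> carrier B"
  obtains f where "f \<in> carrier PA" "b = proj f"
  using assms by (auto simp: B_carrier)

lemma proj_closed [simp]: "f \<in> carrier PA \<Longrightarrow> proj f \<in> carrier B"
  by (simp add: B_carrier)

lemma proj_eq_iff: "f \<in> carrier PA \<Longrightarrow> g \<in> carrier PA \<Longrightarrow> proj f = proj g \<longleftrightarrow> f \<ominus>\<^bsub>PA\<^esub> g \<in> I"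
  unfolding proj_def by (rule PA.coset_eq_iff[OF I.is_additive_subgroup])

lemma minus_at: "f \<in> carrier PA \<Longrightarrow> g \<in> carrier PA \<Longrightarrow> (f \<ominus>\<^bsub>PA\<^esub> g) y = f y - g y"
  by (simp add: PA.minus_eq flip: PA.scl_minus_one) (simp add: PA_simps)

lemma proj_zero_iff: "f \<in> carrier PA \<Longrightarrow> proj f = \<zero>\<^bsub>B\<^esub> \<longleftrightarrow> f \<in> I"
proof -
  assume f: "f \<in> carrier PA"
  have "f \<ominus>\<^bsub>PA\<^esub> \<zero>\<^bsub>PA\<^esub> = f" using f by (intro ext) (simp add: minus_at, simp add: PA_simps)
  then show ?thesis using f by (simp add: B_zero proj_eq_iff)
qed

sublocale B: kalgebra B
proof (intro kalgebra.intro B_kspace kalgebra_axioms.intro)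
  fix x y z and t :: 'k assume "x \<in> carrier B" "y \<in> carrier B"
  then obtain f g where fg: "f \<in> carrier PA" "g \<in> carrier PA" "x = proj f" "y = proj g" by (auto simp: B_carrier)
  show "x \<otimes>\<^bsub>B\<^esub> y \<in> carrier B" using fg by (simp add: B_mult)
  show "(t \<odot>\<^bsub>B\<^esub> x) \<otimes>\<^bsub>B\<^esub> y = t \<odot>\<^bsub>B\<^esub> (x \<otimes>\<^bsub>B\<^esub> y)" using fg by (simp add: B_mult B_smult PA.scl_mult)
  show "x \<otimes>\<^bsub>B\<^esub> (t \<odot>\<^bsub>B\<^esub> y) = t \<odot>\<^bsub>B\<^esub> (x \<otimes>\<^bsub>B\<^esub> y)" using fg by (simp add: B_mult B_smult PA.mult_scl)
  assume "z \<in> carrier B"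
  then obtain h where h: "h \<in> carrier PA" "z = proj h" by (auto simp: B_carrier)
  show "x \<otimes>\<^bsub>B\<^esub> y \<otimes>\<^bsub>B\<^esub> z = x \<otimes>\<^bsub>B\<^esub> (y \<otimes>\<^bsub>B\<^esub> z)" using fg h by (simp add: B_mult PA.mult_assoc)
  show "(x \<oplus>\<^bsub>B\<^esub> y) \<otimes>\<^bsub>B\<^esub> z = x \<otimes>\<^bsub>B\<^esub> z \<oplus>\<^bsub>B\<^esub> y \<otimes>\<^bsub>B\<^esub> z" using fg h by (simp add: B_mult B_add PA.mult_l_distr)
  show "z \<otimes>\<^bsub>B\<^esub> (x \<oplus>\<^bsub>B\<^esub> y) = z \<otimes>\<^bsub>B\<^esub> x \<oplus>\<^bsub>B\<^esub> z \<otimes>\<^bsub>B\<^esub> y" using fg h by (simp add: B_mult B_add PA.mult_r_distr)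
qed

lemma B_ring: "ring B"
  by (intro ringI B.abelian_group_axioms monoidI)
    (auto simp: B.mult_assoc B.mult_l_distr B.mult_r_distr B_one B_mult B_carrier)

sublocale BR: ring B by (rule B_ring)

definition arrows :: "nat \<Rightarrow> ('v \<times> 'a list \<Rightarrow> 'k) set set" where
  "arrows j = proj ` arrow_ideal_power Q j"

lemma arrows_mem_iff:
  assumes "f \<in> carrier PA"
  shows "proj f \<in> arrows 1 \<longleftrightarrow> f \<in> arrow_ideal_power Q 1"
proof
  assume "proj f \<in> arrows 1"
  then obtain g where g: "g \<in> arrow_ideal_power Q 1" "proj f = proj g" by (auto simp: arrows_def)
  have gP: "g \<in> carrier PA" using g by (simp add: arrow_ideal_power_iff)
  have "f \<ominus>\<^bsub>PA\<^esub> g \<in> arrow_ideal_power Q 1" using g gP assms I_arrows by (auto simp: proj_eq_iff)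
  then have "(f \<ominus>\<^bsub>PA\<^esub> g) \<oplus>\<^bsub>PA\<^esub> g \<in> arrow_ideal_power Q 1" using g arrow_ideal_power_add by blast
  then show "f \<in> arrow_ideal_power Q 1" using assms gP by (simp add: PA.minus_eq PA.a_assoc PA.l_neg)
qed (simp add: arrows_def)

lemma arrows_ideal: "ideal (arrows j) B"
proof (rule idealI[OF B_ring])
  have c: "f \<in> carrier PA" if "f \<in> arrow_ideal_power Q j" for f using that by (simp add: arrow_ideal_power_iff)
  note ap = ksubspace_facts[OF arrow_ideal_power_ksubspace]
  have "ksubspace (arrows j) B"
  proof (rule B.ksubspaceI)
    show "arrows j \<subseteq> carrier B" using c by (auto simp: arrows_def)
    show "\<zero>\<^bsub>B\<^esub> \<in> arrows j" using ap(2) by (auto simp: arrows_def B_zero)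
    show "x \<oplus>\<^bsub>B\<^esub> y \<in> arrows j" if "x \<in> arrows j" "y \<in> arrows j" for x y
      using that ap(3) c by (auto simp: arrows_def B_add)
    show "t \<odot>\<^bsub>B\<^esub> x \<in> arrows j" if "x \<in> arrows j" for t x
      using that ap(4) c by (auto simp: arrows_def B_smult)
  qed
  then show "subgroup (arrows j) (add_monoid B)"
    using ksubspace_facts(5) additive_subgroup.a_subgroup by blast
  fix x b assume "x \<in> arrows j" "b \<in> carrier B"
  then obtain f g where fg: "f \<in> arrow_ideal_power Q j" "x = proj f" "g \<in> carrier PA" "b = proj g"
    by (auto simp: arrows_def B_carrier)
  interpret A: ideal "arrow_ideal_power Q j" PA by (rule arrow_ideal_power_ideal)
  show "b \<otimes>\<^bsub>B\<^esub> x \<in> arrows j" using fg c A.I_l_closed by (auto simp: arrows_def B_mult)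
  show "x \<otimes>\<^bsub>B\<^esub> b \<in> arrows j" using fg c A.I_r_closed by (auto simp: arrows_def B_mult)
qed

lemma arrows_mult:
  assumes "x \<in> arrows j" "y \<in> arrows l"
  shows "x \<otimes>\<^bsub>B\<^esub> y \<in> arrows (j + l)"
proof -
  obtain f g where "f \<in> arrow_ideal_power Q j" "x = proj f" "g \<in> arrow_ideal_power Q l" "y = proj g"
    using assms by (auto simp: arrows_def)
  then show ?thesis
    using arrow_ideal_power_mult[of f j g l] by (auto simp: arrows_def B_mult arrow_ideal_power_iff)
qed

lemma arrows_m: "arrows m = {\<zero>\<^bsub>B\<^esub>}"
proof -
  have "proj f = \<zero>\<^bsub>B\<^esub>" if "f \<in> arrow_ideal_power Q m" for f
  proof -
    have "f \<in> carrier PA" "f \<in> I" using that arrows_I by (auto simp: arrow_ideal_power_iff)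
    then show ?thesis by (rule iffD2[OF proj_zero_iff])
  qed
  moreover have "\<zero>\<^bsub>B\<^esub> \<in> arrows m" using arrows_ideal additive_subgroup.zero_closed ideal.axioms(1) by blast
  ultimately show ?thesis by (auto simp: arrows_def)
qed

lemma left_ideal_eq_carrier:
  assumes "left_ideal L B" "\<one>\<^bsub>B\<^esub> \<in> L"
  shows "L = carrier B"
proof
  show "L \<subseteq> carrier B" using assms additive_subgroup.a_subset by (auto simp: left_ideal_def)
  show "carrier B \<subseteq> L"
  proof
    fix b assume "b \<in> carrier B"
    then have "b \<otimes>\<^bsub>B\<^esub> \<one>\<^bsub>B\<^esub> \<in> L" using assms unfolding left_ideal_def by blast
    then show "b \<in> L" using \<open>b \<in> carrier B\<close> by simp
  qed
qed

text \<open>Otherwise \<open>1 = x + r\<close> with \<open>x\<close> in \<open>L\<close> and \<open>r\<close> in the ideal of arrows.  From \<open>1 = y + s\<close> with \<open>y\<close> in \<open>L\<close>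
  one gets \<open>1 = (y + s x) + s r\<close>, so the remainder can be pushed into ever higher powers of this
  nilpotent ideal, and \<open>1\<close> lies in \<open>L\<close>.\<close>

lemma arrows_subset_maximal:
  assumes L: "maximal_left_ideal L B"
  shows "arrows 1 \<subseteq> L"
proof (rule ccontr)
  assume no: "\<not> arrows 1 \<subseteq> L"
  have Ll: "left_ideal L B" "L \<noteq> carrier B" using L by (auto simp: maximal_left_ideal_def)
  interpret L: additive_subgroup L B using Ll by (simp add: left_ideal_def)
  interpret A: ideal "arrows 1" B by (rule arrows_ideal)
  have LM: "b \<otimes>\<^bsub>B\<^esub> x \<in> L" if "b \<in> carrier B" "x \<in> L" for b x using Ll that by (auto simp: left_ideal_def)
  define S where "S = {x \<oplus>\<^bsub>B\<^esub> r |x r. x \<in> L \<and> r \<in> arrows 1}"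
  have Smem: "x \<oplus>\<^bsub>B\<^esub> r \<in> S" if "x \<in> L" "r \<in> arrows 1" for x r using that by (auto simp: S_def)
  have "ksubspace S B"
  proof (rule B.ksubspaceI)
    show "S \<subseteq> carrier B" by (auto simp: S_def)
    show "\<zero>\<^bsub>B\<^esub> \<in> S" using Smem[OF L.zero_closed A.zero_closed] by simp
    fix y z assume "y \<in> S" "z \<in> S"
    then obtain x r x' r' where *: "y = x \<oplus>\<^bsub>B\<^esub> r" "z = x' \<oplus>\<^bsub>B\<^esub> r'" "x \<in> L" "x' \<in> L" "r \<in> arrows 1" "r' \<in> arrows 1"
      by (auto simp: S_def)
    then have "y \<oplus>\<^bsub>B\<^esub> z = (x \<oplus>\<^bsub>B\<^esub> x') \<oplus>\<^bsub>B\<^esub> (r \<oplus>\<^bsub>B\<^esub> r')" by (simp add: B.a_ac)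
    then show "y \<oplus>\<^bsub>B\<^esub> z \<in> S" using * Smem A.a_closed by simp
  next
    fix t y assume "y \<in> S"
    then obtain x r where *: "y = x \<oplus>\<^bsub>B\<^esub> r" "x \<in> L" "r \<in> arrows 1" by (auto simp: S_def)
    have scl: "t \<odot>\<^bsub>B\<^esub> z = (t \<odot>\<^bsub>B\<^esub> \<one>\<^bsub>B\<^esub>) \<otimes>\<^bsub>B\<^esub> z" if "z \<in> carrier B" for z using that by (simp add: B.scl_mult)
    have "t \<odot>\<^bsub>B\<^esub> y = (t \<odot>\<^bsub>B\<^esub> \<one>\<^bsub>B\<^esub>) \<otimes>\<^bsub>B\<^esub> x \<oplus>\<^bsub>B\<^esub> (t \<odot>\<^bsub>B\<^esub> \<one>\<^bsub>B\<^esub>) \<otimes>\<^bsub>B\<^esub> r"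
      using * by (simp add: B.scl_add scl[symmetric])
    then show "t \<odot>\<^bsub>B\<^esub> y \<in> S" using * LM A.I_l_closed Smem by simp
  qed
  moreover have "b \<otimes>\<^bsub>B\<^esub> y \<in> S" if b: "b \<in> carrier B" and "y \<in> S" for b y
  proof -
    obtain x r where *: "y = x \<oplus>\<^bsub>B\<^esub> r" "x \<in> L" "r \<in> arrows 1" using \<open>y \<in> S\<close> by (auto simp: S_def)
    then show ?thesis using b LM A.I_l_closed Smem by (simp add: B.mult_r_distr)
  qed
  ultimately have S: "left_ideal S B" using ksubspace_facts(5) by (auto simp: left_ideal_def)
  have "L \<subseteq> S"
  proof
    fix y assume "y \<in> L"
    then show "y \<in> S" using Smem[OF _ A.zero_closed, of y] by simp
  qed
  moreover have "arrows 1 \<subseteq> S"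
  proof
    fix y assume y: "y \<in> arrows 1"
    then show "y \<in> S" using Smem[OF L.zero_closed y] A.a_Hcarr[OF y] by simp
  qed
  ultimately have "S = carrier B" using L S no by (auto simp: maximal_left_ideal_def)
  then have "\<one>\<^bsub>B\<^esub> \<in> S" by simp
  then obtain x r where xr: "\<one>\<^bsub>B\<^esub> = x \<oplus>\<^bsub>B\<^esub> r" "x \<in> L" "r \<in> arrows 1" by (auto simp: S_def)
  have "\<exists>y\<in>L. \<exists>s\<in>arrows j. \<one>\<^bsub>B\<^esub> = y \<oplus>\<^bsub>B\<^esub> s" for j
  proof (induction j)
    case 0
    have "\<one>\<^bsub>B\<^esub> \<in> arrows 0" by (simp add: arrows_def arrow_ideal_power_0 B_one)
    then show ?case by (intro bexI[of _ "\<zero>\<^bsub>B\<^esub>"] bexI[of _ "\<one>\<^bsub>B\<^esub>"]) auto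
  next
    case (Suc j)
    then obtain y s where ys: "y \<in> L" "s \<in> arrows j" "\<one>\<^bsub>B\<^esub> = y \<oplus>\<^bsub>B\<^esub> s" by blast
    interpret Aj: ideal "arrows j" B by (rule arrows_ideal)
    have [simp]: "s \<in> carrier B" using ys by simp
    have "s = s \<otimes>\<^bsub>B\<^esub> (x \<oplus>\<^bsub>B\<^esub> r)" using xr(1) by (simp flip: xr(1))
    then have "s = s \<otimes>\<^bsub>B\<^esub> x \<oplus>\<^bsub>B\<^esub> s \<otimes>\<^bsub>B\<^esub> r" using xr by (simp add: B.mult_r_distr)
    then have "\<one>\<^bsub>B\<^esub> = y \<oplus>\<^bsub>B\<^esub> (s \<otimes>\<^bsub>B\<^esub> x \<oplus>\<^bsub>B\<^esub> s \<otimes>\<^bsub>B\<^esub> r)" using ys(3) by simp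
    then have "\<one>\<^bsub>B\<^esub> = (y \<oplus>\<^bsub>B\<^esub> s \<otimes>\<^bsub>B\<^esub> x) \<oplus>\<^bsub>B\<^esub> s \<otimes>\<^bsub>B\<^esub> r" using xr ys by (simp add: B.a_assoc)
    moreover have "y \<oplus>\<^bsub>B\<^esub> s \<otimes>\<^bsub>B\<^esub> x \<in> L" using ys xr LM by simp
    moreover have "s \<otimes>\<^bsub>B\<^esub> r \<in> arrows (Suc j)" using arrows_mult[OF ys(2) xr(3)] by simp
    ultimately show ?case by blast
  qed
  from this[of m] obtain y s where "y \<in> L" "s \<in> arrows m" "\<one>\<^bsub>B\<^esub> = y \<oplus>\<^bsub>B\<^esub> s" by (elim bexE)
  then have "\<one>\<^bsub>B\<^esub> \<in> L" by (simp add: arrows_m)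
  then show False using left_ideal_eq_carrier Ll by blast
qed

text \<open>This is the kernel of the algebra homomorphism to the field that reads off the coefficient of the
  trivial path at \<open>x\<close>; it is well defined on the quotient since \<open>I\<close> contains no trivial paths.\<close>

lemma maximal_left_ideal_at_vertex:
  assumes x: "x \<in> verts Q"
  shows "maximal_left_ideal (proj ` {f \<in> carrier PA. f (x, []) = 0}) B" (is "maximal_left_ideal ?M B")
proof -
  have mem: "f (x, []) = 0" if f: "proj f \<in> ?M" "f \<in> carrier PA" for f
  proof -
    obtain g where g: "g \<in> carrier PA" "g (x, []) = 0" "proj f = proj g" using f(1) by blast
    then have "f \<ominus>\<^bsub>PA\<^esub> g \<in> arrow_ideal_power Q 1" using f I_arrows by (auto simp: proj_eq_iff)
    then have "(f \<ominus>\<^bsub>PA\<^esub> g) (x, []) = 0" by (force simp: arrow_ideal_power_iff)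
    then show ?thesis using g f by (simp add: minus_at)
  qed
  have k: "ksubspace ?M B"
  proof (rule B.ksubspaceI)
    show "?M \<subseteq> carrier B" by auto
    show "\<zero>\<^bsub>B\<^esub> \<in> ?M" unfolding B_zero by (intro imageI) (simp add: PA_simps)
    show "a \<oplus>\<^bsub>B\<^esub> b \<in> ?M" if ab: "a \<in> ?M" "b \<in> ?M" for a b
    proof -
      obtain f g where "a = proj f" "b = proj g" "f \<in> carrier PA" "f (x, []) = 0" "g \<in> carrier PA" "g (x, []) = 0"
        using ab by blast
      then show ?thesis by (auto simp: B_add PA_simps(3) intro!: imageI PA_add_closed[unfolded PA_simps(3)])
    qed
    show "t \<odot>\<^bsub>B\<^esub> a \<in> ?M" if a: "a \<in> ?M" for t a
    proof -
      obtain f where "a = proj f" "f \<in> carrier PA" "f (x, []) = 0" using a by blast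
      then show ?thesis by (auto simp: B_smult PA_simps(5) intro!: imageI PA_smult_closed[unfolded PA_simps(5)])
    qed
  qed
  moreover have "b \<otimes>\<^bsub>B\<^esub> a \<in> ?M" if ab: "b \<in> carrier B" "a \<in> ?M" for a b
  proof -
    obtain f g where "a = proj f" "b = proj g" "f \<in> carrier PA" "f (x, []) = 0" "g \<in> carrier PA"
      using ab by (auto simp: B_carrier)
    then show ?thesis by (auto simp: B_mult mult_at_Nil intro!: imageI)
  qed
  ultimately have "left_ideal ?M B" using ksubspace_facts(5) by (auto simp: left_ideal_def)
  moreover have "?M \<noteq> carrier B"
  proof
    assume "?M = carrier B"
    then have "proj \<one>\<^bsub>PA\<^esub> \<in> ?M" by simp
    then have "\<one>\<^bsub>PA\<^esub> (x, []) = (0 :: 'k)" by (rule mem) simp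
    then show False using x by (simp add: PA_simps)
  qed
  moreover have "L = ?M \<or> L = carrier B" if L: "left_ideal L B" "?M \<subseteq> L" for L
  proof (rule disjCI)
    assume "L \<noteq> carrier B"
    interpret L: additive_subgroup L B using L by (simp add: left_ideal_def)
    show "L = ?M"
    proof (rule ccontr)
      assume "L \<noteq> ?M"
      then obtain b where b: "b \<in> L" "b \<notin> ?M" using L by blast
      then obtain f where f: "f \<in> carrier PA" "b = proj f" using L.a_subset by (auto simp: B_carrier)
      then have c: "f (x, []) \<noteq> 0" using b by auto
      let ?t = "inverse (f (x, []))"
      let ?g = "\<one>\<^bsub>PA\<^esub> \<ominus>\<^bsub>PA\<^esub> ?t \<odot>\<^bsub>PA\<^esub> f"
      have "?g (x, []) = 0" using f c x by (simp add: minus_at PR.one_closed) (simp add: PA_simps)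
      then have "proj ?g \<in> L" using L(2) f by auto
      moreover have "?t \<odot>\<^bsub>B\<^esub> \<one>\<^bsub>B\<^esub> \<otimes>\<^bsub>B\<^esub> b \<in> L" using b L(1) by (auto simp: left_ideal_def)
      then have "proj (?t \<odot>\<^bsub>PA\<^esub> f) \<in> L" using f by (simp add: B.scl_mult B_smult)
      ultimately have "proj ?g \<oplus>\<^bsub>B\<^esub> proj (?t \<odot>\<^bsub>PA\<^esub> f) \<in> L" by simp
      then have "\<one>\<^bsub>B\<^esub> \<in> L" using f by (simp add: B_add B_one) (simp add: PA.minus_eq PA.a_assoc PA.l_neg)
      then show False using left_ideal_eq_carrier L(1) \<open>L \<noteq> carrier B\<close> by blast
    qed
  qed
  ultimately show ?thesis by (auto simp: maximal_left_ideal_def)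
qed

theorem jacobson_radical_eq: "jacobson_radical B = arrows 1"
proof
  interpret A: ideal "arrows 1" B by (rule arrows_ideal)
  show "arrows 1 \<subseteq> jacobson_radical B"
    using arrows_subset_maximal A.a_subset by (auto simp: jacobson_radical_def)
  show "jacobson_radical B \<subseteq> arrows 1"
  proof
    fix b assume b: "b \<in> jacobson_radical B"
    then obtain f where f: "f \<in> carrier PA" "b = proj f" by (auto simp: jacobson_radical_def B_carrier)
    have "f (x, []) = 0" if x: "x \<in> verts Q" for x
    proof -
      have "proj f \<in> proj ` {f \<in> carrier PA. f (x, []) = 0}"
        using b f maximal_left_ideal_at_vertex[OF x] by (auto simp: jacobson_radical_def)
      then obtain g where g: "g \<in> carrier PA" "g (x, []) = 0" "proj f = proj g" by auto
      then have "f \<ominus>\<^bsub>PA\<^esub> g \<in> arrow_ideal_power Q 1" using f I_arrows by (auto simp: proj_eq_iff)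
      then have "(f \<ominus>\<^bsub>PA\<^esub> g) (x, []) = 0" by (force simp: arrow_ideal_power_iff)
      then show ?thesis using g f by (simp add: minus_at)
    qed
    moreover have "u \<in> verts Q" if "f (u, p) \<noteq> 0" for u p using PA_path[OF f(1) that] path_vertices by blast
    ultimately have "f \<in> arrow_ideal_power Q 1" using f(1)
      by (auto simp: arrow_ideal_power_iff Suc_le_eq)
    then show "b \<in> arrows 1" using f by (simp add: arrows_def)
  qed
qed

abbreviation "rp \<equiv> radical_power B"

lemma rp_Suc: "rp (Suc j) = rp j \<cdot>\<^bsub>B\<^esub> arrows 1"
  by (simp add: jacobson_radical_eq)

lemma rp_ideal: "ideal (rp j) B"
proof (induction j)
  case 0
  show ?case by (simp add: BR.oneideal)
next
  case (Suc j)
  then show ?case unfolding rp_Suc by (rule BR.ideal_prod_is_ideal[OF _ arrows_ideal])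
qed

lemma rp_decreasing: "rp (Suc j) \<subseteq> rp j"
  unfolding rp_Suc using BR.ideal_prod_inter[OF rp_ideal arrows_ideal] by blast

lemma rp_1: "rp 1 = arrows 1"
proof
  show "rp 1 \<subseteq> arrows 1"
    using BR.ideal_prod_inter[OF rp_ideal[of 0] arrows_ideal[of 1]] rp_Suc[of 0] by simp
  show "arrows 1 \<subseteq> rp 1"
  proof
    interpret A: ideal "arrows 1" B by (rule arrows_ideal)
    fix r assume r: "r \<in> arrows 1"
    then have "\<one>\<^bsub>B\<^esub> \<otimes>\<^bsub>B\<^esub> r \<in> carrier B \<cdot>\<^bsub>B\<^esub> arrows 1" by (intro ideal_prod.prod) auto
    then show "r \<in> rp 1" using r by (simp add: jacobson_radical_eq)
  qed
qed

lemma rp_mult: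
  assumes a: "a \<in> rp j"
  shows "b \<in> rp l \<Longrightarrow> a \<otimes>\<^bsub>B\<^esub> b \<in> rp (j + l)"
proof (induction l arbitrary: b)
  case 0
  interpret ideal "rp j" B by (rule rp_ideal)
  show ?case using 0 a by (simp add: I_r_closed)
next
  case (Suc l)
  interpret j: ideal "rp j" B by (rule rp_ideal)
  interpret l: ideal "rp l" B by (rule rp_ideal)
  interpret A: ideal "arrows 1" B by (rule arrows_ideal)
  have aB: "a \<in> carrier B" using a by simp
  have "b \<in> rp l \<cdot>\<^bsub>B\<^esub> arrows 1" using Suc.prems rp_Suc by simp
  then have "b \<in> carrier B \<and> a \<otimes>\<^bsub>B\<^esub> b \<in> rp (j + l) \<cdot>\<^bsub>B\<^esub> arrows 1"
  proof (induction b rule: ideal_prod.induct)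
    case (prod p q)
    then have "a \<otimes>\<^bsub>B\<^esub> p \<otimes>\<^bsub>B\<^esub> q \<in> rp (j + l) \<cdot>\<^bsub>B\<^esub> arrows 1" using Suc.IH by (intro ideal_prod.prod) auto
    then show ?case using prod aB by (simp add: B.mult_assoc)
  next
    case (sum p q)
    then show ?case using aB by (simp add: B.mult_r_distr ideal_prod.sum)
  qed
  then show ?case using rp_Suc[of "j + l"] by simp
qed

lemma rp_subset_arrows: "rp j \<subseteq> arrows j"
proof (induction j)
  case 0
  show ?case by (simp add: arrows_def arrow_ideal_power_0 B_carrier)
next
  case (Suc j)
  interpret A: ideal "arrows (Suc j)" B by (rule arrows_ideal)
  show ?case
  proof
    fix b assume "b \<in> rp (Suc j)"
    then have "b \<in> rp j \<cdot>\<^bsub>B\<^esub> arrows 1" by (simp only: rp_Suc)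
    then show "b \<in> arrows (Suc j)"
    proof (induction b rule: ideal_prod.induct)
      case (prod p q)
      then show ?case using arrows_mult[of p j q 1] Suc.IH by auto
    next
      case (sum p q)
      then show ?case by simp
    qed
  qed
qed

lemma rp_nilpotency_degree: "rp (nilpotency_degree B) = {\<zero>\<^bsub>B\<^esub>}"
  unfolding nilpotency_degree_def
proof (rule LeastI)
  interpret ideal "rp m" B by (rule rp_ideal)
  show "rp m = {\<zero>\<^bsub>B\<^esub>}" using rp_subset_arrows[of m] arrows_m by auto
qed

lemma rp_ksubspace: "ksubspace (rp j) B"
proof -
  interpret ideal "rp j" B by (rule rp_ideal)
  have "t \<odot>\<^bsub>B\<^esub> b \<in> rp j" if "b \<in> rp j" for t b
    using I_l_closed[of b "t \<odot>\<^bsub>B\<^esub> \<one>\<^bsub>B\<^esub>"] that by (simp add: B.scl_mult)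
  then show ?thesis using is_additive_subgroup by (simp add: ksubspace_def)
qed

definition idm :: "'v \<Rightarrow> ('v \<times> 'a list \<Rightarrow> 'k) set" where
  "idm x = proj (path_elem (x, []))"

lemma idm_closed: "x \<in> verts Q \<Longrightarrow> idm x \<in> carrier B"
  by (simp add: idm_def)

lemma idm_notin_radical:
  assumes "x \<in> verts Q"
  shows "idm x \<notin> rp 1"
proof
  assume "idm x \<in> rp 1"
  then have "(path_elem (x, []) :: _ \<Rightarrow> 'k) \<in> arrow_ideal_power Q 1"
    using arrows_mem_iff[OF idem_closed[OF assms]] by (simp only: rp_1 idm_def)
  moreover have "path_elem (x, []) (x, []) \<noteq> (0 :: 'k)" by (simp add: path_elem_def)
  ultimately have "1 \<le> length ([] :: 'a list)" unfolding arrow_ideal_power_iff by blast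
  then show False by simp
qed

lemma corner_proj:
  assumes "f \<in> carrier PA" "x \<in> verts Q" "y \<in> verts Q"
  shows "idm y \<otimes>\<^bsub>B\<^esub> proj f \<otimes>\<^bsub>B\<^esub> idm x = proj (\<lambda>(u, p). if u = x \<and> awlast u p = y then f (u, p) else 0)"
    and "(\<lambda>(u, p). if u = x \<and> awlast u p = y then f (u, p) else 0) \<in> carrier PA"
proof -
  have eq: "path_elem (y, []) \<otimes>\<^bsub>PA\<^esub> f \<otimes>\<^bsub>PA\<^esub> path_elem (x, [])
      = (\<lambda>(u, p). if u = x \<and> awlast u p = y then f (u, p) else 0)"
    by (auto simp: fun_eq_iff mult_path_elem path_elem_mult)
  show "idm y \<otimes>\<^bsub>B\<^esub> proj f \<otimes>\<^bsub>B\<^esub> idm x = proj (\<lambda>(u, p). if u = x \<and> awlast u p = y then f (u, p) else 0)"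
    using assms by (simp add: idm_def B_mult flip: eq)
  show "(\<lambda>(u, p). if u = x \<and> awlast u p = y then f (u, p) else 0) \<in> carrier PA"
    using assms by (simp flip: eq)
qed

lemma idm_off_diagonal:
  assumes "x \<in> verts Q" "y \<in> verts Q" "x \<noteq> y" "b \<in> carrier B"
  shows "idm y \<otimes>\<^bsub>B\<^esub> b \<otimes>\<^bsub>B\<^esub> idm x \<in> rp 1"
proof -
  obtain f where f: "f \<in> carrier PA" "b = proj f" using assms(4) by (rule B_carrierE)
  have "(\<lambda>(u, p). if u = x \<and> awlast u p = y then f (u, p) else 0) \<in> arrow_ideal_power Q 1"
    using corner_proj(2)[OF f(1) assms(1,2)] assms(3)
    by (auto simp: arrow_ideal_power_iff Suc_le_eq split: if_splits)
  then show ?thesis unfolding f(2) corner_proj(1)[OF f(1) assms(1,2)] rp_1 arrows_def by (rule imageI)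
qed

lemma idm_diagonal:
  assumes "x \<in> verts Q" "b \<in> carrier B"
  shows "\<exists>t. \<exists>w\<in>rp 1. idm x \<otimes>\<^bsub>B\<^esub> b \<otimes>\<^bsub>B\<^esub> idm x = t \<odot>\<^bsub>B\<^esub> idm x \<oplus>\<^bsub>B\<^esub> w"
proof -
  obtain f where f: "f \<in> carrier PA" "b = proj f" using assms(2) by (rule B_carrierE)
  let ?g = "\<lambda>(u, p). if u = x \<and> awlast u p = x then f (u, p) else 0"
  let ?t = "f (x, [])"
  let ?w = "?g \<ominus>\<^bsub>PA\<^esub> ?t \<odot>\<^bsub>PA\<^esub> path_elem (x, [])"
  have g: "?g \<in> carrier PA" by (rule corner_proj(2)[OF f(1) assms(1,1)])
  have c: "?t \<odot>\<^bsub>PA\<^esub> path_elem (x, []) \<in> carrier PA" using assms by (intro PA.scl_closed) simp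
  have w: "?w \<in> carrier PA" using g c by (rule PA.minus_closed)
  have val: "?w (u, p) = ?g (u, p) - ?t * path_elem (x, []) (u, p)" for u p
    using minus_at[OF g c] by (simp add: PA_simps(5))
  have "?w \<in> arrow_ideal_power Q 1"
    using w unfolding arrow_ideal_power_iff val by (auto simp: path_elem_def Suc_le_eq split: if_splits)
  moreover have "?g = ?t \<odot>\<^bsub>PA\<^esub> path_elem (x, []) \<oplus>\<^bsub>PA\<^esub> ?w"
  proof
    fix y :: "'v \<times> 'a list"
    obtain u p where y: "y = (u, p)" by (rule prod.exhaust)
    show "?g y = (?t \<odot>\<^bsub>PA\<^esub> path_elem (x, []) \<oplus>\<^bsub>PA\<^esub> ?w) y"
      unfolding y by (simp only: PA_simps(3) val) (simp add: PA_simps(5))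
  qed
  then have "proj ?g = ?t \<odot>\<^bsub>B\<^esub> idm x \<oplus>\<^bsub>B\<^esub> proj ?w"
    using w assms by (simp add: idm_def B_smult B_add)
  ultimately show ?thesis unfolding f(2) corner_proj(1)[OF f(1) assms(1,1)] rp_1 arrows_def by blast
qed

lemma bound_quiver_filtered_algebra:
  assumes "verts Q \<noteq> {}"
  shows "filtered_algebra B (verts Q) idm"
proof
  fix j l a b
  show "ksubspace (rp j) B" by (rule rp_ksubspace)
  show "rp (Suc j) \<subseteq> rp j" by (rule rp_decreasing)
  show "a \<otimes>\<^bsub>B\<^esub> b \<in> rp (j + l)" if "a \<in> rp j" "b \<in> rp l" using that by (rule rp_mult)
  show "rp (nilpotency_degree B) = {\<zero>\<^bsub>B\<^esub>}" by (rule rp_nilpotency_degree)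
  show "finite (verts Q)" by (rule finite_verts)
  show "0 < nilpotency_degree B"
  proof (rule ccontr)
    assume "\<not> 0 < nilpotency_degree B"
    then have 0: "carrier B = {\<zero>\<^bsub>B\<^esub>}" using rp_nilpotency_degree by simp
    obtain x where x: "x \<in> verts Q" using assms by blast
    have "idm x = \<zero>\<^bsub>B\<^esub>" using 0 idm_closed[OF x] by blast
    then show False using idm_notin_radical[OF x] ksubspace_facts(2)[OF rp_ksubspace[of 1]] by metis
  qed
next
  fix x y assume x: "x \<in> verts Q"
  show "idm x \<in> carrier B" by (rule idm_closed[OF x])
  have "path_elem (x, []) \<otimes>\<^bsub>PA\<^esub> path_elem (x, []) = (path_elem (x, []) :: _ \<Rightarrow> 'k)"
    by (rule ext, clarify, simp only: mult_path_elem) (simp add: path_elem_def)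
  then show "idm x \<otimes>\<^bsub>B\<^esub> idm x = idm x" using x by (simp add: idm_def B_mult)
  assume "y \<in> verts Q" "x \<noteq> y"
  then have "path_elem (x, []) \<otimes>\<^bsub>PA\<^esub> path_elem (y, []) = (\<zero>\<^bsub>PA\<^esub> :: _ \<Rightarrow> 'k)"
    by (intro ext, clarify, simp only: mult_path_elem) (simp add: path_elem_def PA_simps(4))
  then show "idm x \<otimes>\<^bsub>B\<^esub> idm y = \<zero>\<^bsub>B\<^esub>" using x \<open>y \<in> verts Q\<close> by (simp add: idm_def B_mult B_zero)
next
  fix a assume "a \<in> carrier B"
  then obtain f where f: "f \<in> carrier PA" "a = proj f" by (rule B_carrierE)
  have "proj (finsum PA (\<lambda>x. path_elem (x, []) \<otimes>\<^bsub>PA\<^esub> f) (verts Q))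
      = finsum B (\<lambda>x. proj (path_elem (x, []) \<otimes>\<^bsub>PA\<^esub> f)) (verts Q)"
    using f finite_verts
    by (intro finsum_hom[where h = proj and G = PA and H = B])
      (auto simp: PA.abelian_group_axioms B.abelian_group_axioms B_add)
  also have "\<dots> = finsum B (\<lambda>x. idm x \<otimes>\<^bsub>B\<^esub> a) (verts Q)"
    using f by (intro B.finsum_cong') (auto simp: idm_def B_mult)
  finally show "finsum B (\<lambda>x. idm x \<otimes>\<^bsub>B\<^esub> a) (verts Q) = a" using PA_complete(1)[OF f(1)] f(2) by simp
  have "proj (finsum PA (\<lambda>x. f \<otimes>\<^bsub>PA\<^esub> path_elem (x, [])) (verts Q))
      = finsum B (\<lambda>x. proj (f \<otimes>\<^bsub>PA\<^esub> path_elem (x, []))) (verts Q)"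
    using f finite_verts
    by (intro finsum_hom[where h = proj and G = PA and H = B])
      (auto simp: PA.abelian_group_axioms B.abelian_group_axioms B_add)
  also have "\<dots> = finsum B (\<lambda>x. a \<otimes>\<^bsub>B\<^esub> idm x) (verts Q)"
    using f by (intro B.finsum_cong') (auto simp: idm_def B_mult)
  finally show "finsum B (\<lambda>x. a \<otimes>\<^bsub>B\<^esub> idm x) (verts Q) = a" using PA_complete(2)[OF f(1)] f(2) by simp
qed

end


section \<open>Attaching an arrow to every vertex\<close>

lemma tilde_quiver_simps [simp]:
  "verts (tilde_quiver Q) = Old ` verts Q \<union> Tilde ` verts Q"
  "arcs (tilde_quiver Q) = OldArr ` arcs Q \<union> Alpha ` verts Q"
  "tail (tilde_quiver Q) (OldArr a) = Old (tail Q a)" "tail (tilde_quiver Q) (Alpha k) = Old k"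
  "head (tilde_quiver Q) (OldArr a) = Old (head Q a)" "head (tilde_quiver Q) (Alpha k) = Tilde k"
  by (simp_all add: tilde_quiver_def)

lemma (in fin_digraph) tilde_quiver_fin_digraph: "fin_digraph (tilde_quiver G)"
  by unfold_locales auto

lemma inj_old_path: "inj old_path"
  by (rule injI) (auto simp: old_path_def inj_map_eq_map inj_def)

lemma old_elem_old_path [simp]: "old_elem f (old_path x) = f x"
  by (simp add: old_elem_def inv_into_f_f[OF inj_old_path])

lemma old_elem_map [simp]: "old_elem f (Old u, map OldArr p) = f (u, p)"
  using old_elem_old_path[of f "(u, p)"] by (simp add: old_path_def)

lemma old_elem_nonzero:
  assumes "old_elem f y \<noteq> 0"
  obtains u p where "y = (Old u, map OldArr p)" "f (u, p) \<noteq> 0"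
proof -
  obtain x where "y = old_path x" using assms by (auto simp: old_elem_def split: if_splits)
  then show thesis using assms that[of "fst x" "snd x"] by (simp add: old_path_def split_beta)
qed

locale tilde_bound_quiver = finite_quiver Q K
  for Q :: "('v, 'a) pre_digraph" and K :: "'k::field itself" +
  fixes R :: "('v \<times> 'a list \<Rightarrow> 'k) set" and m :: nat
  assumes R_carrier: "R \<subseteq> carrier PA"
    and R_arrows: "R \<subseteq> arrow_ideal_power Q 1"
    and arrows_R: "arrow_ideal_power Q m \<subseteq> Idl\<^bsub>PA\<^esub> R"
begin

abbreviation "TQ \<equiv> tilde_quiver Q"

sublocale T: finite_quiver TQ K
  using tilde_quiver_fin_digraph by (simp add: finite_quiver_def)

definition TI :: "('v tvert \<times> ('v, 'a) tarr list \<Rightarrow> 'k) set" where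
  "TI = Idl\<^bsub>T.PA\<^esub> (old_elem ` R)"

lemma tilde_awlast: "T.awlast (Old u) (map OldArr p) = Old (awlast u p)"
  by (induction p arbitrary: u) auto

lemma tilde_cas: "T.cas (Old u) (map OldArr p) (Old v) = cas u p v"
  by (induction p arbitrary: u) auto

lemma single_path: "(u, [a]) \<in> quiver_paths Q \<longleftrightarrow> a \<in> arcs Q \<and> tail Q a = u"
  by (auto simp: quiver_paths_def awalk_def)

lemma tilde_single_path: "(u, [a]) \<in> quiver_paths TQ \<longleftrightarrow> a \<in> arcs TQ \<and> tail TQ a = u"
  by (auto simp: quiver_paths_def T.awalk_def)

lemma tilde_path_old: "(u, p) \<in> quiver_paths Q \<Longrightarrow> (Old u, map OldArr p) \<in> quiver_paths TQ"
proof -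
  assume "(u, p) \<in> quiver_paths Q"
  then obtain v where "u \<in> verts Q" "set p \<subseteq> arcs Q" "cas u p v" by (auto simp: quiver_paths_def awalk_def)
  then have "T.awalk (Old u) (map OldArr p) (Old v)" by (auto simp: T.awalk_def tilde_cas)
  then show ?thesis by (auto simp: quiver_paths_def)
qed

lemma tilde_path_cases:
  assumes "(w, p) \<in> quiver_paths TQ"
  shows "(\<exists>k. w = Tilde k \<and> p = []) \<or> (\<exists>u q. w = Old u \<and> (u, q) \<in> quiver_paths Q \<and>
           (p = map OldArr q \<or> p = map OldArr q @ [Alpha (awlast u q)]))"
  using assms
proof (induction p rule: rev_induct)
  case Nil
  then show ?case by (auto simp: T.path_Nil path_Nil)
next
  case (snoc a p)
  then have p: "(w, p) \<in> quiver_paths TQ" and a: "a \<in> arcs TQ" "tail TQ a = T.awlast w p"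
    by (simp_all add: T.path_append tilde_single_path)
  from snoc.IH[OF p] show ?case
  proof (elim disjE exE conjE)
    fix k assume "w = Tilde k" "p = []"
    then show ?thesis using a by auto
  next
    fix u q assume *: "w = Old u" "(u, q) \<in> quiver_paths Q" "p = map OldArr q"
    show ?thesis
    proof (cases a)
      case (OldArr b)
      then have "(u, q @ [b]) \<in> quiver_paths Q" using a * by (auto simp: path_append single_path tilde_awlast)
      then show ?thesis using * OldArr by (intro disjI2 exI[of _ u] exI[of _ "q @ [b]"]) simp
    next
      case (Alpha k)
      then show ?thesis using a * by (auto simp: tilde_awlast)
    qed
  next
    fix u q assume *: "w = Old u" "p = map OldArr q @ [Alpha (awlast u q)]"
    have "T.awlast w p = Tilde (awlast u q)" using * by (simp add: T.awlast_append)
    then show ?thesis using a by auto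
  qed
qed

lemma tilde_sink: "(Tilde k, p) \<in> quiver_paths TQ \<Longrightarrow> p = []"
  using tilde_path_cases by blast

lemma old_elem_closed:
  assumes f: "f \<in> carrier PA"
  shows "old_elem f \<in> carrier T.PA"
proof -
  have "{y. old_elem f y \<noteq> 0} \<subseteq> old_path ` {x. f x \<noteq> 0}"
    by (auto elim!: old_elem_nonzero simp: old_path_def image_iff)
  moreover have "finite (old_path ` {x. f x \<noteq> 0})" using f by (simp add: PA_simps)
  ultimately have "finite {y. old_elem f y \<noteq> 0}" by (rule finite_subset)
  moreover have "y \<in> quiver_paths TQ" if "old_elem f y \<noteq> 0" for y
    using that by (elim old_elem_nonzero) (auto intro: tilde_path_old PA_path[OF f])
  ultimately show ?thesis by (auto simp: T.PA_simps(1))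
qed

lemma old_elem_add: "old_elem (f \<oplus>\<^bsub>PA\<^esub> g) = old_elem f \<oplus>\<^bsub>T.PA\<^esub> old_elem g"
  by (auto simp: fun_eq_iff old_elem_def PA_simps(3) T.PA_simps(3))

lemma old_elem_smult: "old_elem (t \<odot>\<^bsub>PA\<^esub> f) = t \<odot>\<^bsub>T.PA\<^esub> old_elem f"
  by (auto simp: fun_eq_iff old_elem_def PA_simps(5) T.PA_simps(5))

lemma old_elem_mult: "old_elem (f \<otimes>\<^bsub>PA\<^esub> g) = old_elem f \<otimes>\<^bsub>T.PA\<^esub> old_elem g"
proof
  fix y :: "'v tvert \<times> ('v, 'a) tarr list"
  show "old_elem (f \<otimes>\<^bsub>PA\<^esub> g) y = (old_elem f \<otimes>\<^bsub>T.PA\<^esub> old_elem g) y"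
  proof (cases "y \<in> range old_path")
    case True
    then obtain u p where y: "y = (Old u, map OldArr p)" by (auto simp: old_path_def)
    show ?thesis unfolding y
      by (simp add: PA_simps(2) T.PA_simps(2) take_map drop_map tilde_awlast)
  next
    case False
    obtain w p where y: "y = (w, p)" by (rule prod.exhaust)
    have "(old_elem f \<otimes>\<^bsub>T.PA\<^esub> old_elem g) y = 0"
    proof (rule ccontr)
      assume "(old_elem f \<otimes>\<^bsub>T.PA\<^esub> old_elem g) y \<noteq> 0"
      then obtain q r where qr: "p = q @ r" "old_elem f (T.awlast w q, r) \<noteq> 0" "old_elem g (w, q) \<noteq> 0"
        unfolding y by (rule T.PA_mult_nonzero)
      then obtain u q' v r' where "w = Old u" "q = map OldArr q'" "r = map OldArr r'"
        by (auto elim!: old_elem_nonzero)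
      then have "y = old_path (u, q' @ r')" using qr(1) by (simp add: y old_path_def)
      then show False using False by blast
    qed
    then show ?thesis using False by (simp add: old_elem_def)
  qed
qed

sublocale TP: kalgebra T.PA by (rule T.PA_kalgebra)
sublocale TR: ring T.PA by (rule T.PA_ring)
sublocale PR: ring PA by (rule PA_ring)

lemma old_R_carrier: "old_elem ` R \<subseteq> carrier T.PA"
  using R_carrier old_elem_closed by blast

lemma TI_ideal: "ideal TI T.PA"
  unfolding TI_def by (rule TR.genideal_ideal[OF old_R_carrier])

sublocale TI: ideal TI T.PA by (rule TI_ideal)

lemma TI_ksubspace: "ksubspace TI T.PA"
  by (rule T.ideal_ksubspace[OF TI_ideal])

lemma old_elem_Idl:
  assumes "f \<in> Idl\<^bsub>PA\<^esub> R"
  shows "old_elem f \<in> TI"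
proof -
  interpret P: kalgebra PA by (rule PA_kalgebra)
  note TIf = ksubspace_facts[OF TI_ksubspace]
  have "ideal {f \<in> carrier PA. old_elem f \<in> TI} PA"
  proof (rule idealI[OF PA_ring])
    have "ksubspace {f \<in> carrier PA. old_elem f \<in> TI} PA"
    proof (rule P.ksubspaceI)
      have "old_elem \<zero>\<^bsub>PA\<^esub> = \<zero>\<^bsub>T.PA\<^esub>" by (simp add: fun_eq_iff old_elem_def PA_simps(4) T.PA_simps(4))
      then show "\<zero>\<^bsub>PA\<^esub> \<in> {f \<in> carrier PA. old_elem f \<in> TI}" using TIf(2) by simp
    qed (use TIf in \<open>auto simp: old_elem_add old_elem_smult\<close>)
    then show "subgroup {f \<in> carrier PA. old_elem f \<in> TI} (add_monoid PA)"
      using ksubspace_facts(5) additive_subgroup.a_subgroup by blast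
  qed (auto simp: old_elem_mult old_elem_closed TI.I_l_closed TI.I_r_closed)
  moreover have "R \<subseteq> {f \<in> carrier PA. old_elem f \<in> TI}"
    using R_carrier TR.genideal_self[OF old_R_carrier] by (auto simp: TI_def)
  ultimately have "Idl\<^bsub>PA\<^esub> R \<subseteq> {f \<in> carrier PA. old_elem f \<in> TI}" by (rule PR.genideal_minimal)
  then show ?thesis using assms by blast
qed

lemma TI_arrows: "TI \<subseteq> arrow_ideal_power TQ 1"
  unfolding TI_def
proof (rule TR.genideal_minimal[OF T.arrow_ideal_power_ideal])
  show "old_elem ` R \<subseteq> arrow_ideal_power TQ 1"
  proof (clarify)
    fix f assume f: "f \<in> R"
    then have "f \<in> arrow_ideal_power Q 1" using R_arrows by blast
    then show "old_elem f \<in> arrow_ideal_power TQ 1"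
      using f R_carrier old_elem_closed unfolding T.arrow_ideal_power_iff arrow_ideal_power_iff
      by (auto elim!: old_elem_nonzero)
  qed
qed

text \<open>Such a path consists of an old path of length at least \<open>m\<close>, which is zero modulo the relations
  already in the old quiver, possibly followed by an attached arrow.\<close>

lemma long_path_TI:
  assumes x: "x \<in> quiver_paths TQ" "Suc m \<le> length (snd x)"
  shows "path_elem x \<in> TI"
proof -
  obtain w p where wp: "x = (w, p)" by (rule prod.exhaust)
  have old: "path_elem (Old u, map OldArr q) \<in> TI" if q: "(u, q) \<in> quiver_paths Q" "m \<le> length q" for u q
  proof -
    have "(path_elem (u, q) :: _ \<Rightarrow> 'k) \<in> arrow_ideal_power Q m"
      using path_elem_closed[OF q(1)] q(2) by (auto simp: arrow_ideal_power_iff path_elem_def split: if_splits)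
    then have "old_elem (path_elem (u, q) :: _ \<Rightarrow> 'k) \<in> TI" using arrows_R old_elem_Idl by blast
    moreover have "old_elem (path_elem (u, q)) = (path_elem (Old u, map OldArr q) :: _ \<Rightarrow> 'k)"
    proof
      fix y
      have q: "(Old u, map OldArr q) = old_path (u, q)" by (simp add: old_path_def)
      show "old_elem (path_elem (u, q)) y = (path_elem (Old u, map OldArr q) y :: 'k)"
      proof (cases "y \<in> range old_path")
        case True
        then show ?thesis using inj_old_path unfolding q by (auto simp: path_elem_def inj_eq)
      next
        case False
        then show ?thesis unfolding q by (auto simp: path_elem_def old_elem_def)
      qed
    qed
    ultimately show ?thesis by simp
  qed
  from tilde_path_cases[OF x(1)[unfolded wp]] show ?thesis
  proof (elim disjE exE conjE)
    fix k assume "w = Tilde k" "p = []"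
    then show ?thesis using x(2) wp by simp
  next
    fix u q assume "w = Old u" "(u, q) \<in> quiver_paths Q" "p = map OldArr q"
    then show ?thesis using old x(2) wp by simp
  next
    fix u q assume q: "w = Old u" "(u, q) \<in> quiver_paths Q" "p = map OldArr q @ [Alpha (awlast u q)]"
    let ?k = "awlast u q"
    have "?k \<in> verts Q" using path_vertices q by blast
    then have a: "path_elem (Old ?k, [Alpha ?k]) \<in> carrier T.PA"
      by (intro T.path_elem_closed) (simp add: tilde_single_path)
    have "path_elem (Old ?k, [Alpha ?k]) \<otimes>\<^bsub>T.PA\<^esub> path_elem (Old u, map OldArr q) = (path_elem x :: _ \<Rightarrow> 'k)"
    proof (rule ext, clarify)
      fix v r
      have "(path_elem (Old ?k, [Alpha ?k]) \<otimes>\<^bsub>T.PA\<^esub> path_elem (Old u, map OldArr q)) (v, r)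
          = (\<Sum>i\<le>length r. if i = length q then (path_elem x (v, r) :: 'k) else 0)"
        unfolding T.PA_simps(2)
      proof (rule sum.cong[OF refl])
        fix i assume i: "i \<in> {..length r}"
        have "take i r = map OldArr q \<longleftrightarrow> i = length q \<and> take i r = map OldArr q"
          using i by (auto dest: arg_cong[where f = length])
        moreover have "r = p \<longleftrightarrow> take (length q) r = map OldArr q \<and> drop (length q) r = [Alpha ?k]"
          using q(3) append_eq_conv_conj[of "map OldArr q" "[Alpha ?k]" r] by auto
        ultimately show "path_elem (Old ?k, [Alpha ?k]) (T.awlast v (take i r), drop i r)
            * path_elem (Old u, map OldArr q) (v, take i r) = (if i = length q then (path_elem x (v, r) :: 'k) else 0)"
          using q(1) by (auto simp: path_elem_def wp tilde_awlast)
      qed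
      also have "\<dots> = path_elem x (v, r)" using q(3) by (auto simp: path_elem_def wp)
      finally show "(path_elem (Old ?k, [Alpha ?k]) \<otimes>\<^bsub>T.PA\<^esub> path_elem (Old u, map OldArr q)) (v, r)
          = (path_elem x (v, r) :: 'k)" .
    qed
    moreover have "path_elem (Old u, map OldArr q) \<in> TI" using old[OF q(2)] x(2) wp q(3) by simp
    ultimately show ?thesis using TI.I_l_closed[OF _ a] by metis
  qed
qed

lemma arrows_TI: "arrow_ideal_power TQ (Suc m) \<subseteq> TI"
proof
  fix f :: "_ \<Rightarrow> 'k" assume f: "f \<in> arrow_ideal_power TQ (Suc m)"
  then have long: "Suc m \<le> length (snd x)" if "f x \<noteq> 0" for x
    using that by (cases x) (auto simp: T.arrow_ideal_power_iff)
  have fP: "f \<in> carrier T.PA" using f by (simp add: T.arrow_ideal_power_iff)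
  let ?S = "{x. f x \<noteq> 0}"
  have fin: "finite ?S" using fP by (simp add: T.PA_simps)
  let ?g = "\<lambda>x. f x \<odot>\<^bsub>T.PA\<^esub> path_elem x"
  have TI: "?g x \<in> TI" if "x \<in> ?S" for x
    using that long_path_TI[OF T.PA_path[OF fP] long] ksubspace_facts(4)[OF TI_ksubspace] by auto
  have "finsum T.PA ?g ?S = (\<lambda>y. \<Sum>x\<in>?S. ?g x y)"
    using fin TI by (intro T.PA_finsum) auto
  also have "\<dots> = f"
  proof
    fix y
    have "(\<Sum>x\<in>?S. ?g x y) = (\<Sum>x\<in>?S. if x = y then f y else 0)"
      by (intro sum.cong) (auto simp: T.PA_simps(5) path_elem_def)
    then show "(\<Sum>x\<in>?S. ?g x y) = f y" using fin by simp
  qed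
  finally show "f \<in> TI" using TP.finsum_in_subgroup[OF TI.is_additive_subgroup fin, of ?g] TI by simp
qed

text \<open>On paths that end at \<open>k\<close>, this undoes the multiplication by \<open>\<alpha>\<^sub>k\<close> from the left: paths that end in \<open>\<alpha>\<^sub>k\<close> lose
  this arrow, all others are sent to zero.\<close>

definition strip :: "'v \<Rightarrow> ('v tvert \<times> ('v, 'a) tarr list \<Rightarrow> 'k) \<Rightarrow> 'v tvert \<times> ('v, 'a) tarr list \<Rightarrow> 'k" where
  "strip k f = (\<lambda>(u, p). f (u, p @ [Alpha k]))"

lemma strip_closed:
  assumes f: "f \<in> carrier T.PA"
  shows "strip k f \<in> carrier T.PA"
proof -
  have "{x. strip k f x \<noteq> 0} \<subseteq> (\<lambda>(u, p). (u, butlast p)) ` {x. f x \<noteq> 0}"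
    by (auto simp: strip_def image_iff) (metis butlast_snoc)
  moreover have "finite ((\<lambda>(u, p). (u, butlast p)) ` {x. f x \<noteq> 0})" using f by (simp add: T.PA_simps)
  ultimately have "finite {x. strip k f x \<noteq> 0}" by (rule finite_subset)
  moreover have "x \<in> quiver_paths TQ" if "strip k f x \<noteq> 0" for x
  proof -
    obtain u p where x: "x = (u, p)" by (rule prod.exhaust)
    have "(u, p @ [Alpha k]) \<in> quiver_paths TQ" using that by (intro T.PA_path[OF f]) (simp add: x strip_def)
    then show ?thesis by (simp add: x T.path_append)
  qed
  ultimately show ?thesis by (auto simp: T.PA_simps(1))
qed

text \<open>The second summand collects the terms in which the path is cut behind its last arrow.\<close>

lemma strip_mult:
  "strip k (g \<otimes>\<^bsub>T.PA\<^esub> f) = strip k g \<otimes>\<^bsub>T.PA\<^esub> f \<oplus>\<^bsub>T.PA\<^esub> g (Tilde k, []) \<odot>\<^bsub>T.PA\<^esub> strip k f"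
proof
  fix y :: "'v tvert \<times> ('v, 'a) tarr list"
  obtain u p where y: "y = (u, p)" by (rule prod.exhaust)
  have "strip k (g \<otimes>\<^bsub>T.PA\<^esub> f) (u, p)
      = (\<Sum>i\<le>length p. g (T.awlast u (take i p), drop i p @ [Alpha k]) * f (u, take i p))
        + g (T.awlast u (p @ [Alpha k]), []) * f (u, p @ [Alpha k])"
    by (simp add: strip_def T.PA_simps(2))
  also have "\<dots> = (strip k g \<otimes>\<^bsub>T.PA\<^esub> f \<oplus>\<^bsub>T.PA\<^esub> g (Tilde k, []) \<odot>\<^bsub>T.PA\<^esub> strip k f) (u, p)"
    unfolding T.PA_simps(3,5) T.PA_simps(2) by (simp add: strip_def T.awlast_append)
  finally show "strip k (g \<otimes>\<^bsub>T.PA\<^esub> f) y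
      = (strip k g \<otimes>\<^bsub>T.PA\<^esub> f \<oplus>\<^bsub>T.PA\<^esub> g (Tilde k, []) \<odot>\<^bsub>T.PA\<^esub> strip k f) y" unfolding y .
qed

text \<open>Elements of the ideal \<open>TI\<close> have no trivial paths.  So by \<open>strip_mult\<close> those among them whose
  image under \<open>strip\<close> is in \<open>TI\<close> again form a two-sided ideal.  It contains the relations,
  which are sent to zero since they involve old arrows only.\<close>

lemma strip_TI:
  assumes "f \<in> TI"
  shows "strip k f \<in> TI"
proof -
  note TIf = ksubspace_facts[OF TI_ksubspace]
  have zero: "f (Tilde k, []) = 0" if "f \<in> TI" for f
  proof (rule ccontr)
    assume "f (Tilde k, []) \<noteq> 0"
    moreover have "f \<in> arrow_ideal_power TQ 1" using that TI_arrows by blast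
    ultimately have "1 \<le> length ([] :: ('v, 'a) tarr list)" unfolding T.arrow_ideal_power_iff by blast
    then show False by simp
  qed
  let ?S = "{f \<in> TI. strip k f \<in> TI}"
  have "ideal ?S T.PA"
  proof (rule idealI[OF T.PA_ring])
    have "ksubspace ?S T.PA"
    proof (rule TP.ksubspaceI)
      show "?S \<subseteq> carrier T.PA" by auto
      have "strip k \<zero>\<^bsub>T.PA\<^esub> = \<zero>\<^bsub>T.PA\<^esub>" by (simp add: strip_def T.PA_simps(4) fun_eq_iff)
      then show "\<zero>\<^bsub>T.PA\<^esub> \<in> ?S" using TIf(2) by simp
      show "f \<oplus>\<^bsub>T.PA\<^esub> g \<in> ?S" if "f \<in> ?S" "g \<in> ?S" for f g
      proof -
        have "strip k (f \<oplus>\<^bsub>T.PA\<^esub> g) = strip k f \<oplus>\<^bsub>T.PA\<^esub> strip k g"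
          by (simp add: strip_def T.PA_simps(3) fun_eq_iff)
        then show ?thesis using that TIf(3) by simp
      qed
      show "t \<odot>\<^bsub>T.PA\<^esub> f \<in> ?S" if "f \<in> ?S" for t f
      proof -
        have "strip k (t \<odot>\<^bsub>T.PA\<^esub> f) = t \<odot>\<^bsub>T.PA\<^esub> strip k f"
          by (simp add: strip_def T.PA_simps(5) fun_eq_iff)
        then show ?thesis using that TIf(4) by simp
      qed
    qed
    then show "subgroup ?S (add_monoid T.PA)"
      using ksubspace_facts(5) additive_subgroup.a_subgroup by blast
    fix f g assume f: "f \<in> ?S" and g: "g \<in> carrier T.PA"
    show "g \<otimes>\<^bsub>T.PA\<^esub> f \<in> ?S"
      using f g TIf(3,4) strip_closed by (simp add: strip_mult TI.I_l_closed)
    show "f \<otimes>\<^bsub>T.PA\<^esub> g \<in> ?S"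
      using f g TIf(3,4) strip_closed zero[of f] by (simp add: strip_mult TI.I_r_closed)
  qed
  moreover have "old_elem ` R \<subseteq> ?S"
  proof clarify
    fix f assume "f \<in> R"
    have "strip k (old_elem f) (u, p) = 0" for u p
    proof (rule ccontr)
      assume "strip k (old_elem f) (u, p) \<noteq> 0"
      then have "old_elem f (u, p @ [Alpha k]) \<noteq> 0" by (simp add: strip_def)
      then obtain v q where "p @ [Alpha k] = map OldArr q" by (auto elim!: old_elem_nonzero)
      then have "Alpha k \<in> set (map OldArr q)" by (metis in_set_conv_decomp)
      then show False by auto
    qed
    then have "strip k (old_elem f) = \<zero>\<^bsub>T.PA\<^esub>" by (simp add: fun_eq_iff T.PA_simps(4))
    then show "old_elem f \<in> TI \<and> strip k (old_elem f) \<in> TI"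
      using TIf(2) TR.genideal_self[OF old_R_carrier] \<open>f \<in> R\<close> by (auto simp: TI_def)
  qed
  ultimately have "Idl\<^bsub>T.PA\<^esub> (old_elem ` R) \<subseteq> ?S" by (rule TR.genideal_minimal)
  then show ?thesis using assms unfolding TI_def by blast
qed

sublocale BQ: bound_quiver TQ K TI "Suc m"
  by unfold_locales (rule TI_ideal TI_arrows arrows_TI)+

abbreviation "alpha k \<equiv> path_elem (Old k, [Alpha k]) :: 'v tvert \<times> ('v, 'a) tarr list \<Rightarrow> 'k"

lemma alpha_closed: "k \<in> verts Q \<Longrightarrow> alpha k \<in> carrier T.PA"
  by (intro T.path_elem_closed) (simp add: tilde_single_path)

lemma strip_alpha: "strip k (alpha k) = path_elem (Old k, [])"
  by (auto simp: strip_def path_elem_def fun_eq_iff)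

lemma alpha_radical: "k \<in> verts Q \<Longrightarrow> BQ.proj (alpha k) \<in> radical_power BQ.B 1"
  using alpha_closed[of k] unfolding BQ.rp_1 BQ.arrows_def
  by (intro imageI) (auto simp: T.arrow_ideal_power_iff path_elem_def split: if_splits)

text \<open>This is the isomorphism of \<open>\<alpha>\<^sub>k A\<close> with \<open>e\<^sub>k A\<close>; it holds because no relation involves \<open>\<alpha>\<^sub>k\<close>.\<close>

lemma alpha_cancel:
  assumes "k \<in> verts Q" "f \<in> carrier T.PA" "alpha k \<otimes>\<^bsub>T.PA\<^esub> f \<in> TI"
  shows "path_elem (Old k, []) \<otimes>\<^bsub>T.PA\<^esub> f \<in> TI"
proof -
  have "alpha k (Tilde k, []) = 0" by (simp add: path_elem_def)
  then have "strip k (alpha k \<otimes>\<^bsub>T.PA\<^esub> f) = path_elem (Old k, []) \<otimes>\<^bsub>T.PA\<^esub> f"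
    using assms strip_closed[OF assms(2), of k] by (simp add: strip_mult strip_alpha)
  then show ?thesis using strip_TI[OF assms(3), of k] by simp
qed

lemma nilpotency_degree_ge_2:
  assumes k: "k \<in> verts Q"
  shows "2 \<le> nilpotency_degree BQ.B"
proof (rule ccontr)
  assume "\<not> 2 \<le> nilpotency_degree BQ.B"
  then have "nilpotency_degree BQ.B \<le> 1" by simp
  then have "radical_power BQ.B 1 \<subseteq> radical_power BQ.B (nilpotency_degree BQ.B)"
    by (rule lift_Suc_antimono_le[of "radical_power BQ.B", OF BQ.rp_decreasing])
  then have "BQ.proj (alpha k) = \<zero>\<^bsub>BQ.B\<^esub>"
    using alpha_radical[OF k] BQ.rp_nilpotency_degree by auto
  then have "alpha k \<in> TI" using BQ.proj_zero_iff[OF alpha_closed[OF k]] by simp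
  then have "path_elem (Old k, []) \<in> TI" using strip_TI[of "alpha k" k] by (simp only: strip_alpha)
  then have "(path_elem (Old k, []) :: _ \<Rightarrow> 'k) \<in> arrow_ideal_power TQ 1" using TI_arrows by blast
  moreover have "path_elem (Old k, []) (Old k, []) \<noteq> (0 :: 'k)" by (simp add: path_elem_def)
  ultimately have "1 \<le> length ([] :: ('v, 'a) tarr list)" unfolding T.arrow_ideal_power_iff by blast
  then show False by simp
qed

theorem tilde_second_order_algebra:
  assumes "verts Q \<noteq> {}"
  shows "second_order_algebra BQ.B (verts TQ) BQ.idm (range Tilde) second_gt"
proof -
  interpret F: filtered_algebra BQ.B "verts TQ" BQ.idm
    by (rule BQ.bound_quiver_filtered_algebra) (use assms in auto)
  show ?thesis
  proof
    fix y x :: "'v tvert" and k i :: int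
    show "second_gt (y, k) (x, i) \<longleftrightarrow> k < i \<or> (k = i \<and> y \<in> range Tilde \<and> x \<notin> range Tilde)"
      by (cases x) (auto simp: second_gt_def first_gt_def)
  next
    fix x y a assume "x \<in> verts TQ" "y \<in> verts TQ" "x \<noteq> y" "a \<in> carrier BQ.B"
    then show "BQ.idm y \<otimes>\<^bsub>BQ.B\<^esub> a \<otimes>\<^bsub>BQ.B\<^esub> BQ.idm x \<in> radical_power BQ.B 1"
      by (rule BQ.idm_off_diagonal)
  next
    fix x a assume "x \<in> verts TQ" "a \<in> carrier BQ.B"
    then show "\<exists>t. \<exists>w\<in>radical_power BQ.B 1.
        BQ.idm x \<otimes>\<^bsub>BQ.B\<^esub> a \<otimes>\<^bsub>BQ.B\<^esub> BQ.idm x = t \<odot>\<^bsub>BQ.B\<^esub> BQ.idm x \<oplus>\<^bsub>BQ.B\<^esub> w"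
      by (rule BQ.idm_diagonal)
  next
    fix x assume "x \<in> verts TQ"
    then show "BQ.idm x \<notin> radical_power BQ.B 1" by (rule BQ.idm_notin_radical)
  next
    fix x y a assume *: "x \<in> verts TQ" "y \<in> verts TQ" "x \<notin> range Tilde" "y \<in> range Tilde" "a \<in> carrier BQ.B"
    obtain f where f: "f \<in> carrier T.PA" "a = BQ.proj f" using *(5) by (rule BQ.B_carrierE)
    have "(if u = y \<and> T.awlast u p = x then f (u, p) else 0) = 0" for u p
    proof (rule ccontr)
      assume "(if u = y \<and> T.awlast u p = x then f (u, p) else 0) \<noteq> 0"
      then have "f (u, p) \<noteq> 0" "u = y" "T.awlast u p = x" by (simp_all split: if_splits)
      moreover obtain k where "y = Tilde k" using *(4) by blast
      ultimately show False using tilde_sink[of k p] T.PA_path[OF f(1), of "(u, p)"] *(3) by auto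
    qed
    then have "(\<lambda>(u, p). if u = y \<and> T.awlast u p = x then f (u, p) else 0) = \<zero>\<^bsub>T.PA\<^esub>"
      by (simp add: T.PA_simps(4) fun_eq_iff)
    then show "BQ.idm x \<otimes>\<^bsub>BQ.B\<^esub> a \<otimes>\<^bsub>BQ.B\<^esub> BQ.idm y = \<zero>\<^bsub>BQ.B\<^esub>"
      using BQ.corner_proj(1)[OF f(1) *(2,1)] f(2) by (simp add: BQ.B_zero)
  next
    fix x a assume x: "x \<in> verts TQ" and a: "a \<in> radical_power BQ.B (nilpotency_degree BQ.B - 1)"
    have aB: "a \<in> carrier BQ.B" using a ksubspace_facts(1)[OF BQ.rp_ksubspace] by blast
    show "BQ.idm x \<otimes>\<^bsub>BQ.B\<^esub> a \<otimes>\<^bsub>BQ.B\<^esub> BQ.idm x = \<zero>\<^bsub>BQ.B\<^esub>"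
    proof (cases x)
      case (Old k)
      then have k: "k \<in> verts Q" using x by auto
      obtain f where f: "f \<in> carrier T.PA" "a = BQ.proj f" using aB by (rule BQ.B_carrierE)
      \<comment> \<open>The element \<open>\<alpha>\<^sub>k a\<close> is in the \<open>N\<close>-th power, which is zero, and left multiplication by \<open>\<alpha>\<^sub>k\<close> is injective on \<open>e\<^sub>k A\<close>.\<close>
      have "BQ.proj (alpha k) \<otimes>\<^bsub>BQ.B\<^esub> a \<in> radical_power BQ.B (1 + (nilpotency_degree BQ.B - 1))"
        using alpha_radical[OF k] a by (rule BQ.rp_mult)
      then have "BQ.proj (alpha k \<otimes>\<^bsub>T.PA\<^esub> f) = \<zero>\<^bsub>BQ.B\<^esub>"
        using nilpotency_degree_ge_2[OF k] f alpha_closed[OF k] BQ.rp_nilpotency_degree by (simp add: BQ.B_mult)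
      then have "alpha k \<otimes>\<^bsub>T.PA\<^esub> f \<in> TI" using f alpha_closed[OF k] by (simp add: BQ.proj_zero_iff)
      then have "path_elem (Old k, []) \<otimes>\<^bsub>T.PA\<^esub> f \<in> TI" by (rule alpha_cancel[OF k f(1)])
      then have "BQ.idm x \<otimes>\<^bsub>BQ.B\<^esub> a = \<zero>\<^bsub>BQ.B\<^esub>"
        using f x Old by (simp add: BQ.idm_def BQ.B_mult BQ.proj_zero_iff)
      then show ?thesis using BQ.idm_closed[OF x] by simp
    next
      case (Tilde k)
      then have k: "k \<in> verts Q" using x by auto
      \<comment> \<open>The exponent is positive, but the only path that starts at a sink is trivial.\<close>
      have "radical_power BQ.B (nilpotency_degree BQ.B - 1) \<subseteq> radical_power BQ.B 1"
        using nilpotency_degree_ge_2[OF k] by (intro F.power_antimono) simp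
      then have "a \<in> BQ.arrows 1" using a BQ.rp_1 by blast
      then obtain f where f: "f \<in> arrow_ideal_power TQ 1" "a = BQ.proj f" by (auto simp: BQ.arrows_def)
      then have fP: "f \<in> carrier T.PA" by (simp add: T.arrow_ideal_power_iff)
      have "f (x, p) = 0" for p
        using tilde_sink[of k p] T.PA_path[OF fP, of "(x, p)"] f(1) Tilde unfolding T.arrow_ideal_power_iff by force
      then have "(\<lambda>(u, p). if u = x \<and> T.awlast u p = x then f (u, p) else 0) = \<zero>\<^bsub>T.PA\<^esub>"
        by (simp add: T.PA_simps(4) fun_eq_iff)
      then show ?thesis
        using BQ.corner_proj(1)[OF fP x x] f(2) by (simp add: BQ.B_zero)
    qed
  qed
qed

end


section \<open>Quasi-heredity for the second order\<close>

theorem corollary8: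
  fixes n :: nat
    and Q :: "(nat, 'a) pre_digraph"
    and R :: "(nat \<times> 'a list \<Rightarrow> 'k::alg_closed_field) set"
  assumes "fin_digraph Q"
    and "verts Q = {1..n}"
    and "R \<subseteq> carrier (path_algebra Q)"
    and "admissible_ideal Q (Idl\<^bsub>path_algebra Q\<^esub> R)"
  shows "quasi_hereditary (D_algebra Q R) (index_set Q) (D_idem Q R) second_gt"
proof (cases "verts Q = {}")
  case True
  then show ?thesis by (simp add: quasi_hereditary_def index_set_def)
next
  case False
  interpret fin_digraph Q by fact
  interpret finite_quiver Q "TYPE('k)" by unfold_locales
  obtain m where m: "arrow_ideal_power Q m \<subseteq> Idl\<^bsub>path_algebra Q\<^esub> R"
    using assms(4) by (auto simp: admissible_ideal_def)
  have "R \<subseteq> Idl\<^bsub>path_algebra Q\<^esub> R" by (rule ring.genideal_self[OF PA_ring assms(3)])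
  then have "R \<subseteq> arrow_ideal_power Q 1"
    using assms(4) arrow_ideal_power_antimono[of 1 2] by (auto simp: admissible_ideal_def)
  then interpret tilde_bound_quiver Q "TYPE('k)" R m
    using assms(3) m by unfold_locales auto
  have B: "BQ.B = tilde_algebra Q R"
    by (simp add: tilde_algebra_def bound_quiver_algebra_def TI_def)
  have e: "BQ.idm = tilde_idem Q R"
    by (intro ext) (simp only: BQ.idm_def BQ.proj_def tilde_idem_def vertex_idem_def, simp only: TI_def)
  interpret S: second_order_algebra "tilde_algebra Q R" "verts TQ" "tilde_idem Q R" "range Tilde" second_gt
    using tilde_second_order_algebra[OF False] by (simp only: B e)
  interpret M: symmetric_shift_algebra "C_algebra Q R" "verts TQ" S.N S.shift second_gt
    unfolding C_algebra_def by (rule S.MA_symmetric_shift_algebra)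
  interpret H: shift_quasi_hereditary "trivial_extension (C_algebra Q R) (verts TQ \<times> UNIV) (\<lambda>\<nu>. S.shift \<nu> 0)"
    "verts TQ" S.N "\<lambda>\<nu> j. (S.shift \<nu> j, \<lambda>_. 0)" second_gt
    by (rule M.trivial_extension_shift_quasi_hereditary)
  have idem: "(\<lambda>\<nu>. S.shift \<nu> 0) = C_idem Q R"
  proof
    fix \<nu> :: "nat tvert \<times> int"
    show "S.shift \<nu> 0 = C_idem Q R \<nu>"
      by (cases \<nu>) (simp only: S.shift_idem C_idem_def)
  qed
  have D: "D_algebra Q R = trivial_extension (C_algebra Q R) (verts TQ \<times> UNIV) (\<lambda>\<nu>. S.shift \<nu> 0)"
    by (simp only: D_algebra_def index_set_def idem)
  have D_id: "D_idem Q R = (\<lambda>\<nu>. (S.shift \<nu> 0, \<lambda>_. 0))"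
  proof
    fix \<nu>
    show "D_idem Q R \<nu> = (S.shift \<nu> 0, \<lambda>_. 0)" using fun_cong[OF idem, of \<nu>] by (simp only: D_idem_def)
  qed
  show ?thesis unfolding D D_id index_set_def by (rule H.quasi_hereditary)
qed

end
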